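(* Let $\Sigma(x)=\lim_{t\to+\infty}\mathcal{V}(t,x)=\sup_{t>0}\mathcal{V}(t,x)$. For any $x\in\mathbb{R}^n$ we have $$\Sigma(x)=V^r(x).$$ Moreover, $V^r$ is lower semicontinuous and there exists an optimal relaxed control (i.e. for every $x$ the infimum defining $V^r(x)$ is attained).
   Context: Notation. $\mathbb{R}_+=[0,+\infty)$; $\overline{B(0,1)}$ is the closed unit ball of $\mathbb{R}^m$. A modulus is a function $\omega:\mathbb{R}_+\times\mathbb{R}_+\to\mathbb{R}_+$ such that $\omega(\cdot,R)$ is increasing in a neighborhood of $0$, continuous at $0$, with $\omega(0,R)=0$ for every $R>0$, and $\omega(r,\cdot)$ is increasing for every $r$. Data (standing assumptions). $A\subset\mathbb{R}^m$ is either compact or an (unbounded) convex, closed, nontrivial cone containing the origin. $f:\mathbb{R}^n\times A\to\mathbb{R}^n$ and $l:\mathbb{R}^n\times A\to\mathbb{R}$ are continuous; there are integers $q\ge p\ge 1$, $M>0$ and, for every $R>0$, constants $L_R,M_R>0$ and a modulus $\omega(\cdot,R)$ such that, for all $a\in A$ and all $|x|,|x_1|,|x_2|\le R$, $|f(x_1,a)-f(x_2,a)|\le L_R(1+|a|^p)|x_1-x_2|$, $|l(x_1,a)-l(x_2,a)|\le(1+|a|^q)\omega(|x_1-x_2|,R)$, $0\le l(x,a)\le M_R(1+|a|^q)$; and $|f(x,a)|\le M(1+|a|^p)(1+|x|)$ for all $(x,a)$. If $A$ is unbounded, moreover: there are $C_1\ge0$, $C_2>0$ with $l(x,a)\ge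 C_2|a|^q-C_1$ for all $(x,a)\in\mathbb{R}^n\times A$ (same $q$), and for $\Phi\in\{f,l\}$ there is a continuous function $\Phi^\infty$ with $\lim_{\rho\to0^+}\rho^q\Phi(x,\rho^{-1}a)=\Phi^\infty(x,a)$ uniformly on compact subsets of $\mathbb{R}^n\times A$. Original problem. $\mathcal{A}$ is the set of Borel measurable $\alpha:\mathbb{R}_+\to A$ belonging to $L^q_{loc}(\mathbb{R}_+,A)$ (all Borel $\alpha$ if $A$ is compact); $y_x(\cdot,\alpha)$ is the solution of $\dot y=f(y,\alpha)$, $y(0)=x$; $\mathcal{V}(t,x)=\inf_{\alpha\in\mathcal{A}}\int_0^t l(y_x(\tau,\alpha),\alpha(\tau))\,d\tau$. Relaxed problem, $A$ compact. $A^r=\mathcal{P}(A)$ is the set of Radon probability measures on $A$ with the weak$^*$ topology, $\mathcal{A}^r=L^\infty(\mathbb{R}_+,\mathcal{P}(A))$ is the set of relaxed controls; $f^r(x,\mu)=\int_A f(x,a)\,d\mu$, $l^r(x,\mu)=\int_A l(x,a)\,d\mu$; $y^r_x(\cdot,\mu)$ solves $\dot y^r=f^r(y^r,\mu)$, $y^r(0)=x$; $V^r(x)=\inf_{\mu\in\mathcal{A}^r}\int_0^{+\infty} l^r(y^r_x(\tau,\mu),\mu(\tau))\,d\tau\in[0,+\infty]$. Relaxed problem, $A$ unbounded. For $\Phi\in\{f,l\}$, $\overline{\Phi}(x,w_0,w)=w_0^q\Phi(x,w_0^{-1}w)$ if $w_0\ne0$ and $\overline\Phi(x,0,w)=\Phi^\infty(x,w)$,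 for $(x,w_0,w)\in\mathbb{R}^n\times\mathbb{R}_+\times A$. $A^r=\mathcal{P}(\overline{B(0,1)}\cap A)$ is the set of Radon probability measures on $\overline{B(0,1)}\cap A$ with the weak$^*$ topology, $\Gamma^r=L^\infty(\mathbb{R}_+,A^r)$ is the set of relaxed controls; for $\psi\in\{\overline f,\overline l\}$, $\psi^r(x,\mu)=\int_{\overline{B(0,1)}\cap A}\psi(x,(1-|w|^q)^{1/q},w)\,d\mu$; $\xi^r_x(\cdot,\mu)$ solves $\dot\xi^r=\overline f^r(\xi^r,\mu)$, $\xi^r(0)=x$; $V^r(x)=\inf_{\mu\in\Gamma^r}\int_0^{+\infty}\overline l^r(\xi^r_x(s,\mu),\mu(s))\,ds\in[0,+\infty]$. *)

theory Defs
  imports "HOL-Probability.Probability"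
begin

section \<open>Moduli\<close>

text \<open>The domain is the quarter plane of nonnegative pairs; \<open>\<omega>\<close> is irrelevant elsewhere.
  "Increasing" is read in the weak sense.\<close>

definition modulus :: "(real \<Rightarrow> real \<Rightarrow> real) \<Rightarrow> bool" where
  "modulus \<omega> \<longleftrightarrow>
     (\<forall>r\<ge>0. \<forall>R\<ge>0. 0 \<le> \<omega> r R) \<and>
     (\<forall>R>0. (\<exists>\<delta>>0. mono_on {0..<\<delta>} (\<lambda>r. \<omega> r R)) \<and>
            continuous (at 0 within {0..}) (\<lambda>r. \<omega> r R) \<and> \<omega> 0 R = 0) \<and>
     (\<forall>r\<ge>0. mono_on {0..} (\<lambda>R. \<omega> r R))"

section \<open>Trajectories and costs\<close>

text \<open>Caratheodory solutions on \<open>[0, \<infinity>)\<close> of \<open>y' = g(\<tau>, y)\<close>, \<open>y(0) = x\<close>, in integrated form: locally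
  absolutely continuous functions satisfying the differential equation almost everywhere.
  Extensionality only fixes the irrelevant values at negative times, so that "the" solution is
  a unique object of type \<^typ>\<open>real \<Rightarrow> 'b\<close>.\<close>

definition solution ::
  "(real \<Rightarrow> 'b \<Rightarrow> 'b::euclidean_space) \<Rightarrow> 'b \<Rightarrow> (real \<Rightarrow> 'b) \<Rightarrow> bool" where
  "solution g x y \<longleftrightarrow> y \<in> extensional {0..} \<and>
     (\<forall>t\<ge>0. set_integrable lebesgue {0..t} (\<lambda>\<tau>. g \<tau> (y \<tau>)) \<and>
             y t = x + (LINT \<tau>:{0..t}|lebesgue. g \<tau> (y \<tau>)))"

text \<open>The type \<open>'u\<close> of control values is \<open>real ^ 'm\<close> for the original problem and
  \<open>(real ^ 'm) measure\<close> for the relaxed one.\<close>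

definition trajectory ::
  "('b \<Rightarrow> 'u \<Rightarrow> 'b::euclidean_space) \<Rightarrow> 'b \<Rightarrow> (real \<Rightarrow> 'u) \<Rightarrow> real \<Rightarrow> 'b" where
  "trajectory F x u = (THE y. solution (\<lambda>\<tau> z. F z (u \<tau>)) x y)"

text \<open>Costs take values in \<open>[0, \<infinity>]\<close>; \<^const>\<open>ennreal\<close> loses nothing because the running costs
  considered are nonnegative.\<close>

definition cost ::
  "('b \<Rightarrow> 'u \<Rightarrow> 'b::euclidean_space) \<Rightarrow> ('b \<Rightarrow> 'u \<Rightarrow> real) \<Rightarrow> real set \<Rightarrow> 'b \<Rightarrow> (real \<Rightarrow> 'u) \<Rightarrow> ennreal"
  where
  "cost F L I x u = (\<integral>\<^sup>+\<tau>\<in>I. ennreal (L (trajectory F x u \<tau>) (u \<tau>)) \<partial>lebesgue)"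

section \<open>The original problem\<close>

definition controls :: "('a::euclidean_space) set \<Rightarrow> nat \<Rightarrow> (real \<Rightarrow> 'a) set" where
  "controls A q =
     {\<alpha> \<in> restrict_space borel {0..} \<rightarrow>\<^sub>M restrict_space borel A.
        compact A \<or> (\<forall>T>0. set_integrable lebesgue {0..T} (\<lambda>\<tau>. norm (\<alpha> \<tau>) ^ q))}"

definition value_fun ::
  "('a::euclidean_space) set \<Rightarrow> nat \<Rightarrow> ('b \<Rightarrow> 'a \<Rightarrow> 'b::euclidean_space) \<Rightarrow> ('b \<Rightarrow> 'a \<Rightarrow> real) \<Rightarrow>
   real \<Rightarrow> 'b \<Rightarrow> ennreal" where
  "value_fun A q f l t x = (INF \<alpha>\<in>controls A q. cost f l {0..t} x \<alpha>)"

definition Sigma_fun ::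
  "('a::euclidean_space) set \<Rightarrow> nat \<Rightarrow> ('b \<Rightarrow> 'a \<Rightarrow> 'b::euclidean_space) \<Rightarrow> ('b \<Rightarrow> 'a \<Rightarrow> real) \<Rightarrow>
   'b \<Rightarrow> ennreal" where
  "Sigma_fun A q f l x = (SUP t\<in>{0<..}. value_fun A q f l t x)"

section \<open>Relaxed controls\<close>

text \<open>Used for compact \<open>K\<close> only, where every Borel probability measure is Radon.\<close>

definition prob_measures :: "('a::euclidean_space) set \<Rightarrow> 'a measure set" where
  "prob_measures K = space (prob_algebra (restrict_space borel K))"

definition weak_star_topology :: "('a::euclidean_space) set \<Rightarrow> 'a measure topology" where
  "weak_star_topology K = topology_generated_by
     {{\<mu> \<in> prob_measures K. (LINT a|\<mu>. \<phi> a) \<in> U} |(\<phi> :: 'a \<Rightarrow> real) U. continuous_on K \<phi> \<and> open U}"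

text \<open>Representatives of the elements of \<open>L\<^sup>\<infinity>(\<real>\<^sub>+, P(K))\<close>: Lebesgue measurable maps into \<open>P(K)\<close> with
  the Borel sets of the weak* topology. Essential boundedness is automatic, as probability
  measures have total variation 1.\<close>

definition relaxed_controls :: "('a::euclidean_space) set \<Rightarrow> (real \<Rightarrow> 'a measure) set" where
  "relaxed_controls K =
     restrict_space lebesgue {0..} \<rightarrow>\<^sub>M
       sigma (topspace (weak_star_topology K)) {U. openin (weak_star_topology K) U}"

definition relax ::
  "('b \<Rightarrow> 'a \<Rightarrow> 'c::euclidean_space) \<Rightarrow> 'b \<Rightarrow> 'a measure \<Rightarrow> 'c" where
  "relax \<Phi> x \<mu> = (LINT a|\<mu>. \<Phi> x a)"

section \<open>Compactification for unbounded control sets\<close>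

definition is_recession ::
  "('a::euclidean_space) set \<Rightarrow> nat \<Rightarrow> ('b::euclidean_space \<Rightarrow> 'a \<Rightarrow> 'c::euclidean_space) \<Rightarrow>
   ('b \<Rightarrow> 'a \<Rightarrow> 'c) \<Rightarrow> bool" where
  "is_recession A q \<Phi> \<Phi>inf \<longleftrightarrow>
     continuous_on (UNIV \<times> A) (\<lambda>(x, a). \<Phi>inf x a) \<and>
     (\<forall>K. compact K \<and> K \<subseteq> UNIV \<times> A \<longrightarrow>
        uniform_limit K (\<lambda>\<rho> (x, a). \<rho> ^ q *\<^sub>R \<Phi> x (inverse \<rho> *\<^sub>R a)) (\<lambda>(x, a). \<Phi>inf x a) (at_right 0))"

definition extended ::
  "nat \<Rightarrow> ('b \<Rightarrow> 'a \<Rightarrow> 'c) \<Rightarrow> ('b \<Rightarrow> 'a \<Rightarrow> 'c) \<Rightarrow>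
   'b \<Rightarrow> real \<Rightarrow> 'a::euclidean_space \<Rightarrow> 'c::euclidean_space" where
  "extended q \<Phi> \<Phi>inf x w0 w =
     (if w0 \<noteq> 0 then w0 ^ q *\<^sub>R \<Phi> x (inverse w0 *\<^sub>R w) else \<Phi>inf x w)"

section \<open>The relaxed problem\<close>

definition relaxed_base :: "('a::euclidean_space) set \<Rightarrow> 'a set" where
  "relaxed_base A = (if bounded A then A else cball 0 1 \<inter> A)"

text \<open>The functions \<open>f\<^sup>r\<close>, \<open>l\<^sup>r\<close> if \<open>A\<close> is bounded, and the relaxations of the extended data
  restricted to \<open>w0 = (1 - |w|^q)^(1/q)\<close> otherwise.\<close>

definition relaxed_data ::
  "('a::euclidean_space) set \<Rightarrow> nat \<Rightarrow> ('b \<Rightarrow> 'a \<Rightarrow> 'c) \<Rightarrow> ('b \<Rightarrow> 'a \<Rightarrow> 'c) \<Rightarrow>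
   'b \<Rightarrow> 'a measure \<Rightarrow> 'c::euclidean_space" where
  "relaxed_data A q \<Phi> \<Phi>inf =
     (if bounded A then relax \<Phi>
      else relax (\<lambda>x w. extended q \<Phi> \<Phi>inf x (root q (1 - norm w ^ q)) w))"

definition relaxed_cost ::
  "('a::euclidean_space) set \<Rightarrow> nat \<Rightarrow>
   ('b \<Rightarrow> 'a \<Rightarrow> 'b::euclidean_space) \<Rightarrow> ('b \<Rightarrow> 'a \<Rightarrow> 'b) \<Rightarrow> ('b \<Rightarrow> 'a \<Rightarrow> real) \<Rightarrow> ('b \<Rightarrow> 'a \<Rightarrow> real) \<Rightarrow>
   'b \<Rightarrow> (real \<Rightarrow> 'a measure) \<Rightarrow> ennreal" where
  "relaxed_cost A q f finf l linf x \<mu> =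
     cost (relaxed_data A q f finf) (relaxed_data A q l linf) {0..} x \<mu>"

definition relaxed_value ::
  "('a::euclidean_space) set \<Rightarrow> nat \<Rightarrow>
   ('b \<Rightarrow> 'a \<Rightarrow> 'b::euclidean_space) \<Rightarrow> ('b \<Rightarrow> 'a \<Rightarrow> 'b) \<Rightarrow> ('b \<Rightarrow> 'a \<Rightarrow> real) \<Rightarrow> ('b \<Rightarrow> 'a \<Rightarrow> real) \<Rightarrow>
   'b \<Rightarrow> ennreal" where
  "relaxed_value A q f finf l linf x =
     (INF \<mu>\<in>relaxed_controls (relaxed_base A). relaxed_cost A q f finf l linf x \<mu>)"

section \<open>Semicontinuity\<close>

definition lower_semicontinuous :: "('b::topological_space \<Rightarrow> ennreal) \<Rightarrow> bool" where
  "lower_semicontinuous V \<longleftrightarrow> (\<forall>x. V x \<le> Liminf (at x) V)"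

end

theory Submission
  imports Defs
begin

text \<open>If \<open>A\<close> is unbounded, the time change with speed \<open>1 + |\<alpha>|^q\<close> turns an ordinary control \<open>\<alpha>\<close> into a
  control with values \<open>w\<close> in the part \<open>|w| < 1\<close> of the compact set \<open>cball 0 1 \<inter> A\<close>, on which the
  extended data are continuous, Lipschitz in the state and of linear growth; the converse holds for
  controls bounded away from \<open>|w| = 1\<close>. So in both cases one deals with a problem on a compact set \<open>K\<close>.

  Relaxed controls are Markov kernels from the half-line to \<open>K\<close>. They are sequentially compact for the
  convergence of \<open>\<integral>\<^sub>0\<^sup>t \<integral> \<phi> d\<mu>\<^sub>s ds\<close> for all continuous \<open>\<phi>\<close> and all \<open>t\<close>, and trajectories and costs
  on bounded intervals are continuous for it. For the compactness, a space-filling curve with a Borel section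
  transports the kernels to the real line, where a diagonal argument on distribution functions
  and the Radon-Nikodym theorem give the limit kernel. Applied to almost optimal controls on longer and
  longer horizons this gives a relaxed control of cost at most \<open>\<Sigma>(x)\<close>, and applied to optimal controls for
  converging initial states it gives lower semicontinuity.

  Conversely every kernel is a limit of rapidly oscillating ordinary controls with finitely many
  values in a dense subset of \<open>K\<close>. If \<open>A\<close> is unbounded, coercivity forces the original time along a
  relaxed control of finite cost to tend to infinity, so these ordinary controls eventually cover
  every horizon \<open>t\<close>, which gives \<open>\<Sigma> \<le> V\<^sup>r\<close>.\<close>

section \<open>Integrals along kernels\<close>

text \<open>The time change sets \<open>w = \<alpha> / (1 + |\<alpha>|^q)^(1/q)\<close>, so original
  time runs at the rate \<open>1 - |w|^q\<close>, which vanishes exactly where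
  \<open>|w| = 1\<close>. This is why the approximating controls take finitely many values with
  \<open>|w| < 1\<close>: their rate has a positive minimum, and the control they induce in original
  time is bounded, hence locally in \<open>L^q\<close>.

  Trajectories are definite descriptions, so existence and uniqueness must both be known. For an
  unbounded \<alpha> they are inherited from the compactified equation through the time change.

  Relaxed controls are measurable for the Borel sets of the weak-star topology, whereas the analysis
  uses measurability of the mass of each Borel set. The two notions agree; the harder inclusion
  rests on a countable base of that topology.

  The detour through the line pays because a measure there is its distribution function: it suffices
  to follow countably many rational levels, whose time integrals are Lipschitz in the horizon and
  therefore have densities.\<close>

abbreviation halfline :: "real measure" where
  "halfline \<equiv> restrict_space lebesgue {0..}"

lemma set_borel_measurable_halfline:
  fixes h :: "real \<Rightarrow> 'c::{banach,second_countable_topology}"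
  assumes "h \<in> borel_measurable halfline" "S \<in> sets lebesgue" "S \<subseteq> {0..}"
  shows "set_borel_measurable lebesgue S h"
proof -
  have "set_borel_measurable lebesgue {0..} h"
    using assms(1) unfolding set_borel_measurable_def
    by (subst (asm) borel_measurable_restrict_space_iff) auto
  then show ?thesis using assms by (rule_tac set_borel_measurable_subset) auto
qed

lemma set_integrable_halfline:
  fixes h :: "real \<Rightarrow> 'c::{banach,second_countable_topology}"
  assumes "h \<in> borel_measurable halfline" "S \<in> lmeasurable" "S \<subseteq> {0..}"
    and "\<And>s. s \<in> S \<Longrightarrow> norm (h s) \<le> C"
  shows "set_integrable lebesgue S h"
proof (rule set_integrable_bound)
  show "set_integrable lebesgue S (\<lambda>_. C)"
    using assms(2) unfolding set_integrable_def
    by (auto simp: fmeasurable_def intro!: integrable_mult_left integrable_real_indicator)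
  show "set_borel_measurable lebesgue S h"
    using assms by (intro set_borel_measurable_halfline) (auto simp: fmeasurable_def)
  show "AE x in lebesgue. x \<in> S \<longrightarrow> norm (h x) \<le> norm C"
    using assms(4) by (auto intro!: AE_I2 order_trans[OF assms(4)])
qed

lemma norm_set_integral_le:
  fixes h :: "real \<Rightarrow> 'c::euclidean_space"
  assumes "h \<in> borel_measurable halfline" "0 \<le> a" "a \<le> b"
    and "\<And>s. s \<in> {a..b} \<Longrightarrow> norm (h s) \<le> C"
  shows "norm (LINT s:{a..b}|lebesgue. h s) \<le> C * (b - a)"
proof -
  have i: "set_integrable lebesgue {a..b} h"
    by (rule set_integrable_halfline[OF assms(1)]) (use assms in auto)
  have c: "set_integrable lebesgue {a..b} (\<lambda>_. C)"
    by (rule set_integrable_halfline[where C="\<bar>C\<bar>"]) (use assms in auto)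
  have "norm (LINT s:{a..b}|lebesgue. h s) \<le> (LINT s:{a..b}|lebesgue. norm (h s))"
    using i by (rule set_integral_norm_bound)
  also have "\<dots> \<le> (LINT s:{a..b}|lebesgue. C)"
    using assms c set_integrable_norm[OF i] by (intro set_integral_mono) auto
  also have "\<dots> = C * (b - a)" using assms by (simp add: set_lebesgue_integral_def)
  finally show ?thesis .
qed

lemma set_integral_Icc_combine:
  fixes h :: "real \<Rightarrow> 'c::euclidean_space"
  assumes "set_integrable lebesgue {a..c} h" "a \<le> b" "b \<le> c"
  shows "(LINT s:{a..c}|lebesgue. h s) = (LINT s:{a..b}|lebesgue. h s) + (LINT s:{b..c}|lebesgue. h s)"
proof -
  have i: "set_integrable lebesgue {a..b} h" "set_integrable lebesgue {b..c} h"
    using assms by (auto intro: set_integrable_subset[OF assms(1)])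
  have "integral {a..b} h + integral {b..c} h = integral {a..c} h"
    using assms by (intro Henstock_Kurzweil_Integration.integral_combine set_lebesgue_integral_eq_integral(1)) auto
  then show ?thesis
    using set_lebesgue_integral_eq_integral(2)[OF i(1)] set_lebesgue_integral_eq_integral(2)[OF i(2)]
      set_lebesgue_integral_eq_integral(2)[OF assms(1)] by simp
qed

lemma prob_algebraD:
  assumes "\<mu> \<in> halfline \<rightarrow>\<^sub>M prob_algebra N" "0 \<le> s"
  shows "prob_space (\<mu> s)" "sets (\<mu> s) = sets N" "space (\<mu> s) = space N"
proof -
  have "\<mu> s \<in> space (prob_algebra N)" using assms by (intro measurable_space[OF assms(1)]) (auto simp: space_restrict_space)
  then show "prob_space (\<mu> s)" "sets (\<mu> s) = sets N" by (auto simp: space_prob_algebra)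
  then show "space (\<mu> s) = space N" by (auto dest: sets_eq_imp_space_eq)
qed

lemma measurable_kernel_integral:
  fixes \<phi> :: "'a \<Rightarrow> 'c::{banach,second_countable_topology}"
  assumes "\<mu> \<in> halfline \<rightarrow>\<^sub>M prob_algebra N" "\<phi> \<in> borel_measurable N"
  shows "(\<lambda>s. LINT a|\<mu> s. \<phi> a) \<in> borel_measurable halfline"
  using measurable_compose[OF measurable_prob_algebraD[OF assms(1)] integral_measurable_subprob_algebra[OF assms(2)]] by simp

lemma (in prob_space) norm_integral_le_const:
  fixes \<phi> :: "'a \<Rightarrow> 'c::{banach,second_countable_topology}"
  assumes "\<phi> \<in> borel_measurable M" "\<And>a. a \<in> space M \<Longrightarrow> norm (\<phi> a) \<le> C"
  shows "integrable M \<phi>" "norm (LINT a|M. \<phi> a) \<le> C"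
proof -
  show i: "integrable M \<phi>" using assms by (intro integrable_const_bound[of _ C]) auto
  have "norm (LINT a|M. \<phi> a) \<le> (LINT a|M. norm (\<phi> a))" by (rule integral_norm_bound)
  also have "\<dots> \<le> (LINT a|M. C)" using i assms by (intro integral_mono) auto
  finally show "norm (LINT a|M. \<phi> a) \<le> C" by (simp add: prob_space)
qed

lemma kernel_integral_bound:
  fixes \<phi> :: "'a \<Rightarrow> 'c::{banach,second_countable_topology}"
  assumes "\<mu> \<in> halfline \<rightarrow>\<^sub>M prob_algebra N" "\<phi> \<in> borel_measurable N"
    "\<And>a. a \<in> space N \<Longrightarrow> norm (\<phi> a) \<le> C" "0 \<le> s"
  shows "integrable (\<mu> s) \<phi>" "norm (LINT a|\<mu> s. \<phi> a) \<le> C"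
  using prob_space.norm_integral_le_const[of "\<mu> s" \<phi> C] prob_algebraD[OF assms(1,4)] assms(2,3)
  by (auto simp: measurable_cong_sets[OF prob_algebraD(2)[OF assms(1,4)] refl])

text \<open>The law \<open>N\<close> is the mixture of the measures \<open>\<nu> s\<close> for
  \<open>s\<close> uniform on \<open>[0,T]\<close>, a Giry bind. It turns convergence of time
  integrals of a family into weak convergence of single distributions on the line, which can be
  tested with distribution functions. \<open>C\<close> is a free assignment of bounds to test
  functions.\<close>

lemma average_distribution:
  fixes \<nu> :: "real \<Rightarrow> real measure"
  assumes \<nu>: "\<nu> \<in> halfline \<rightarrow>\<^sub>M prob_algebra borel" and T: "0 < T"
  obtains N where "real_distribution N"
    "\<And>\<phi>::real\<Rightarrow>real. \<phi> \<in> borel_measurable borel \<Longrightarrow> (\<And>c. \<bar>\<phi> c\<bar> \<le> C \<phi>) \<Longrightarrow>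
      (LINT c|N. \<phi> c) = (LINT s:{0..T}|lebesgue. LINT c|\<nu> s. \<phi> c) / T"
proof -
  \<comment> \<open>The uniform law on \<open>[0,T]\<close>, carried by the half-line because
    \<open>\<nu>\<close> is measurable only there.\<close>
  define M where "M = density halfline (\<lambda>s. ennreal (indicator {0..T} s / T))"
  have [measurable]: "(\<lambda>s. indicator {0..T} s / T) \<in> borel_measurable halfline"
    by (intro measurable_restrict_space1 borel_measurable_divide borel_measurable_indicator) auto
  have sM: "sets M = sets halfline" "space M = {0..}" by (auto simp: M_def space_restrict_space)
  have int: "(LINT s|M. h s) = (LINT s:{0..T}|lebesgue. h s) / T" if h: "h \<in> borel_measurable halfline" for h :: "real \<Rightarrow> real"
  proof -
    have "(LINT s|M. h s) = (LINT s|halfline. (indicator {0..T} s / T) * h s)"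
      unfolding M_def using h T by (subst integral_density) auto
    also have "\<dots> = (LINT s|lebesgue. indicator {0..} s * ((indicator {0..T} s / T) * h s))"
      by (subst integral_restrict_space) auto
    also have "\<dots> = (LINT s|lebesgue. (indicator {0..T} s * h s) / T)"
      by (intro Bochner_Integration.integral_cong) (auto simp: indicator_def)
    finally show ?thesis by (simp add: set_lebesgue_integral_def)
  qed
  have em: "emeasure M (space M) = 1"
  proof -
    have "emeasure M (space M) = (\<integral>\<^sup>+s. ennreal (indicator {0..T} s / T) * indicator {0..} s \<partial>halfline)"
      unfolding sM unfolding M_def by (subst emeasure_density) (auto simp: sets_restrict_space)
    also have "\<dots> = (\<integral>\<^sup>+s. (ennreal (indicator {0..T} s / T) * indicator {0..} s) * indicator {0..} s \<partial>lebesgue)"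
      by (subst nn_integral_restrict_space) auto
    also have "\<dots> = (\<integral>\<^sup>+s. ennreal (1 / T) * indicator {0..T} s \<partial>lebesgue)"
      by (intro nn_integral_cong) (auto simp: indicator_def)
    also have "\<dots> = 1" using T by (simp add: nn_integral_cmult_indicator ennreal_mult[symmetric])
    finally show ?thesis .
  qed
  interpret M: prob_space M by (rule prob_spaceI) (rule em)
  have k: "\<nu> \<in> M \<rightarrow>\<^sub>M subprob_algebra borel"
    using measurable_prob_algebraD[OF \<nu>] by (simp add: measurable_cong_sets[OF sM(1) refl])
  have ps: "prob_space (\<nu> s)" "sets (\<nu> s) = sets borel" "space (\<nu> s) = UNIV" if "s \<in> space M" for s
    using prob_algebraD[OF \<nu>] that by (auto simp: sM)
  let ?N = "M \<bind> \<nu>"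
  have "prob_space ?N" using ps by (intro M.prob_space_bind[OF _ k]) auto
  moreover have sN: "sets ?N = sets borel" using k ps sM by (intro sets_bind) (auto)
  ultimately have "real_distribution ?N"
    by (auto simp: real_distribution_def real_distribution_axioms_def)
  moreover have "(LINT c|?N. \<phi> c) = (LINT s:{0..T}|lebesgue. LINT c|\<nu> s. \<phi> c) / T" 
    if "\<phi> \<in> borel_measurable borel" "\<And>c. \<bar>\<phi> c\<bar> \<le> C \<phi>" for \<phi> :: "real \<Rightarrow> real"
  proof -
    have "(LINT c|?N. \<phi> c) = (LINT s|M. LINT c|\<nu> s. \<phi> c)"
    proof (rule integral_bind[of \<phi> borel "C \<phi>" \<nu> M 1])
      show "AE s in M. emeasure (\<nu> s) (space (\<nu> s)) \<le> ennreal 1"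
        by (intro AE_I2) (metis ennreal_1 order_refl prob_space.emeasure_space_1 ps(1))
    qed (use that k in \<open>auto simp: M.finite_measure_axioms\<close>)
    also have "\<dots> = (LINT s:{0..T}|lebesgue. LINT c|\<nu> s. \<phi> c) / T"
      using that by (intro int measurable_kernel_integral[OF \<nu>])
    finally show ?thesis .
  qed
  ultimately show ?thesis by (rule that)
qed

section \<open>Compactness of Young measures\<close>

lemma emeasure_interval_measure_add:
  fixes F G :: "real \<Rightarrow> real"
  assumes F: "mono F" "\<And>x. continuous (at_right x) F"
    and G: "mono G" "\<And>x. continuous (at_right x) G"
    and A: "A \<in> sets borel"
  shows "emeasure (interval_measure (\<lambda>x. F x + G x)) A =
    emeasure (interval_measure F) A + emeasure (interval_measure G) A"
proof -
  let ?f = "\<lambda>A. emeasure (interval_measure F) A + emeasure (interval_measure G) A"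
  \<comment> \<open>The setwise sum is made into a measure, so that uniqueness on the
    intersection-stable half-open intervals applies.\<close>
  define N where "N = measure_of UNIV (sets borel) ?f"
  have sN: "sets N = sets (borel :: real measure)"
    unfolding N_def using sets.sigma_sets_eq[of "borel :: real measure"] by simp
  have eN: "emeasure N X = ?f X" if "X \<in> sets borel" for X
    unfolding N_def
  proof (rule emeasure_measure_of_sigma)
    show "sigma_algebra UNIV (sets (borel :: real measure))"
      using sets.sigma_algebra_axioms[of "borel :: real measure"] by simp
    show "positive (sets borel) ?f" by (simp add: positive_def)
    show "countably_additive (sets borel) ?f"
      unfolding countably_additive_def
      by (auto simp: suminf_add[symmetric] suminf_emeasure)
    show "X \<in> sets borel" by fact
  qed
  have "interval_measure (\<lambda>x. F x + G x) = N"
  proof (rule measure_eqI_generator_eq[where \<Omega>=UNIV and E="range (\<lambda>(a, b). {a<..b::real})"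
        and A="\<lambda>i. {- real i<..real i}"])
    show "Int_stable (range (\<lambda>(a, b). {a<..b::real}))"
      by (auto simp: Int_stable_def Int_greaterThanAtMost)
    show "sets (interval_measure (\<lambda>x. F x + G x)) = sigma_sets UNIV (range (\<lambda>(a, b). {a<..b}))"
      "sets N = sigma_sets UNIV (range (\<lambda>(a, b). {a<..b}))"
      by (simp_all add: sN borel_sigma_sets_Ioc)
    show "(\<Union>i. {- real i<..real i}) = UNIV" by (rule UN_Ioc_eq_UNIV)
    fix i show "emeasure (interval_measure (\<lambda>x. F x + G x)) {- real i<..real i} \<noteq> \<infinity>"
      using F G by (subst emeasure_interval_measure_Ioc) (auto intro!: add_mono continuous_intros simp: mono_def)
  next
    fix X assume "X \<in> range (\<lambda>(a, b). {a<..b::real})"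
    then obtain a b where X: "X = {a<..b}" by auto
    have ge: "F a \<le> F b" "G a \<le> G b" if "a \<le> b" using that F G by (auto simp: mono_def)
    show "emeasure (interval_measure (\<lambda>x. F x + G x)) X = emeasure N X"
    proof (cases "a \<le> b")
      case True
      show ?thesis unfolding X
        apply (subst eN, simp)
        using True F G ge
        apply (subst (1 2 3) emeasure_interval_measure_Ioc)
        apply (auto intro!: add_mono continuous_intros simp: mono_def ennreal_plus[symmetric] algebra_simps simp del: ennreal_plus)
        done
    next
      case False
      then show ?thesis by (simp add: X eN)
    qed
  qed auto
  then show ?thesis using eN[OF A] by simp
qed

text \<open>Since \<open>x - H x\<close> is nondecreasing as well, the Stieltjes measures of
  \<open>H\<close> and of \<open>x - H x\<close> add up to Lebesgue measure. So the measure of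
  \<open>H\<close> is absolutely continuous, and Radon-Nikodym gives its density.\<close>

lemma lipschitz_mono_density:
  fixes H :: "real \<Rightarrow> real"
  assumes H: "\<And>a b. a \<le> b \<Longrightarrow> 0 \<le> H b - H a \<and> H b - H a \<le> b - a"
  shows "\<exists>g. g \<in> borel_measurable borel \<and> interval_measure H = density lborel (\<lambda>s. ennreal (g s)) \<and> (\<forall>s. 0 \<le> g s)"
    and "\<And>a. continuous (at_right a) H"
    and "continuous_on UNIV H"
proof -
  have lip: "\<bar>H x - H y\<bar> \<le> \<bar>x - y\<bar>" for x y
    using H[of x y] H[of y x] by (cases "x \<le> y") auto
  have cH: "isCont H x" for x
    unfolding continuous_at_eps_delta dist_real_def using lip by (meson le_less_trans)
  then show "continuous_on UNIV H" by (simp add: continuous_at_imp_continuous_on)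
  show c: "continuous (at_right a) H" for a using cH
    by (simp add: continuous_at_imp_continuous_within)
  have m: "mono H" "mono (\<lambda>x. x - H x)" using H by (force simp: mono_def)+
  have sum: "emeasure lborel A = emeasure (interval_measure H) A + emeasure (interval_measure (\<lambda>x. x - H x)) A"
    if "A \<in> sets borel" for A
    using emeasure_interval_measure_add[OF m(1) c m(2) _ that] c
    by (simp add: lborel_eq_real continuous_intros)
  have "absolutely_continuous lborel (interval_measure H)"
    unfolding absolutely_continuous_def null_sets_def using sum by auto
  then obtain g where g: "g \<in> borel_measurable lborel" "density lborel g = interval_measure H"
    using sigma_finite_measure.Radon_Nikodym[OF lborel.sigma_finite_measure_axioms] by force
  have "sigma_finite_measure (density lborel g)" unfolding g
    using sigma_finite_interval_measure[of H] c m by (auto simp: mono_def)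
  \<comment> \<open>The Radon-Nikodym density takes values in \<open>[0,\<infinity>]\<close>;
    sigma-finiteness of the measure of \<open>H\<close> makes it finite almost everywhere, so a real
    function can replace it.\<close>
  then have "AE x in lborel. g x \<noteq> \<infinity>" 
    using sigma_finite_measure.sigma_finite_iff_density_finite[OF lborel.sigma_finite_measure_axioms g(1)] by simp
  then have "density lborel g = density lborel (\<lambda>s. ennreal (enn2real (g s)))"
    using g(1) by (intro density_cong) (auto simp: less_top)
  then show "\<exists>g. g \<in> borel_measurable borel \<and> interval_measure H = density lborel (\<lambda>s. ennreal (g s)) \<and> (\<forall>s. 0 \<le> g s)"
    using g by (intro exI[of _ "\<lambda>s. enn2real (g s)"]) auto
qed

text \<open>The difference \<open>H2 - H1\<close> is again monotone and 1-Lipschitz and so has a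
  density \<open>h \<ge> 0\<close>; additivity and uniqueness of densities give
  \<open>g2 = g1 + h\<close>. Applied to two levels, this shows that the densities are ordered like
  the values of a distribution function.\<close>

lemma density_mono_AE:
  fixes H1 H2 g1 g2 :: "real \<Rightarrow> real"
  assumes H1: "\<And>a b. a \<le> b \<Longrightarrow> 0 \<le> H1 b - H1 a \<and> H1 b - H1 a \<le> b - a"
   and H: "\<And>a b. a \<le> b \<Longrightarrow> H1 b - H1 a \<le> H2 b - H2 a \<and> H2 b - H2 a \<le> b - a"
   and g1: "g1 \<in> borel_measurable borel" "interval_measure H1 = density lborel (\<lambda>s. ennreal (g1 s))" "\<And>s. 0 \<le> g1 s"
   and g2: "g2 \<in> borel_measurable borel" "interval_measure H2 = density lborel (\<lambda>s. ennreal (g2 s))" "\<And>s. 0 \<le> g2 s"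
  shows "AE s in lborel. g1 s \<le> g2 s"
proof -
  define D where "D = (\<lambda>x. H2 x - H1 x)"
  have D: "0 \<le> D b - D a \<and> D b - D a \<le> b - a" if "a \<le> b" for a b
    using H1[OF that] H[OF that] by (auto simp: D_def)
  obtain h where h: "h \<in> borel_measurable borel" "interval_measure D = density lborel (\<lambda>s. ennreal (h s))" "\<And>s. 0 \<le> h s"
    using lipschitz_mono_density(1)[of D] D by auto
  have m: "mono H1" "mono D" using H1 D by (force simp: mono_def)+
  have e: "(\<lambda>x. H1 x + D x) = H2" by (auto simp: D_def)
  have "density lborel (\<lambda>s. ennreal (g2 s)) = density lborel (\<lambda>s. ennreal (g1 s + h s))"
  proof (rule measure_eqI)
    fix A assume "A \<in> sets (density lborel (\<lambda>s. ennreal (g2 s)))"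
    then have A[measurable]: "A \<in> sets borel" by simp
    note [measurable] = g1(1) g2(1) h(1)
    have "emeasure (interval_measure H2) A = emeasure (interval_measure H1) A + emeasure (interval_measure D) A"
      using emeasure_interval_measure_add[OF m(1) lipschitz_mono_density(2) m(2) lipschitz_mono_density(2) A] H1 D
      unfolding e by blast
    also have "\<dots> = emeasure (density lborel (\<lambda>s. ennreal (g1 s + h s))) A"
      unfolding g1(2) h(2)
      by (simp add: emeasure_density nn_integral_add[symmetric] distrib_right[symmetric] ennreal_plus g1 h)
    finally show "emeasure (density lborel (\<lambda>s. ennreal (g2 s))) A = emeasure (density lborel (\<lambda>s. ennreal (g1 s + h s))) A"
      by (simp add: g2)
  qed simp
  then have "AE s in lborel. ennreal (g2 s) = ennreal (g1 s + h s)"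
    by (intro sigma_finite_measure.density_unique[OF lborel.sigma_finite_measure_axioms]) (use g1 g2 h in auto)
  then show ?thesis
    by eventually_elim (smt (verit) ennreal_inj add_nonneg_nonneg g1(3) g2(3) h(3) ennreal_plus)
qed

text \<open>A countable product of compact intervals is compact and first countable, hence
  sequentially compact; this replaces an explicit diagonal extraction.\<close>

lemma pointwise_convergent_subsequence:
  fixes u :: "nat \<Rightarrow> nat \<Rightarrow> real"
  assumes "\<And>n i. u n i \<in> {a i..b i}"
  obtains r where "strict_mono r" "\<And>i. convergent (\<lambda>n. u (r n) i)"
proof -
  let ?K = "PiE UNIV (\<lambda>i. {a i..b i})"
  have "compactin (product_topology (\<lambda>i. euclidean) UNIV) ?K"
    by (simp add: compactin_PiE)
  then have "compact ?K" by (simp add: euclidean_product_topology)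
  then have "seq_compact ?K" by (rule compact_imp_seq_compact)
  moreover have "\<forall>n. u n \<in> ?K" using assms by auto
  ultimately obtain v r where "strict_mono r" and lim: "(u \<circ> r) \<longlonglongrightarrow> v"
    by (metis seq_compactE)
  have "(\<lambda>n. u (r n) i) \<longlonglongrightarrow> v i" for i
    using continuous_on_tendsto_compose[OF continuous_on_product_coordinates[of i] lim] by (simp add: o_def)
  then show ?thesis using that \<open>strict_mono r\<close> by (auto simp: convergent_def)
qed

text \<open>Convergence is first obtained at the countably many rational times and levels. As all
  functions are 1-Lipschitz in time, it extends to every time by a three-epsilon argument.\<close>

lemma equilipschitz_convergent_subsequence:
  fixes G :: "nat \<Rightarrow> real \<Rightarrow> rat \<Rightarrow> real"
  assumes G: "\<And>k a b c. 0 \<le> a \<Longrightarrow> a \<le> b \<Longrightarrow> 0 \<le> G k b c - G k a c \<and> G k b c - G k a c \<le> b - a"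
   and G0: "\<And>k c. G k 0 c = 0"
  obtains r where "strict_mono r" "\<And>T c. 0 \<le> T \<Longrightarrow> convergent (\<lambda>k. G (r k) T c)"
proof -
  \<comment> \<open>Pairs of rationals are coded by naturals. The absolute value turns every
    rational into an admissible time, and the entries lie in \<open>[0,|t|]\<close> because the
    functions vanish at time 0.\<close>
  define u where "u = (\<lambda>k i. case from_nat i of (t, c) \<Rightarrow> G k \<bar>real_of_rat t\<bar> c)"
  have "u n i \<in> {0..(case from_nat i of (t, c::rat) \<Rightarrow> \<bar>real_of_rat t\<bar>)}" for n i
    using G[of 0 _ n] G0[of n] by (auto simp: u_def split: prod.split)
  then obtain r where r: "strict_mono r" and c: "\<And>i. convergent (\<lambda>n. u (r n) i)"
    using pointwise_convergent_subsequence[of u "\<lambda>_. 0" "\<lambda>i. case from_nat i of (t, c::rat) \<Rightarrow> \<bar>real_of_rat t\<bar>"] by blast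
  have rc: "convergent (\<lambda>n. G (r n) \<bar>real_of_rat t\<bar> c)" for t c
    using c[of "to_nat (t, c)"] by (simp add: u_def)
  have "convergent (\<lambda>n. G (r n) T c)" if "0 \<le> T" for T c
  proof (rule Cauchy_convergent, rule metric_CauchyI)
    fix e :: real assume e: "0 < e"
    obtain t where t: "T < real_of_rat t" "real_of_rat t < T + e / 3"
      using of_rat_dense[of T "T + e/3"] e by auto
    have "\<bar>real_of_rat t\<bar> = real_of_rat t" using t that by linarith
    then have "Cauchy (\<lambda>n. G (r n) (real_of_rat t) c)" using convergent_Cauchy[OF rc[of t c]] by metis
    then obtain M where M: "\<And>m n. m \<ge> M \<Longrightarrow> n \<ge> M \<Longrightarrow> dist (G (r m) (real_of_rat t) c) (G (r n) (real_of_rat t) c) < e / 3"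
      using e by (meson metric_CauchyD divide_pos_pos zero_less_numeral)
    have "dist (G (r m) T c) (G (r n) T c) < e" if "m \<ge> M" "n \<ge> M" for m n
      using M[OF that] G[of T "real_of_rat t" "r m" c] G[of T "real_of_rat t" "r n" c] t \<open>0 \<le> T\<close> 
      unfolding dist_real_def by linarith
    then show "\<exists>M. \<forall>m\<ge>M. \<forall>n\<ge>M. dist (G (r m) T c) (G (r n) T c) < e" by blast
  qed
  with r show ?thesis by (rule that)
qed

text \<open>For \<open>good s\<close> the values \<open>g c s\<close> are nondecreasing in
  \<open>c\<close>, but they may fail to be right continuous. The infimum over the rationals to the
  right of \<open>x\<close> regularises them, which is why the conclusion consists of two one-sided
  comparisons instead of an equality at rational levels.\<close>

lemma kernel_of_rational_cdf:
  fixes g :: "rat \<Rightarrow> real \<Rightarrow> real"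
  assumes g[measurable]: "\<And>c. g c \<in> borel_measurable borel"
  defines "good s \<equiv> (\<forall>c c'. c \<le> c' \<longrightarrow> g c s \<le> g c' s) \<and> (\<forall>c<0. g c s = 0) \<and> (\<forall>c\<ge>1. g c s = 1)"
  obtains \<nu> where "\<nu> \<in> borel \<rightarrow>\<^sub>M prob_algebra borel"
    "\<And>s x c. good s \<Longrightarrow> x < real_of_rat c \<Longrightarrow> cdf (\<nu> s) x \<le> g c s"
    "\<And>s c. good s \<Longrightarrow> g c s \<le> cdf (\<nu> s) (real_of_rat c)"
proof -
  \<comment> \<open>Off the good set the distribution function of the Dirac measure at 0 is used, so
    that the kernel is defined for every \<open>s\<close>.\<close>
  define F where "F = (\<lambda>s x. if good s then (INF c\<in>{c. x < real_of_rat c}. g c s) else if 0 \<le> x then 1 else 0)"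
  have ne: "{c. x < real_of_rat c} \<noteq> {}" for x
    using of_rat_dense[of x "x+1"] by auto
  have g0: "0 \<le> g c s" if "good s" for c s
  proof -
    have "g (min c (-1)) s = 0" using that by (simp add: good_def min_def)
    moreover have "g (min c (-1)) s \<le> g c s" using that unfolding good_def by (meson min.cobounded1)
    ultimately show ?thesis by simp
  qed
  then have bdd: "bdd_below ((\<lambda>c. g c s) ` A)" if "good s" for s A
    using that by (intro bdd_belowI[of _ 0]) auto
  have Fle: "F s x \<le> g c s" if "good s" "x < real_of_rat c" for s x c
    using that bdd by (auto simp: F_def intro!: cINF_lower)
  have leF: "y \<le> F s x" if "good s" "\<And>c. x < real_of_rat c \<Longrightarrow> y \<le> g c s" for s x y
    using that ne[of x] by (auto simp: F_def intro!: cINF_greatest)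
  have geF: "g c s \<le> F s (real_of_rat c)" if "good s" for s c
  proof (rule leF[OF that])
    fix c' assume "real_of_rat c < real_of_rat c'"
    then have "c \<le> c'" by (simp add: of_rat_less)
    then show "g c s \<le> g c' s" using that by (simp add: good_def)
  qed
  have mono: "F s x \<le> F s y" if "x \<le> y" for s x y
  proof (cases "good s")
    case True then show ?thesis using that by (intro leF Fle) auto
  qed (use that in \<open>auto simp: F_def\<close>)
  have rc: "continuous (at_right a) (F s)" for s a
  proof (subst continuous_at_right_real_increasing[OF mono], assumption, intro allI impI)
    fix e :: real assume e: "0 < e"
    show "\<exists>d>0. F s (a + d) - F s a < e"
    proof (cases "good s")
      case True
      have "\<exists>c. a < of_rat c \<and> g c s < F s a + e"
        using leF[OF True, of a "F s a + e"] e by (meson not_le less_add_same_cancel1)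
      then obtain c where c: "a < of_rat c" "g c s < F s a + e" by auto
      then have "F s (a + (of_rat c - a) / 2) \<le> g c s" by (intro Fle[OF True]) (auto simp: field_simps)
      then show ?thesis using c by (intro exI[of _ "(of_rat c - a) / 2"]) auto
    next
      case False
      show ?thesis
        using e False by (intro exI[of _ "if 0 \<le> a then 1 else - a / 2"]) (auto simp: F_def)
    qed
  qed
  have F0: "F s x = 0" if "x < 0" for s x
  proof (cases "good s")
    case True
    note x = that
    obtain c where c: "x < real_of_rat c" "real_of_rat c < 0" using of_rat_dense[OF x] by blast
    then have "g c s = 0" using True by (auto simp: good_def)
    then have "F s x \<le> 0" using Fle[OF True c(1)] by metis
    moreover have "0 \<le> F s x" by (intro leF[OF True] g0[OF True])
    ultimately show ?thesis by linarith
  qed (use that in \<open>simp add: F_def\<close>)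
  have F1: "F s x = 1" if "1 \<le> x" for s x
  proof (cases "good s")
    case True
    have *: "g c s = 1" if "x < real_of_rat c" for c
    proof -
      have "1 \<le> real_of_rat c" using that \<open>1 \<le> x\<close> by linarith
      then have "1 \<le> c" by simp
      then show ?thesis using True by (auto simp: good_def)
    qed
    then show ?thesis using True ne[of x] by (auto simp: F_def)
  qed (use that in \<open>simp add: F_def\<close>)
  have l0: "(F s \<longlongrightarrow> 0) at_bot" for s
    by (rule tendsto_eventually) (auto simp: eventually_at_bot_dense F0 intro!: exI[of _ 0])
  have l1: "(F s \<longlongrightarrow> 1) at_top" for s
    by (rule tendsto_eventually) (auto simp: eventually_at_top_linorder F1 intro!: exI[of _ 1])
  have [measurable]: "Measurable.pred borel good" unfolding good_def by measurable
  have mF: "(\<lambda>s. F s x) \<in> borel_measurable borel" for x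
  proof -
    \<comment> \<open>The family inside the infimum is set to 0 off the good set, since
      measurability of a countable infimum asks for a lower bound at every \<open>s\<close>.\<close>
    have "(\<lambda>s. INF c\<in>{c. x < real_of_rat c}. if good s then g c s else 0) \<in> borel_measurable borel"
      using g0 ne by (intro borel_measurable_cINF) (auto intro!: bdd_belowI[of _ 0])
    then have "(\<lambda>s. if good s then (INF c\<in>{c. x < real_of_rat c}. if good s then g c s else 0) else if 0 \<le> x then 1 else 0) \<in> borel_measurable borel"
      by measurable
    also have "(\<lambda>s. if good s then (INF c\<in>{c. x < real_of_rat c}. if good s then g c s else 0) else if 0 \<le> x then 1 else 0) = (\<lambda>s. F s x)"
      by (auto simp: F_def)
    finally show ?thesis .
  qed
  have rd: "real_distribution (interval_measure (F s))" for s
    using mono rc l0 l1 by (rule real_distribution_interval_measure)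
  have cdf: "cdf (interval_measure (F s)) = F s" for s
    using mono rc l0 by (rule cdf_interval_measure)
  show ?thesis
  proof (rule that[of "\<lambda>s. interval_measure (F s)"])
    show "(\<lambda>s. interval_measure (F s)) \<in> borel \<rightarrow>\<^sub>M prob_algebra borel"
    proof (rule measurable_prob_algebra_generated[where \<Omega>=UNIV and G="range (\<lambda>a. {..a})"])
      show "sets borel = sigma_sets UNIV (range (\<lambda>a. {..a::real}))" by (simp add: borel_eq_atMost)
      fix A :: "real set" assume "A \<in> range (\<lambda>a. {..a})"
      then obtain a where "A = {..a}" by auto
      then show "(\<lambda>s. emeasure (interval_measure (F s)) A) \<in> borel_measurable borel"
        using mF[of a] emeasure_interval_measure_Iic[OF mono rc l0] by simp
    qed (use rd in \<open>auto simp: Int_stable_def real_distribution_def\<close>)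
  qed (use cdf Fle geF in auto)
qed

text \<open>The integrals over \<open>[0,T]\<close> of the distribution functions are Lipschitz in
  \<open>T\<close> and nondecreasing in the level. Along a subsequence they converge for all
  \<open>T\<close> and all rational levels. The time density of the limit is, for almost every
  \<open>s\<close>, a distribution function up to right continuity, and it defines the limit kernel.
  Time averages of the kernels then converge weakly, since their distribution functions converge at
  points of continuity. The common support \<open>[0,1]\<close> prevents loss of mass.\<close>

theorem real_young_compactness:
  fixes \<nu> :: "nat \<Rightarrow> real \<Rightarrow> real measure"
  assumes \<nu>: "\<And>k. \<nu> k \<in> halfline \<rightarrow>\<^sub>M prob_algebra borel"
    and supp: "\<And>k s. 0 \<le> s \<Longrightarrow> measure (\<nu> k s) {0..1} = 1"
  obtains r \<nu>' where "strict_mono r" "\<nu>' \<in> halfline \<rightarrow>\<^sub>M prob_algebra borel"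
    "\<And>(\<phi>::real\<Rightarrow>real) C T. continuous_on UNIV \<phi> \<Longrightarrow> (\<And>c. \<bar>\<phi> c\<bar> \<le> C) \<Longrightarrow> 0 \<le> T \<Longrightarrow>
      (\<lambda>k. LINT s:{0..T}|lebesgue. LINT c|\<nu> (r k) s. \<phi> c) \<longlonglongrightarrow> (LINT s:{0..T}|lebesgue. LINT c|\<nu>' s. \<phi> c)"
proof -
  have rd: "real_distribution (\<nu> k s)" if "0 \<le> s" for k s
    using prob_algebraD[OF \<nu> that, of k] by (auto simp: real_distribution_def real_distribution_axioms_def)
  have mcdf: "(\<lambda>s. cdf (\<mu> s) x) \<in> borel_measurable halfline" if "\<mu> \<in> halfline \<rightarrow>\<^sub>M prob_algebra borel" for \<mu> x
    using measurable_compose[OF measurable_prob_algebraD[OF that] measurable_measure_subprob_algebra[of "{..x}"]]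
    by (simp add: cdf_def)
  have cdf01: "0 \<le> cdf (\<nu> k s) x" "cdf (\<nu> k s) x \<le> 1" if "0 \<le> s" for k s x
  proof -
    interpret real_distribution "\<nu> k s" using rd that .
    show "0 \<le> cdf (\<nu> k s) x" "cdf (\<nu> k s) x \<le> 1" by (auto simp: cdf_nonneg cdf_bounded_prob)
  qed
  have cdf0: "cdf (\<nu> k s) x = 0" if "0 \<le> s" "x < 0" for k s x
  proof -
    interpret real_distribution "\<nu> k s" using rd that(1) .
    have "prob {..x} + prob {0..1} = prob ({..x} \<union> {0..1})"
      using that by (intro finite_measure_Union[symmetric]) auto
    also have "\<dots> \<le> 1" by (rule prob_le_1)
    finally show ?thesis using supp[OF that(1), of k] measure_nonneg[of "\<nu> k s" "{..x}"] by (simp add: cdf_def)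
  qed
  have cdf1: "cdf (\<nu> k s) x = 1" if "0 \<le> s" "1 \<le> x" for k s x
  proof -
    interpret real_distribution "\<nu> k s" using rd that(1) .
    have "prob {0..1} \<le> prob {..x}" using that by (intro finite_measure_mono) auto
    then show ?thesis using supp[OF that(1), of k] prob_le_1[of "{..x}"] by (simp add: cdf_def)
  qed
  define GG where "GG = (\<lambda>k T x. LINT s:{0..T}|lebesgue. cdf (\<nu> k s) x)"
  have icdf: "set_integrable lebesgue {a..b} (\<lambda>s. cdf (\<nu> k s) x)" if "0 \<le> a" for a b k x
    using that cdf01 by (intro set_integrable_halfline[where C=1] mcdf[OF \<nu>]) auto
  have GGx: "GG k T x \<le> GG k T y" if "x \<le> y" for k T x y
    unfolding GG_def using icdf that rd
    by (intro set_integral_mono) (auto intro!: finite_borel_measure.cdf_nondecreasing simp: real_distribution.finite_borel_measure_M)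
  have GG_diff: "GG k b x - GG k a x = (LINT s:{a..b}|lebesgue. cdf (\<nu> k s) x)" if "0 \<le> a" "a \<le> b" for k a b x
    unfolding GG_def using set_integral_Icc_combine[OF icdf[of 0 b k x] that] by simp
  have GG: "0 \<le> GG k b x - GG k a x \<and> GG k b x - GG k a x \<le> b - a" if "0 \<le> a" "a \<le> b" for k a b x
  proof -
    have "0 \<le> (LINT s:{a..b}|lebesgue. cdf (\<nu> k s) x)"
      unfolding set_lebesgue_integral_def
      using that cdf01 by (intro integral_nonneg_AE AE_I2) (auto simp: indicator_def)
    moreover have "norm (LINT s:{a..b}|lebesgue. cdf (\<nu> k s) x) \<le> 1 * (b - a)"
      using that cdf01 by (intro norm_set_integral_le mcdf[OF \<nu>]) auto
    ultimately show ?thesis unfolding GG_diff[OF that] by simp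
  qed
  have GGmono: "GG k b x - GG k a x \<le> GG k b y - GG k a y" if "0 \<le> a" "a \<le> b" "x \<le> y" for k a b x y
    unfolding GG_diff[OF that(1,2)] using icdf that rd
    by (intro set_integral_mono) (auto intro!: finite_borel_measure.cdf_nondecreasing simp: real_distribution.finite_borel_measure_M)
  have GG0: "GG k 0 x = 0" for k x
    using GG_diff[of 0 0 k x] by (simp add: GG_def set_lebesgue_integral_eq_integral(2)[OF icdf])
  have GGneg: "GG k T x = 0" if "0 \<le> T" "x < 0" for k T x
    unfolding GG_def set_lebesgue_integral_def using cdf0[OF _ that(2)] 
    by (intro integral_eq_zero_AE AE_I2) (auto simp: indicator_def)
  have GGtop: "GG k T x = T" if "0 \<le> T" "1 \<le> x" for k T x
  proof -
    have "GG k T x = (LINT s:{0..T}|lebesgue. 1)"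
      unfolding GG_def using cdf1[OF _ that(2)] by (intro set_lebesgue_integral_cong) auto
    then show ?thesis using that by (simp add: set_lebesgue_integral_def)
  qed
  obtain r where r: "strict_mono r" and conv: "\<And>T c. 0 \<le> T \<Longrightarrow> convergent (\<lambda>k. GG (r k) T (real_of_rat c))"
    using equilipschitz_convergent_subsequence[of "\<lambda>k T c. GG k T (real_of_rat c)"] GG GG0 by blast
  define G where "G = (\<lambda>T c. lim (\<lambda>k. GG (r k) T (real_of_rat c)))"
  have G: "(\<lambda>k. GG (r k) T (real_of_rat c)) \<longlonglongrightarrow> G T c" if "0 \<le> T" for T c
    using conv[OF that, of c] by (simp add: G_def convergent_LIMSEQ_iff)
  have Gd: "(\<lambda>k. GG (r k) b (real_of_rat c) - GG (r k) a (real_of_rat c)) \<longlonglongrightarrow> G b c - G a c" if "0 \<le> a" "a \<le> b" for a b c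
    using that by (intro tendsto_diff G) auto
  have Glip: "0 \<le> G b c - G a c \<and> G b c - G a c \<le> b - a" if "0 \<le> a" "a \<le> b" for a b c
    using LIMSEQ_le_const[OF Gd[OF that]] LIMSEQ_le_const2[OF Gd[OF that]] GG[OF that] by blast
  have Gmono: "G b c - G a c \<le> G b c' - G a c'" if "0 \<le> a" "a \<le> b" "c \<le> c'" for a b c c'
    using that by (intro LIMSEQ_le[OF Gd[OF that(1,2)] Gd[OF that(1,2)]]) (auto intro!: GGmono exI[of _ 0] simp: of_rat_less_eq)
  have G0: "G 0 c = 0" for c using LIMSEQ_unique[OF G[of 0 c]] GG0 by simp
  have Gneg: "G T c = 0" if "0 \<le> T" "c < 0" for T c
    using LIMSEQ_unique[OF G[OF that(1), of c]] GGneg[OF that(1)] that by simp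
  have Gtop: "G T c = T" if "0 \<le> T" "1 \<le> c" for T c
    using LIMSEQ_unique[OF G[OF that(1), of c]] GGtop[OF that(1)] that by simp
  \<comment> \<open>\<open>interval_measure\<close> needs a function on the whole line. The
    extension to negative times keeps the increments ordered in \<open>c\<close> and makes
    \<open>H c\<close> exactly 0 for \<open>c < 0\<close> and exactly the identity for
    \<open>c \<ge> 1\<close>.\<close>
  define H where "H = (\<lambda>c t. if 0 \<le> t then G t c else if 0 \<le> c then t else 0)"
  have H: "0 \<le> H c b - H c a \<and> H c b - H c a \<le> b - a" if "a \<le> b" for a b c
    using that Glip[of a b c] Glip[of 0 b c] by (auto simp: H_def G0)
  have Hmono: "H c b - H c a \<le> H c' b - H c' a" if "a \<le> b" "c \<le> c'" for a b c c'
    using that Gmono[of a b c c'] Gmono[of 0 b c c'] Glip[of 0 b c'] by (auto simp: H_def G0)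
  have Hneg: "H c = (\<lambda>_. 0)" if "c < 0" for c using that by (auto simp: H_def Gneg)
  have Htop: "H c = (\<lambda>t. t)" if "1 \<le> c" for c using that by (auto simp: H_def Gtop)
  have "\<exists>g. g \<in> borel_measurable borel \<and> interval_measure (H c) = density lborel (\<lambda>s. ennreal (g s)) \<and> (\<forall>s. 0 \<le> g s)" for c
    using lipschitz_mono_density(1)[of "H c"] H by blast
  then obtain g where g[measurable]: "\<And>c. g c \<in> borel_measurable borel"
    and gd: "\<And>c. interval_measure (H c) = density lborel (\<lambda>s. ennreal (g c s))" and g0: "\<And>c s. 0 \<le> g c s"
    by metis
  \<comment> \<open>Countably many conditions, each valid almost everywhere, because the levels are
    rational.\<close>
  define good where "good s \<longleftrightarrow> (\<forall>c c'. c \<le> c' \<longrightarrow> g c s \<le> g c' s) \<and> (\<forall>c<0. g c s = 0) \<and> (\<forall>c\<ge>1. g c s = 1)" for s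
  have "AE s in lborel. g c s \<le> g c' s" if "c \<le> c'" for c c'
    using density_mono_AE[of "H c" "H c'" "g c" "g c'"] H Hmono[OF _ that] g gd g0 by blast
  then have ae1: "AE s in lborel. \<forall>c c'. c \<le> c' \<longrightarrow> g c s \<le> g c' s"
    by (simp add: AE_all_countable)
  have *: "AE s in lborel. ennreal (g c s) = ennreal 0" if "c < 0" for c
  proof (rule sigma_finite_measure.density_unique[OF lborel.sigma_finite_measure_axioms])
    have "emeasure (density lborel (\<lambda>s. ennreal (g c s))) UNIV = 0"
      unfolding gd[symmetric] Hneg[OF that] 
    proof -
      have "emeasure (interval_measure (\<lambda>_. 0)) (\<Union>n. {- real n<..real n}) = 0"
        by (intro emeasure_UN_eq_0) (auto simp: emeasure_interval_measure_Ioc_eq)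
      then show "emeasure (interval_measure (\<lambda>_. 0)) UNIV = 0" by (simp add: UN_Ioc_eq_UNIV)
    qed
    then have "emeasure (density lborel (\<lambda>s. ennreal (g c s))) A = 0" for A
      using emeasure_mono[of A UNIV "density lborel (\<lambda>s. ennreal (g c s))"] by simp
    then show "density lborel (\<lambda>s. ennreal (g c s)) = density lborel (\<lambda>x. ennreal 0)"
      by (intro measure_eqI) (auto simp: emeasure_density)
  qed auto
  have "AE s in lborel. g c s = 0" if "c < 0" for c 
    using *[OF that] by eventually_elim (metis ennreal_inj g0 order_refl)
  then have ae2: "AE s in lborel. \<forall>c<0. g c s = 0"
    by (simp add: AE_all_countable)
  have **: "AE s in lborel. ennreal (g c s) = ennreal 1" if "1 \<le> c" for c
  proof (rule sigma_finite_measure.density_unique[OF lborel.sigma_finite_measure_axioms])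
    show "density lborel (\<lambda>s. ennreal (g c s)) = density lborel (\<lambda>x. ennreal 1)"
      unfolding gd[symmetric] Htop[OF that] lborel_eq_real[symmetric] by (simp add: density_1)
  qed auto
  have "AE s in lborel. g c s = 1" if "1 \<le> c" for c 
    using **[OF that] by eventually_elim (metis ennreal_inj g0 zero_le_one)
  then have ae3: "AE s in lborel. \<forall>c\<ge>1. g c s = 1"
    by (simp add: AE_all_countable)
  have good: "AE s in lebesgue. good s"
    unfolding good_def using ae1 ae2 ae3 by (intro AE_completion) (auto)
  obtain \<nu>' where \<nu>': "\<nu>' \<in> borel \<rightarrow>\<^sub>M prob_algebra borel"
    and le: "\<And>s x c. good s \<Longrightarrow> x < real_of_rat c \<Longrightarrow> cdf (\<nu>' s) x \<le> g c s"
    and ge: "\<And>s c. good s \<Longrightarrow> g c s \<le> cdf (\<nu>' s) (real_of_rat c)"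
    using kernel_of_rational_cdf[of g, OF g] unfolding good_def by blast
  have \<nu>'2: "\<nu>' \<in> halfline \<rightarrow>\<^sub>M prob_algebra borel"
    using \<nu>' by (intro measurable_restrict_space1 measurable_completion) simp
  have gint: "set_integrable lebesgue {0..T} (g c)" "(LINT s:{0..T}|lebesgue. g c s) = G T c" if "0 \<le> T" for T c
  proof -
    have "emeasure (interval_measure (H c)) {0..T} = ennreal (H c T - H c 0)"
      using H that by (intro emeasure_interval_measure_Icc lipschitz_mono_density(3)) 
        (auto simp: mono_def intro: lipschitz_mono_density(2))
    also have "H c T - H c 0 = G T c" using that by (simp add: H_def G0)
    finally have "(\<integral>\<^sup>+s. ennreal (g c s) * indicator {0..T} s \<partial>lborel) = ennreal (G T c)"
      unfolding gd by (simp add: emeasure_density)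
    moreover have "(\<integral>\<^sup>+s. ennreal (indicator {0..T} s * g c s) \<partial>lborel) = (\<integral>\<^sup>+s. ennreal (g c s) * indicator {0..T} s \<partial>lborel)"
      by (intro nn_integral_cong) (auto simp: indicator_def)
    ultimately have "(\<integral>\<^sup>+s. ennreal (indicator {0..T} s * g c s) \<partial>lborel) = ennreal (G T c)" by simp
    moreover have "0 \<le> G T c" using Glip[of 0 T c] that by (simp add: G0)
    ultimately have "has_bochner_integral lborel (\<lambda>s. indicator {0..T} s * g c s) (G T c)"
      using g0 by (intro has_bochner_integral_nn_integral) auto
    then have "integrable lborel (\<lambda>s. indicator {0..T} s * g c s)" "(LINT s|lborel. indicator {0..T} s * g c s) = G T c"
      by (auto simp: has_bochner_integral_iff)
    then show "set_integrable lebesgue {0..T} (g c)" "(LINT s:{0..T}|lebesgue. g c s) = G T c"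
      by (auto simp: set_integrable_def set_lebesgue_integral_def integrable_completion integral_completion)
  qed
  have conv: "(\<lambda>k. LINT s:{0..T}|lebesgue. LINT c|\<nu> (r k) s. \<phi> c) \<longlonglongrightarrow> (LINT s:{0..T}|lebesgue. LINT c|\<nu>' s. \<phi> c)"
    if \<phi>: "continuous_on UNIV \<phi>" "\<And>c. \<bar>\<phi> c\<bar> \<le> C" and T: "0 < T" for \<phi> :: "real \<Rightarrow> real" and C T
  proof -
    \<comment> \<open>The bound \<open>max 1 C\<close> covers both \<open>\<phi>\<close> and the
      indicators of half-lines, so that one average law serves for test functions and for
      distribution functions.\<close>
    have "\<exists>N. real_distribution N \<and> (\<forall>\<psi>::real\<Rightarrow>real. \<psi> \<in> borel_measurable borel \<longrightarrow> (\<forall>c. \<bar>\<psi> c\<bar> \<le> max 1 C) \<longrightarrow>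
      (LINT c|N. \<psi> c) = (LINT s:{0..T}|lebesgue. LINT c|\<mu> s. \<psi> c) / T)"
      if "\<mu> \<in> halfline \<rightarrow>\<^sub>M prob_algebra borel" for \<mu>
      by (rule average_distribution[OF that T, of "\<lambda>_. max 1 C"]) blast
    then obtain Av where rdA: "\<And>\<mu>. \<mu> \<in> halfline \<rightarrow>\<^sub>M prob_algebra borel \<Longrightarrow> real_distribution (Av \<mu>)"
      and Av: "\<And>\<mu> \<psi>::real\<Rightarrow>real. \<mu> \<in> halfline \<rightarrow>\<^sub>M prob_algebra borel \<Longrightarrow> \<psi> \<in> borel_measurable borel \<Longrightarrow> (\<And>c. \<bar>\<psi> c\<bar> \<le> max 1 C) \<Longrightarrow>
      (LINT c|Av \<mu>. \<psi> c) = (LINT s:{0..T}|lebesgue. LINT c|\<mu> s. \<psi> c) / T"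
      by metis
    have cdfA: "cdf (Av \<mu>) x = (LINT s:{0..T}|lebesgue. cdf (\<mu> s) x) / T" if \<mu>: "\<mu> \<in> halfline \<rightarrow>\<^sub>M prob_algebra borel" for \<mu> x
    proof -
      have s: "sets (Av \<mu>) = sets borel"
        using rdA[OF \<mu>] by (simp add: real_distribution.events_eq_borel)
      have "cdf (Av \<mu>) x = (LINT c|Av \<mu>. indicator {..x} c)"
        by (simp add: cdf_def s)
      also have "\<dots> = (LINT s:{0..T}|lebesgue. LINT c|\<mu> s. indicator {..x} c) / T"
        by (intro Av \<mu>) (auto simp: indicator_def)
      also have "(LINT s:{0..T}|lebesgue. LINT c|\<mu> s. indicator {..x} c) = (LINT s:{0..T}|lebesgue. cdf (\<mu> s) x)"
        using prob_algebraD[OF \<mu>] by (intro set_lebesgue_integral_cong) (auto simp: cdf_def)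
      finally show ?thesis .
    qed
    have icdf': "set_integrable lebesgue {0..T} (\<lambda>s. cdf (\<nu>' s) x)" for x
      using prob_algebraD(1)[OF \<nu>'2] by (intro set_integrable_halfline[where C=1] mcdf[OF \<nu>'2]) (auto simp: cdf_def prob_space.prob_le_1)
    \<comment> \<open>The regularised kernel is compared with \<open>G\<close> from one side at a
      time: here strictly to the left of the rational level, in \<open>dn\<close> at the level
      itself.\<close>
    have up: "T * cdf (Av \<nu>') x \<le> G T c" if "x < real_of_rat c" for x c
    proof -
      have "(LINT s:{0..T}|lebesgue. cdf (\<nu>' s) x) \<le> (LINT s:{0..T}|lebesgue. g c s)"
        using good le that icdf' gint(1)[of T c] T by (intro set_integral_mono_AE) auto
      then show ?thesis using T gint(2)[of T c] by (simp add: cdfA[OF \<nu>'2])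
    qed
    have dn: "G T c \<le> T * cdf (Av \<nu>') (of_rat c)" for c
    proof -
      have "(LINT s:{0..T}|lebesgue. g c s) \<le> (LINT s:{0..T}|lebesgue. cdf (\<nu>' s) (real_of_rat c))"
        using good ge icdf' gint(1)[of T c] T by (intro set_integral_mono_AE) auto
      then show ?thesis using T gint(2)[of T c] by (simp add: cdfA[OF \<nu>'2])
    qed
    have "weak_conv_m (\<lambda>k. Av (\<nu> (r k))) (Av \<nu>')"
      unfolding weak_conv_m_def weak_conv_def
    proof (intro allI impI, rule LIMSEQ_I)
      fix x e :: real assume x: "isCont (cdf (Av \<nu>')) x" and e: "0 < e"
      then obtain d where d: "0 < d" "\<And>y. \<bar>y - x\<bar> < d \<Longrightarrow> \<bar>cdf (Av \<nu>') y - cdf (Av \<nu>') x\<bar> < e / 2"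
        unfolding continuous_at_eps_delta dist_real_def by (meson half_gt_zero)
      obtain c1 c2 where c: "x - d < real_of_rat c1" "real_of_rat c1 < x" "x < real_of_rat c2" "real_of_rat c2 < x + d"
        using of_rat_dense[of "x-d" x] of_rat_dense[of x "x+d"] d(1) by auto
      \<comment> \<open>\<open>up\<close> bounds the distribution function only strictly below a
        rational level, hence the extra point \<open>y\<close> below \<open>c1\<close>, still within
        \<open>d\<close> of \<open>x\<close>.\<close>
      obtain y where y: "x - d < y" "y < real_of_rat c1" using dense[OF c(1)] by blast
      have "eventually (\<lambda>k. \<bar>GG (r k) T (real_of_rat c1) - G T c1\<bar> < T * e / 2) sequentially"
        "eventually (\<lambda>k. \<bar>GG (r k) T (real_of_rat c2) - G T c2\<bar> < T * e / 2) sequentially"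
        using tendstoD[OF G[of T], of "T * e / 2"] T e by (auto simp: dist_real_def)
      then have "eventually (\<lambda>k. norm (cdf (Av (\<nu> (r k))) x - cdf (Av \<nu>') x) < e) sequentially"
      proof eventually_elim
        case (elim k)
        have 1: "T * cdf (Av (\<nu> (r k))) x = GG (r k) T x" using T by (simp add: cdfA[OF \<nu>] GG_def)
        have 2: "GG (r k) T (real_of_rat c1) \<le> GG (r k) T x" "GG (r k) T x \<le> GG (r k) T (real_of_rat c2)"
          using c by (auto intro!: GGx)
        have 3: "T * cdf (Av \<nu>') y \<le> G T c1" by (rule up) fact
        have "\<bar>y - x\<bar> < d" "\<bar>real_of_rat c2 - x\<bar> < d" using c y by linarith+
        then have "\<bar>cdf (Av \<nu>') y - cdf (Av \<nu>') x\<bar> < e / 2" "\<bar>cdf (Av \<nu>') (real_of_rat c2) - cdf (Av \<nu>') x\<bar> < e / 2"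
          by (blast intro: d(2))+
        then have "T * cdf (Av \<nu>') x - T * (e / 2) < T * cdf (Av \<nu>') y" "T * cdf (Av \<nu>') (real_of_rat c2) < T * cdf (Av \<nu>') x + T * (e / 2)"
          using T unfolding right_diff_distrib[symmetric] distrib_left[symmetric] mult_less_cancel_left_pos[OF T] by linarith+
        then have "\<bar>T * cdf (Av (\<nu> (r k))) x - T * cdf (Av \<nu>') x\<bar> < T * e"
          using elim 1 2 3 dn[of c2] by linarith
        then have "T * \<bar>cdf (Av (\<nu> (r k))) x - cdf (Av \<nu>') x\<bar> < T * e"
          using T by (simp add: abs_mult right_diff_distrib[symmetric])
        then show ?case using T by simp
      qed
      then show "\<exists>no. \<forall>n\<ge>no. norm (cdf (Av (\<nu> (r n))) x - cdf (Av \<nu>') x) < e"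
        by (simp add: eventually_sequentially)
    qed
    then have "(\<lambda>k. LINT c|Av (\<nu> (r k)). \<phi> c) \<longlonglongrightarrow> (LINT c|Av \<nu>'. \<phi> c)"
      using rdA[OF \<nu>] rdA[OF \<nu>'2] \<phi> 
      by (intro weak_conv_imp_integral_bdd_continuous_conv[where B=C]) (auto simp: continuous_on_eq_continuous_at)
    moreover have "\<phi> \<in> borel_measurable borel" using \<phi>(1) by (rule borel_measurable_continuous_onI)
    moreover have "\<And>c. \<bar>\<phi> c\<bar> \<le> max 1 C" using \<phi>(2) by (simp add: le_max_iff_disj)
    ultimately have "(\<lambda>k. (LINT s:{0..T}|lebesgue. LINT c|\<nu> (r k) s. \<phi> c) / T) \<longlonglongrightarrow> (LINT s:{0..T}|lebesgue. LINT c|\<nu>' s. \<phi> c) / T"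
      using Av[OF \<nu>, of \<phi>] Av[OF \<nu>'2, of \<phi>] by simp
    from tendsto_mult_right[OF this, of T] show ?thesis using T by simp
  qed
  show ?thesis
  proof (rule that[OF r \<nu>'2])
    fix \<phi> :: "real \<Rightarrow> real" and C T assume *: "continuous_on UNIV \<phi>" "\<And>c. \<bar>\<phi> c\<bar> \<le> C" and "0 \<le> (T::real)"
    \<comment> \<open>The case \<open>T = 0\<close> is separate because the averages divide by
      \<open>T\<close>.\<close>
    then consider "T = 0" | "0 < T" by linarith
    then show "(\<lambda>k. LINT s:{0..T}|lebesgue. LINT c|\<nu> (r k) s. \<phi> c) \<longlonglongrightarrow> (LINT s:{0..T}|lebesgue. LINT c|\<nu>' s. \<phi> c)"
    proof cases
      case 1
      have "(LINT s:{0..0}|lebesgue. h s) = 0" for h :: "real \<Rightarrow> real"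
        unfolding set_lebesgue_integral_def
        by (intro integral_eq_zero_AE AE_I'[of "{0}"]) (auto simp: indicator_def)
      then show ?thesis by (simp add: 1)
    qed (use conv * in blast)
  qed
qed

section \<open>A space-filling curve\<close>

text \<open>Schoenberg's plateau function: continuous, even, of period 2, equal to 0 on
  \<open>[0,1/3]\<close> and to 1 on \<open>[2/3,1]\<close>. Clipping a cosine gives evenness and
  periodicity at once.\<close>

definition tent :: "real \<Rightarrow> real" where
  "tent t = max 0 (min 1 (1 / 2 - cos (pi * t)))"

lemma tent_bounds: "0 \<le> tent t" "tent t \<le> 1" by (auto simp: tent_def)

lemma tent_low: "0 \<le> t \<Longrightarrow> t \<le> 1 / 3 \<Longrightarrow> tent t = 0"
  using cos_monotone_0_pi_le[of "pi * t" "pi / 3"] by (auto simp: tent_def cos_60)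

lemma tent_high: "2 / 3 \<le> t \<Longrightarrow> t \<le> 1 \<Longrightarrow> tent t = 1"
  using cos_monotone_0_pi_le[of "2 * pi / 3" "pi * t"] by (auto simp: tent_def cos_120)

lemma continuous_on_tent: "continuous_on S tent"
  unfolding tent_def by (intro continuous_intros)

text \<open>For \<open>d\<close> with values 0 and 1 this is the point of the Cantor set with
  ternary digits \<open>2 d_j\<close>.\<close>

definition tern :: "(nat \<Rightarrow> nat) \<Rightarrow> real" where
  "tern d = (\<Sum>j. 2 * real (d j) / 3 ^ Suc j)"

lemma tern:
  assumes d: "\<And>j. d j \<le> 1"
  shows "0 \<le> tern d" "tern d \<le> 1" "3 * tern d = 2 * real (d 0) + tern (\<lambda>j. d (Suc j))"
proof -
  have g: "(\<lambda>j. 2 / 3 ^ Suc j) sums (1::real)"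
    using sums_mult[OF geometric_sums[of "1/3::real"], of "2/3"] by (simp add: power_one_over divide_simps)
  have le: "2 * real (e j) / 3 ^ Suc j \<le> 2 / 3 ^ Suc j" if "e j \<le> 1" for e and j :: nat
    using that by (simp add: divide_simps)
  have s: "summable (\<lambda>j. 2 * real (e j) / 3 ^ Suc j)" if "\<And>j. e j \<le> 1" for e
    using le[of e] that by (intro summable_comparison_test'[OF sums_summable[OF g], of 0]) auto
  show "0 \<le> tern d" unfolding tern_def by (intro suminf_nonneg s d) auto
  show "tern d \<le> 1" unfolding tern_def sums_unique[OF g] 
    by (intro suminf_le le d s sums_summable[OF g])
  have "tern d = (\<Sum>j. 2 * real (d (Suc j)) / 3 ^ Suc (Suc j)) + 2 * real (d 0) / 3"
    unfolding tern_def using suminf_split_head[OF s[of d, OF d]] by simp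
  also have "(\<Sum>j. 2 * real (d (Suc j)) / 3 ^ Suc (Suc j)) = (\<Sum>j. (1/3) * (2 * real (d (Suc j)) / 3 ^ Suc j))"
    by (simp add: field_simps)
  also have "\<dots> = (1/3) * tern (\<lambda>j. d (Suc j))"
    unfolding tern_def using d by (intro suminf_mult s) auto
  finally show "3 * tern d = 2 * real (d 0) + tern (\<lambda>j. d (Suc j))" by simp
qed

text \<open>Multiplication by 3 shifts the ternary digits and brings out the integer
  \<open>2 d_0\<close>. Even multiples of \<open>pi\<close> do not change the cosine, so the dropped
  digits leave no trace.\<close>

lemma cos_tern:
  assumes "\<And>j. d j \<le> 1"
  shows "cos (pi * (3 ^ n * tern d)) = cos (pi * tern (\<lambda>j. d (j + n)))"
  using assms
proof (induction n arbitrary: d)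
  case (Suc n)
  have "pi * (3 ^ Suc n * tern d) = pi * (3 ^ n * tern (\<lambda>j. d (Suc j))) + 2 * real (3 ^ n * d 0) * pi"
  proof -
    have "3 ^ Suc n * tern d = 3 ^ n * (3 * tern d)" by simp
    also have "3 * tern d = 2 * real (d 0) + tern (\<lambda>j. d (Suc j))" by (rule tern(3)) (rule Suc.prems)
    finally show ?thesis by (simp only: distrib_left of_nat_mult of_nat_power of_nat_numeral mult_ac add.commute)
  qed
  then have "cos (pi * (3 ^ Suc n * tern d)) = cos (pi * (3 ^ n * tern (\<lambda>j. d (Suc j))))"
    by (simp only: cos_add cos_2npi sin_2npi)
  then show ?case using Suc.IH[of "\<lambda>j. d (Suc j)"] Suc.prems by simp
qed simp

text \<open>After the shift the digit \<open>d n\<close> is the leading one. It decides in which of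
  the two outer thirds of \<open>[0,1]\<close> the point lies, and \<open>tent\<close> is constant
  on each. So every digit can be read off from the single parameter \<open>tern d\<close>.\<close>

lemma tent_tern:
  assumes d: "\<And>j. d j \<le> 1"
  shows "tent (3 ^ n * tern d) = real (d n)"
proof -
  define t u where "t = tern (\<lambda>j. d (j + n))" and "u = tern (\<lambda>j. d (Suc j + n))"
  have *: "tent (3 ^ n * tern d) = tent t"
    unfolding t_def tent_def by (subst cos_tern[of d n, OF d]) (rule refl)
  have eq: "3 * t = 2 * real (d n) + u"
    unfolding t_def u_def using tern(3)[of "\<lambda>j. d (j + n)", OF d] by (simp only: add_0)
  have u: "0 \<le> u" "u \<le> 1" unfolding u_def by (intro tern d)+
  show ?thesis
  proof (cases "d n = 0")
    case True
    then have "0 \<le> t" "t \<le> 1 / 3" using eq u by linarith+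
    then show ?thesis unfolding * using True by (simp add: tent_low)
  next
    case False
    then have "d n = 1" using d[of n] by linarith
    moreover from this have "2 / 3 \<le> t" "t \<le> 1" using eq u by linarith+
    ultimately show ?thesis unfolding * by (simp add: tent_high)
  qed
qed

text \<open>The digits are \<open>\<lfloor>2^(k+1) v\<rfloor> - 2 \<lfloor>2^k v\<rfloor>\<close>,
  so the partial sums telescope to \<open>\<lfloor>2^n v\<rfloor> / 2^n\<close>.\<close>

lemma binary_expansion:
  assumes "0 \<le> v" "v < (1::real)"
  obtains \<beta> :: "nat \<Rightarrow> nat" where "\<And>k. \<beta> k \<le> 1" "(\<lambda>k. real (\<beta> k) / 2 ^ Suc k) sums v"
proof -
  define i where "i = (\<lambda>k::nat. \<lfloor>2 ^ Suc k * v\<rfloor> - 2 * \<lfloor>2 ^ k * v\<rfloor>)"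
  have i: "0 \<le> i k \<and> i k \<le> 1" for k
  proof -
    have "2 ^ Suc k * v = 2 * (2 ^ k * v)" by simp
    then show ?thesis unfolding i_def by linarith
  qed
  have sum: "(\<Sum>k<n. of_int (i k) / 2 ^ Suc k) = of_int \<lfloor>2 ^ n * v\<rfloor> / (2 ^ n :: real)" for n
  proof (induction n)
    case 0 then show ?case using assms by simp linarith
  next
    case (Suc n) then show ?case by (simp add: i_def field_simps)
  qed
  have "(\<lambda>n. of_int \<lfloor>2 ^ n * v\<rfloor> / (2 ^ n :: real)) \<longlonglongrightarrow> v"
  proof (rule tendsto_sandwich[of "\<lambda>n. v - (1/2) ^ n" _ _ "\<lambda>n. v"])
    show "\<forall>\<^sub>F n in sequentially. v - (1/2) ^ n \<le> of_int \<lfloor>2 ^ n * v\<rfloor> / (2 ^ n :: real)"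
    proof (intro always_eventually allI)
      fix n :: nat
      have "2 ^ n * v - 1 \<le> of_int \<lfloor>2 ^ n * v\<rfloor>" by linarith
      then have "(2 ^ n * v - 1) / 2 ^ n \<le> of_int \<lfloor>2 ^ n * v\<rfloor> / 2 ^ n" by (intro divide_right_mono) auto
      then show "v - (1/2) ^ n \<le> of_int \<lfloor>2 ^ n * v\<rfloor> / (2 ^ n :: real)" by (simp add: field_simps power_one_over)
    qed
    show "\<forall>\<^sub>F n in sequentially. of_int \<lfloor>2 ^ n * v\<rfloor> / (2 ^ n :: real) \<le> v"
      by (simp add: divide_le_eq mult.commute)
    show "(\<lambda>n. v - (1/2) ^ n) \<longlonglongrightarrow> v" using tendsto_diff[OF tendsto_const[of v] LIMSEQ_realpow_zero[of "1/2::real"]] by simp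
  qed simp
  then have "(\<lambda>k. of_int (i k) / 2 ^ Suc k) sums v" unfolding sums_def sum .
  moreover have "of_int (i k) = real (nat (i k))" "nat (i k) \<le> 1" for k using i[of k] by auto
  ultimately show ?thesis using that[of "\<lambda>k. nat (i k)"] by simp
qed

text \<open>Schoenberg's space-filling curve.\<close>

lemma compact_subset_curve:
  fixes K :: "'a::euclidean_space set"
  assumes "compact K"
  obtains \<gamma> :: "real \<Rightarrow> 'a" where "continuous_on UNIV \<gamma>" "K \<subseteq> \<gamma> ` {0..1}"
proof -
  \<comment> \<open>The strict inequality places the rescaled coordinates in \<open>[0,1)\<close>,
    as \<open>binary_expansion\<close> requires.\<close>
  obtain B where B: "0 < B" "\<And>x. x \<in> K \<Longrightarrow> norm x < B"
    using compact_imp_bounded[OF assms] by (metis bounded_pos_less)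
  define D where "D = DIM('a)"
  have D: "0 < D" by (simp add: D_def)
  obtain h where h: "bij_betw h (Basis :: 'a set) {0..<D}"
    using ex_bij_betw_finite_nat[of "Basis :: 'a set"] by (auto simp: D_def)
  \<comment> \<open>Coordinate \<open>b\<close> takes the digits at the positions congruent to
    \<open>h b\<close> modulo the dimension as its binary digits.\<close>
  define c where "c = (\<lambda>b t. \<Sum>k. tent (3 ^ (k * D + h b) * t) / 2 ^ Suc k)"
  define \<gamma> where "\<gamma> = (\<lambda>t. \<Sum>b\<in>Basis. (2 * B * c b t - B) *\<^sub>R b)"
  have cc: "continuous_on UNIV (c b)" for b
  proof -
    have "uniform_limit UNIV (\<lambda>n t. \<Sum>k<n. tent (3 ^ (k * D + h b) * t) / 2 ^ Suc k) (c b) sequentially"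
      unfolding c_def
    proof (rule Weierstrass_m_test)
      show "summable (\<lambda>k. (1 / 2) ^ Suc k :: real)" by (simp add: summable_geometric)
    qed (use tent_bounds in \<open>auto simp: power_one_over divide_simps\<close>)
    then show ?thesis
      by (rule uniform_limit_theorem[rotated])
        (auto intro!: always_eventually continuous_intros continuous_on_compose2[OF continuous_on_tent[of UNIV]])
  qed
  have "continuous_on UNIV \<gamma>" unfolding \<gamma>_def by (intro continuous_intros cc)
  moreover have "x \<in> \<gamma> ` {0..1}" if "x \<in> K" for x
  proof -
    have "\<exists>\<beta>::nat \<Rightarrow> nat. (\<forall>k. \<beta> k \<le> 1) \<and> (\<lambda>k. real (\<beta> k) / 2 ^ Suc k) sums ((x \<bullet> b + B) / (2 * B))" if b: "b \<in> Basis" for b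
    proof -
      have "\<bar>x \<bullet> b\<bar> < B" using Basis_le_norm[OF b, of x] B(2)[OF \<open>x \<in> K\<close>] by linarith
      then have "0 \<le> (x \<bullet> b + B) / (2 * B)" "(x \<bullet> b + B) / (2 * B) < 1" using B(1) by (auto simp: field_simps)
      then show ?thesis by (rule binary_expansion) blast
    qed
    then obtain \<beta> where \<beta>: "\<And>b k. b \<in> Basis \<Longrightarrow> \<beta> b k \<le> (1::nat)"
      "\<And>b. b \<in> Basis \<Longrightarrow> (\<lambda>k. real (\<beta> b k) / 2 ^ Suc k) sums ((x \<bullet> b + B) / (2 * B))"
      by metis
    \<comment> \<open>The interleaved sequence: position \<open>i\<close> carries digit
      \<open>i div D\<close> of the coordinate numbered \<open>i mod D\<close>.\<close>
    define d where "d = (\<lambda>i. \<beta> (inv_into Basis h (i mod D)) (i div D))"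
    have bd: "inv_into Basis h (i mod D) \<in> Basis" for i
      using h D by (intro inv_into_into) (auto simp: bij_betw_def)
    have d1: "d i \<le> 1" for i using \<beta>(1) bd by (auto simp: d_def)
    have d: "d (k * D + h b) = \<beta> b k" if "b \<in> Basis" for b k
    proof -
      have "h b < D" using h that by (auto simp: bij_betw_def)
      then have "(k * D + h b) mod D = h b" "(k * D + h b) div D = k" by auto
      then show ?thesis using h that by (auto simp: d_def bij_betw_def)
    qed
    have "c b (tern d) = (x \<bullet> b + B) / (2 * B)" if "b \<in> Basis" for b
      unfolding c_def tent_tern[of d, OF d1] d[OF that] using \<beta>(2)[OF that] by (rule sums_unique[symmetric])
    then have "\<gamma> (tern d) = (\<Sum>b\<in>Basis. (x \<bullet> b) *\<^sub>R b)"
      unfolding \<gamma>_def using B(1) by (intro sum.cong) auto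
    then have "\<gamma> (tern d) = x" by (simp add: euclidean_representation)
    then show ?thesis using tern(1,2)[of d, OF d1] by (auto intro!: image_eqI[of _ _ "tern d"])
  qed
  ultimately show ?thesis using that by blast
qed

text \<open>The first parameter at which the curve passes through \<open>a\<close> depends on
  \<open>a\<close> in a Borel way: its sublevel sets are traces on \<open>K\<close> of images of
  compact sets, hence relatively closed.\<close>

lemma curve_borel_section:
  fixes \<gamma> :: "real \<Rightarrow> 'a::euclidean_space"
  assumes \<gamma>: "continuous_on UNIV \<gamma>" "K \<subseteq> \<gamma> ` {0..1}"
  obtains \<sigma> where "\<sigma> \<in> borel_measurable (restrict_space borel K)"
    "\<And>a. a \<in> K \<Longrightarrow> \<sigma> a \<in> {0..1} \<and> \<gamma> (\<sigma> a) = a"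
proof -
  define \<sigma> where "\<sigma> = (\<lambda>a. Inf {t\<in>{0..1}. \<gamma> t = a})"
  have bdd: "bdd_below {t\<in>{0..1}. \<gamma> t = a}" for a by (rule bdd_belowI[of _ 0]) simp
  have cl: "closed {t\<in>{0..1}. \<gamma> t = a}" for a
    by (rule continuous_closed_preimage_constant) (auto intro: continuous_on_subset[OF \<gamma>(1)])
  have \<sigma>: "\<sigma> a \<in> {t\<in>{0..1}. \<gamma> t = a}" if "a \<in> K" for a
  proof -
    have "\<exists>t\<in>{0..1}. \<gamma> t = a" using that \<gamma>(2) by (metis imageE subsetD)
    then show ?thesis
      unfolding \<sigma>_def using bdd by (intro closed_contains_Inf cl) auto
  qed
  have "{a \<in> K. \<sigma> a \<le> c} = K \<inter> \<gamma> ` ({0..1} \<inter> {..c})" for c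
  proof (intro equalityI subsetI)
    fix a assume "a \<in> K \<inter> \<gamma> ` ({0..1} \<inter> {..c})"
    then obtain t where "a \<in> K" "t \<in> {t\<in>{0..1}. \<gamma> t = a}" "t \<le> c" by auto
    then have "\<sigma> a \<le> t" unfolding \<sigma>_def by (intro cInf_lower bdd)
    then show "a \<in> {a \<in> K. \<sigma> a \<le> c}" using \<open>a \<in> K\<close> \<open>t \<le> c\<close> by auto
  next
    fix a assume "a \<in> {a \<in> K. \<sigma> a \<le> c}"
    then show "a \<in> K \<inter> \<gamma> ` ({0..1} \<inter> {..c})" using \<sigma>[of a] by (auto intro!: image_eqI[of _ _ "\<sigma> a"])
  qed
  moreover have "closed (\<gamma> ` ({0..1} \<inter> {..c}))" for c
    by (intro compact_imp_closed compact_continuous_image continuous_on_subset[OF \<gamma>(1)]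
        compact_Int_closed[OF compact_Icc closed_atMost]) auto
  ultimately have "\<sigma> \<in> borel_measurable (restrict_space borel K)"
    unfolding borel_measurable_iff_le by (auto simp: space_restrict_space sets_restrict_space)
  with \<sigma> show ?thesis using that by blast
qed

section \<open>Kernels on a compact set and their convergence\<close>

definition kernels :: "'a::euclidean_space set \<Rightarrow> (real \<Rightarrow> 'a measure) set" where
  "kernels K = halfline \<rightarrow>\<^sub>M prob_algebra (restrict_space borel K)"

text \<open>Tested only with products of the indicator of \<open>[0,t]\<close> and a continuous
  function of the control value. For functions jointly continuous in time and control value,
  convergence is derived in \<open>young_conv_time\<close>.\<close>

definition young_conv ::
  "'a::euclidean_space set \<Rightarrow> (nat \<Rightarrow> real \<Rightarrow> 'a measure) \<Rightarrow> (real \<Rightarrow> 'a measure) \<Rightarrow> bool" where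
  "young_conv K ms m \<longleftrightarrow> (\<forall>\<phi>::'a \<Rightarrow> real. continuous_on K \<phi> \<longrightarrow> (\<forall>t\<ge>0.
     (\<lambda>k. LINT s:{0..t}|lebesgue. LINT a|ms k s. \<phi> a) \<longlonglongrightarrow> (LINT s:{0..t}|lebesgue. LINT a|m s. \<phi> a)))"

lemma kernelsD:
  assumes "m \<in> kernels K" "0 \<le> s"
  shows "prob_space (m s)" "sets (m s) = sets (restrict_space borel K)" "space (m s) = K"
  using prob_algebraD[OF assms[unfolded kernels_def]] by (auto simp: space_restrict_space)

lemma borel_measurable_kernel:
  fixes \<phi> :: "'a::euclidean_space \<Rightarrow> 'c::{banach,second_countable_topology}"
  assumes "m \<in> kernels K" "0 \<le> s" "\<phi> \<in> borel_measurable (restrict_space borel K)"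
  shows "\<phi> \<in> borel_measurable (m s)"
  using assms(3) measurable_cong_sets[OF kernelsD(2)[OF assms(1,2)] refl] by blast

lemma compact_bounded_fun:
  fixes \<phi> :: "'a::topological_space \<Rightarrow> 'c::real_normed_vector"
  assumes "compact K" "continuous_on K \<phi>"
  obtains C where "0 < C" "\<And>a. a \<in> K \<Longrightarrow> norm (\<phi> a) \<le> C"
  using compact_imp_bounded[OF compact_continuous_image[OF assms(2,1)]] unfolding bounded_pos by auto

text \<open>Kernels are pushed to the line by the Borel section \<open>\<sigma>\<close>, and the
  limit is brought back by the curve. As \<open>\<sigma>\<close> need not be continuous, limits are
  tested with functions \<open>\<Phi> o \<gamma>\<close>, for which
  \<open>\<gamma> o \<sigma>\<close> is the identity on \<open>K\<close>. What remains is that the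
  limit charges only parameters that the curve maps into \<open>K\<close>.\<close>

theorem young_compactness:
  fixes ms :: "nat \<Rightarrow> real \<Rightarrow> 'a::euclidean_space measure"
  assumes K: "compact K" "K \<noteq> {}" and ms: "\<And>k. ms k \<in> kernels K"
  obtains r m where "strict_mono (r :: nat \<Rightarrow> nat)" "m \<in> kernels K" "young_conv K (\<lambda>k. ms (r k)) m"
proof -
  let ?N = "restrict_space borel K"
  obtain \<gamma> where \<gamma>: "continuous_on UNIV \<gamma>" "K \<subseteq> \<gamma> ` {0..1::real}"
    using compact_subset_curve[OF K(1)] by blast
  obtain \<sigma> where \<sigma>: "\<sigma> \<in> borel_measurable ?N" "\<And>a. a \<in> K \<Longrightarrow> \<sigma> a \<in> {0..1} \<and> \<gamma> (\<sigma> a) = a"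
    using curve_borel_section[OF \<gamma>] by blast
  define \<nu> where "\<nu> = (\<lambda>k s. distr (ms k s) borel \<sigma>)"
  have \<nu>: "\<nu> k \<in> halfline \<rightarrow>\<^sub>M prob_algebra borel" for k
    using measurable_compose[OF ms[of k, unfolded kernels_def] measurable_distr_prob_space[OF \<sigma>(1)]]
    by (simp add: \<nu>_def)
  have \<sigma>m: "\<sigma> \<in> borel_measurable (ms k s)" if "0 \<le> s" for k s
    by (rule borel_measurable_kernel[OF ms that \<sigma>(1)])
  have supp: "measure (\<nu> k s) {0..1} = 1" if s: "0 \<le> s" for k s
  proof -
    have "measure (\<nu> k s) {0..1} = measure (ms k s) (\<sigma> -` {0..1} \<inter> space (ms k s))"
      unfolding \<nu>_def by (intro measure_distr \<sigma>m s) auto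
    also have "\<sigma> -` {0..1} \<inter> space (ms k s) = space (ms k s)" using \<sigma>(2) kernelsD[OF ms s, of k] by auto
    finally show ?thesis using prob_space.prob_space[OF kernelsD(1)[OF ms s]] by simp
  qed
  obtain r \<nu>' where r: "strict_mono r" and \<nu>': "\<nu>' \<in> halfline \<rightarrow>\<^sub>M prob_algebra borel"
    and conv: "\<And>(\<phi>::real\<Rightarrow>real) C T. continuous_on UNIV \<phi> \<Longrightarrow> (\<And>c. \<bar>\<phi> c\<bar> \<le> C) \<Longrightarrow> 0 \<le> T \<Longrightarrow>
      (\<lambda>k. LINT s:{0..T}|lebesgue. LINT c|\<nu> (r k) s. \<phi> c) \<longlonglongrightarrow> (LINT s:{0..T}|lebesgue. LINT c|\<nu>' s. \<phi> c)"
    using real_young_compactness[of \<nu>, OF \<nu> supp] by blast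
  have \<nu>int: "(LINT c|\<nu> k s. \<phi> c) = (LINT a|ms k s. \<phi> (\<sigma> a))" if "\<phi> \<in> borel_measurable borel" "0 \<le> s" for \<phi> :: "real \<Rightarrow> real" and k s
    unfolding \<nu>_def by (rule integral_distr[OF \<sigma>m[OF that(2)] that(1)])
  define C where "C = {0..1} \<inter> \<gamma> -` K"
  have C: "closed C" unfolding C_def
    using continuous_closed_preimage[OF continuous_on_subset[OF \<gamma>(1)], of "{0..1}" K] compact_imp_closed[OF K(1)] by auto
  have \<sigma>C: "\<sigma> a \<in> C" if "a \<in> K" for a using \<sigma>(2)[OF that] that by (auto simp: C_def)
  then have Cne: "C \<noteq> {}" using K(2) by auto
  \<comment> \<open>A bounded continuous function vanishing exactly on \<open>C\<close>. Its
    integrals are 0 along the sequence and hence in the limit, so almost every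
    \<open>\<nu>' s\<close> lives on \<open>C\<close>.\<close>
  define \<psi> where "\<psi> = (\<lambda>c. min 1 (infdist c C))"
  have \<psi>: "continuous_on UNIV \<psi>" "\<And>c. 0 \<le> \<psi> c" "\<And>c. \<bar>\<psi> c\<bar> \<le> 1" "\<And>c. \<psi> c = 0 \<longleftrightarrow> c \<in> C"
  proof -
    show "continuous_on UNIV \<psi>" unfolding \<psi>_def by (intro continuous_intros)
    fix c
    show "0 \<le> \<psi> c" "\<bar>\<psi> c\<bar> \<le> 1" using infdist_nonneg[of c C] by (auto simp: \<psi>_def)
    show "\<psi> c = 0 \<longleftrightarrow> c \<in> C" using in_closed_iff_infdist_zero[OF C Cne, of c] by (auto simp: \<psi>_def min_def)
  qed
  have \<psi>m: "\<psi> \<in> borel_measurable borel" using \<psi>(1) by (rule borel_measurable_continuous_onI)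
  have z: "(LINT s:{0..T}|lebesgue. LINT c|\<nu>' s. \<psi> c) = 0" if T: "0 \<le> T" for T
  proof -
    have "(LINT c|\<nu> k s. \<psi> c) = 0" if s: "0 \<le> s" for k s
      unfolding \<nu>int[OF \<psi>m s] using kernelsD[OF ms s, of k] \<sigma>C \<psi>(4)
      by (intro integral_eq_zero_AE AE_I2) auto
    then have "(LINT s:{0..T}|lebesgue. LINT c|\<nu> k s. \<psi> c) = 0" for k
      unfolding set_lebesgue_integral_def by (intro integral_eq_zero_AE AE_I2) (auto simp: indicator_def)
    then show ?thesis using LIMSEQ_unique[OF conv[OF \<psi>(1,3) T]] by simp
  qed
  have \<nu>'D: "prob_space (\<nu>' s)" "sets (\<nu>' s) = sets borel" "space (\<nu>' s) = UNIV" if "0 \<le> s" for s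
    using prob_algebraD[OF \<nu>' that] by auto
  have \<psi>0: "0 \<le> (LINT c|\<nu>' s. \<psi> c)" for s using \<psi>(2) by (intro integral_nonneg_AE AE_I2)
  have "AE s in lebesgue. s \<in> {0..real n} \<longrightarrow> (LINT c|\<nu>' s. \<psi> c) = 0" for n
  proof -
    have "set_integrable lebesgue {0..real n} (\<lambda>s. LINT c|\<nu>' s. \<psi> c)"
      by (intro set_integrable_halfline[where C=1] measurable_kernel_integral[OF \<nu>'] kernel_integral_bound(2)[OF \<nu>'] \<psi>m) (use \<psi> in auto)
    then have "AE s in lebesgue. indicator {0..real n} s *\<^sub>R (LINT c|\<nu>' s. \<psi> c) = 0"
      using z[of "real n"] \<psi>0 unfolding set_integrable_def set_lebesgue_integral_def
      by (subst integral_nonneg_eq_0_iff_AE[symmetric]) auto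
    then show ?thesis by eventually_elim (auto simp: indicator_def)
  qed
  then have "AE s in lebesgue. \<forall>n. s \<in> {0..real n} \<longrightarrow> (LINT c|\<nu>' s. \<psi> c) = 0"
    by (subst AE_all_countable) blast
  then have ae: "AE s in lebesgue. 0 \<le> s \<longrightarrow> (LINT c|\<nu>' s. \<psi> c) = 0"
    by eventually_elim (meson atLeastAtMost_iff real_arch_simple)
  have conc: "AE c in \<nu>' s. c \<in> C" if "0 \<le> s" "(LINT c|\<nu>' s. \<psi> c) = 0" for s
  proof -
    have "integrable (\<nu>' s) \<psi>" using kernel_integral_bound(1)[OF \<nu>' \<psi>m _ that(1), of 1] \<psi>(3) by simp
    then have "AE c in \<nu>' s. \<psi> c = 0" using that(2) \<psi>(2)
      by (subst (asm) integral_nonneg_eq_0_iff_AE) auto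
    then show ?thesis using \<psi>(4) by simp
  qed
  obtain a0 where a0: "a0 \<in> K" using K(2) by blast
  \<comment> \<open>Redefined off \<open>C\<close>, a null set of \<open>\<nu>' s\<close> for almost
    every \<open>s\<close>, so as to take values in \<open>K\<close> everywhere.\<close>
  define \<gamma>' where "\<gamma>' = (\<lambda>c. if c \<in> C then \<gamma> c else a0)"
  have \<gamma>b: "\<gamma> \<in> borel_measurable borel" using \<gamma>(1) by (rule borel_measurable_continuous_onI)
  have \<gamma>': "\<gamma>' \<in> borel \<rightarrow>\<^sub>M ?N"
  proof (rule measurable_restrict_space2)
    show "\<gamma>' \<in> space borel \<rightarrow> K" using a0 by (auto simp: \<gamma>'_def C_def)
    show "\<gamma>' \<in> borel_measurable borel" unfolding \<gamma>'_def using C \<gamma>b by (intro measurable_If_set) auto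
  qed
  define m where "m = (\<lambda>s. distr (\<nu>' s) ?N \<gamma>')"
  have "m \<in> kernels K"
    using measurable_compose[OF \<nu>' measurable_distr_prob_space[OF \<gamma>']] by (simp add: m_def kernels_def)
  moreover have "young_conv K (\<lambda>k. ms (r k)) m"
    unfolding young_conv_def
  proof (intro allI impI)
    fix \<phi> :: "'a \<Rightarrow> real" and t :: real assume \<phi>: "continuous_on K \<phi>" and t: "0 \<le> t"
    obtain B where B: "0 < B" "\<And>a. a \<in> K \<Longrightarrow> norm (\<phi> a) \<le> B" using compact_bounded_fun[OF K(1) \<phi>] by blast
    \<comment> \<open>The curve may leave \<open>K\<close> between its visits, so only an extension
      of \<open>\<phi>\<close> to the whole space can be composed with it.\<close>
    obtain \<Phi> where \<Phi>: "continuous_on UNIV \<Phi>" "\<And>a. a \<in> K \<Longrightarrow> \<Phi> a = \<phi> a" "\<And>a. norm (\<Phi> a) \<le> B"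
      using Tietze[OF \<phi>, of UNIV B] B compact_imp_closed[OF K(1)] by auto
    have c: "continuous_on UNIV (\<lambda>c. \<Phi> (\<gamma> c))"
      using continuous_on_compose2[OF \<Phi>(1) \<gamma>(1)] by simp
    then have cm: "(\<lambda>c. \<Phi> (\<gamma> c)) \<in> borel_measurable borel" by (rule borel_measurable_continuous_onI)
    have \<phi>m: "\<phi> \<in> borel_measurable ?N" using \<phi> by (rule borel_measurable_continuous_on_restrict)
    have eq1: "(LINT c|\<nu> k s. \<Phi> (\<gamma> c)) = (LINT a|ms k s. \<phi> a)" if s: "0 \<le> s" for k s
      unfolding \<nu>int[OF cm s] using kernelsD[OF ms s, of k] \<sigma>(2) \<Phi>(2)
      by (intro Bochner_Integration.integral_cong) auto
    have eq2: "(LINT c|\<nu>' s. \<Phi> (\<gamma> c)) = (LINT a|m s. \<phi> a)" if s: "0 \<le> s" "(LINT c|\<nu>' s. \<psi> c) = 0" for s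
    proof -
      have "\<gamma>' \<in> \<nu>' s \<rightarrow>\<^sub>M ?N"
        using \<gamma>' measurable_cong_sets[OF \<nu>'D(2)[OF s(1)] refl] by blast
      then have "(LINT a|m s. \<phi> a) = (LINT c|\<nu>' s. \<phi> (\<gamma>' c))"
        unfolding m_def by (rule integral_distr) (rule \<phi>m)
      also have "\<dots> = (LINT c|\<nu>' s. \<Phi> (\<gamma> c))"
      proof (rule integral_cong_AE)
        show "AE c in \<nu>' s. \<phi> (\<gamma>' c) = \<Phi> (\<gamma> c)"
          using conc[OF s] by eventually_elim (auto simp: \<gamma>'_def C_def \<Phi>(2))
        have "(\<lambda>c. \<phi> (\<gamma>' c)) \<in> borel_measurable borel" using measurable_compose[OF \<gamma>' \<phi>m] .
        then show "(\<lambda>c. \<phi> (\<gamma>' c)) \<in> borel_measurable (\<nu>' s)" 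
          using measurable_cong_sets[OF \<nu>'D(2)[OF s(1)] refl] by blast
        show "(\<lambda>c. \<Phi> (\<gamma> c)) \<in> borel_measurable (\<nu>' s)"
          using cm measurable_cong_sets[OF \<nu>'D(2)[OF s(1)] refl] by blast
      qed
      finally show ?thesis by simp
    qed
    have "(\<lambda>k. LINT s:{0..t}|lebesgue. LINT c|\<nu> (r k) s. \<Phi> (\<gamma> c)) \<longlonglongrightarrow> (LINT s:{0..t}|lebesgue. LINT c|\<nu>' s. \<Phi> (\<gamma> c))"
      by (rule conv[OF c _ t, of B]) (use \<Phi>(3) in auto)
    moreover have "(LINT s:{0..t}|lebesgue. LINT c|\<nu> k s. \<Phi> (\<gamma> c)) = (LINT s:{0..t}|lebesgue. LINT a|ms k s. \<phi> a)" for k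
      using eq1 by (intro set_lebesgue_integral_cong) auto
    moreover have "(LINT s:{0..t}|lebesgue. LINT c|\<nu>' s. \<Phi> (\<gamma> c)) = (LINT s:{0..t}|lebesgue. LINT a|m s. \<phi> a)"
      unfolding set_lebesgue_integral_def
    proof (rule integral_cong_AE)
      show "AE s in lebesgue. indicator {0..t} s *\<^sub>R (LINT c|\<nu>' s. \<Phi> (\<gamma> c)) = indicator {0..t} s *\<^sub>R (LINT a|m s. \<phi> a)"
        using ae by eventually_elim (use eq2 in \<open>auto simp: indicator_def\<close>)
      show "(\<lambda>s. indicator {0..t} s *\<^sub>R (LINT c|\<nu>' s. \<Phi> (\<gamma> c))) \<in> borel_measurable lebesgue"
        using set_borel_measurable_halfline[OF measurable_kernel_integral[OF \<nu>' cm], of "{0..t}"]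
        by (auto simp: set_borel_measurable_def)
      show "(\<lambda>s. indicator {0..t} s *\<^sub>R (LINT a|m s. \<phi> a)) \<in> borel_measurable lebesgue"
        using set_borel_measurable_halfline[OF measurable_kernel_integral[OF \<open>m \<in> kernels K\<close>[unfolded kernels_def] \<phi>m], of "{0..t}"]
        by (auto simp: set_borel_measurable_def)
    qed
    ultimately show "(\<lambda>k. LINT s:{0..t}|lebesgue. LINT a|ms (r k) s. \<phi> a) \<longlonglongrightarrow> (LINT s:{0..t}|lebesgue. LINT a|m s. \<phi> a)"
      by simp
  qed
  ultimately show ?thesis using r that by blast
qed

section \<open>Weak* measurability\<close>

text \<open>Provides an intersection-stable generator made of sets whose indicators are limits of
  continuous functions.\<close>

lemma sets_restrict_closed:
  fixes K :: "'a::euclidean_space set"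
  assumes "closed K"
  shows "sets (restrict_space borel K) = sigma_sets K {A. closed A \<and> A \<subseteq> K}"
proof -
  have "sets (restrict_space borel K) = (\<inter>) K ` sigma_sets UNIV (Collect closed)"
    unfolding sets_restrict_space by (simp add: borel_eq_closed)
  also have "\<dots> = sigma_sets K ((\<inter>) K ` Collect closed)"
    using assms by (intro restricted_sigma) auto
  also have "(\<inter>) K ` Collect closed = {A. closed A \<and> A \<subseteq> K}"
    using assms by (auto simp: image_iff intro!: exI[of _ "_ :: 'a set"])
  finally show ?thesis .
qed

text \<open>Weighted averages with hat functions on finite \<open>1/(n+1)\<close>-nets and rational
  coefficients are countably many, and uniform continuity makes them dense for the supremum norm on
  \<open>K\<close>.\<close>

lemma countable_dense_continuous:
  fixes K :: "'a::euclidean_space set"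
  assumes K: "compact K"
  obtains D :: "('a \<Rightarrow> real) set" where "countable D" "\<And>\<psi>. \<psi> \<in> D \<Longrightarrow> continuous_on K \<psi>"
    "\<And>\<phi> e. continuous_on K \<phi> \<Longrightarrow> 0 < e \<Longrightarrow> \<exists>\<psi>\<in>D. \<forall>a\<in>K. \<bar>\<psi> a - \<phi> a\<bar> < e"
proof -
  have "\<exists>S. S \<subseteq> K \<and> finite S \<and> K \<subseteq> (\<Union>c\<in>S. ball c (1 / real (Suc n)))" for n
  proof -
    have "K \<subseteq> (\<Union>c\<in>K. ball c (1 / real (Suc n)))"
    proof
      fix x assume "x \<in> K"
      then show "x \<in> (\<Union>c\<in>K. ball c (1 / real (Suc n)))" by (intro UN_I[of x]) auto
    qed
    then show ?thesis
      using compactE_image[OF K, of K "\<lambda>c. ball c (1 / real (Suc n))"] by (metis open_ball)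
  qed
  then obtain S where S: "\<And>n. S n \<subseteq> K" "\<And>n. finite (S n)" "\<And>n. K \<subseteq> (\<Union>c\<in>S n. ball c (1 / real (Suc n)))"
    by metis
  define h where "h = (\<lambda>(n::nat) (c::'a) x. max 0 (1 / real (Suc n) - dist c x))"
  define F where "F = (\<lambda>n q x. (\<Sum>c\<in>S n. q c * h n c x) / (\<Sum>c\<in>S n. h n c x))"
  \<comment> \<open>Extensional coefficient functions on a finite net form a countable set.\<close>
  define D where "D = (\<Union>n. F n ` (PiE (S n) (\<lambda>_. \<rat>)))"
  have h0: "0 \<le> h n c x" for n c x by (simp add: h_def)
  have pos: "0 < (\<Sum>c\<in>S n. h n c x)" if "x \<in> K" for n x
  proof -
    have "x \<in> (\<Union>c\<in>S n. ball c (1 / real (Suc n)))" using S(3)[of n] that by blast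
    then obtain c where c: "c \<in> S n" "dist c x < 1 / real (Suc n)" unfolding UN_iff mem_ball by blast
    then have "0 < h n c x" by (simp add: h_def)
    then show ?thesis using S(2)[of n] h0 c(1) by (intro sum_pos2[of _ c])
  qed
  have "countable D" unfolding D_def using S(2) countable_rat by (intro countable_UN countable_image countable_PiE) auto
  moreover have "continuous_on K \<psi>" if "\<psi> \<in> D" for \<psi>
  proof -
    have "continuous_on K (F n q)" for n q
      unfolding F_def using pos[of _ n] by (intro continuous_intros) (auto simp: h_def less_le intro!: continuous_intros)
    then show ?thesis using that by (auto simp: D_def)
  qed
  moreover have "\<exists>\<psi>\<in>D. \<forall>a\<in>K. \<bar>\<psi> a - \<phi> a\<bar> < e" if \<phi>: "continuous_on K \<phi>" and e: "0 < e" for \<phi> :: "'a \<Rightarrow> real" and e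
  proof -
    obtain d where d: "0 < d" "\<And>x y. x \<in> K \<Longrightarrow> y \<in> K \<Longrightarrow> dist x y < d \<Longrightarrow> \<bar>\<phi> x - \<phi> y\<bar> < e / 3"
      using compact_uniformly_continuous[OF \<phi> K] e unfolding uniformly_continuous_on_def dist_real_def
      by (metis dist_commute divide_pos_pos zero_less_numeral)
    obtain n where n: "1 / real (Suc n) < d" using d(1) by (meson nat_approx_posE)
    have "\<exists>r\<in>\<rat>. \<bar>r - \<phi> c\<bar> < e / 3" for c
      using Rats_dense_in_real[of "\<phi> c" "\<phi> c + e/3"] e by (metis abs_of_pos add.commute diff_gt_0_iff_gt diff_less_eq divide_pos_pos less_add_same_cancel1 zero_less_numeral)
    then obtain q0 where q0: "\<And>c. q0 c \<in> \<rat>" "\<And>c. \<bar>q0 c - \<phi> c\<bar> < e / 3" by metis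
    define q where "q = restrict q0 (S n)"
    have "F n q \<in> D" unfolding D_def using q0(1) by (intro UN_I[of n] imageI) (auto simp: q_def)
    moreover have "\<bar>F n q x - \<phi> x\<bar> < e" if x: "x \<in> K" for x
    proof -
      let ?s = "\<Sum>c\<in>S n. h n c x"
      \<comment> \<open>Only net points within \<open>1/(n+1)\<close> of \<open>x\<close> have
        positive weight; for them the oscillation of \<open>\<phi>\<close> and the rational rounding
        cost \<open>e/3\<close> each.\<close>
      have "\<bar>(\<Sum>c\<in>S n. (q c - \<phi> x) * h n c x)\<bar> \<le> (\<Sum>c\<in>S n. (2 * e / 3) * h n c x)"
      proof (rule order_trans[OF sum_abs], rule sum_mono)
        fix c assume c: "c \<in> S n"
        show "\<bar>(q c - \<phi> x) * h n c x\<bar> \<le> (2 * e / 3) * h n c x"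
        proof (cases "dist c x < 1 / real (Suc n)")
          case True
          then have "\<bar>\<phi> c - \<phi> x\<bar> < e / 3" using c S(1) x n by (intro d(2)) auto
          moreover have "\<bar>q c - \<phi> c\<bar> < e / 3" using q0(2) c by (simp add: q_def)
          ultimately have "\<bar>q c - \<phi> x\<bar> \<le> 2 * e / 3" by linarith
          from mult_right_mono[OF this h0[of n c x]] show ?thesis by (simp only: abs_mult abs_of_nonneg[OF h0])
        next
          case False
          then have "h n c x = 0" by (simp add: h_def max_def del: of_nat_Suc)
          then show ?thesis by simp
        qed
      qed
      also have "\<dots> = (2 * e / 3) * ?s" by (simp add: sum_distrib_left)
      finally have "\<bar>(\<Sum>c\<in>S n. (q c - \<phi> x) * h n c x)\<bar> / ?s \<le> 2 * e / 3"
        using pos[OF x, of n] by (simp add: divide_le_eq)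
      moreover have "F n q x - \<phi> x = (\<Sum>c\<in>S n. (q c - \<phi> x) * h n c x) / ?s"
        using pos[OF x, of n] by (simp add: F_def left_diff_distrib sum_subtractf sum_distrib_left[symmetric] field_simps)
      ultimately have "\<bar>F n q x - \<phi> x\<bar> \<le> 2 * e / 3" using pos[OF x, of n] by (simp add: abs_divide)
      then show ?thesis using e by linarith
    qed
    ultimately show ?thesis by blast
  qed
  ultimately show ?thesis using that by blast
qed

lemma borel_approx_closed:
  fixes A :: "'a::euclidean_space set"
  assumes "closed A" "A \<noteq> {}"
  shows "(\<lambda>n. max 0 (1 - real n * infdist a A)) \<longlonglongrightarrow> indicator A a"
proof (cases "a \<in> A")
  case False
  then have p: "0 < infdist a A" using assms infdist_pos_not_in_closed by blast
  have "eventually (\<lambda>n. max 0 (1 - real n * infdist a A) = 0) sequentially"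
  proof -
    obtain n0 where n0: "1 < real n0 * infdist a A" using reals_Archimedean3[OF p] by blast
    show ?thesis
    proof (rule eventually_sequentiallyI[of n0])
      fix n assume "n0 \<le> n"
      then have "real n0 * infdist a A \<le> real n * infdist a A" using p by (intro mult_right_mono) auto
      then show "max 0 (1 - real n * infdist a A) = 0" using n0 by simp
    qed
  qed
  then show ?thesis using False by (simp add: tendsto_eventually)
qed simp

lemma integrable_prob_measures:
  fixes \<phi> :: "'a::euclidean_space \<Rightarrow> 'c::{banach,second_countable_topology}"
  assumes "compact K" "\<mu> \<in> prob_measures K" "continuous_on K \<phi>"
  shows "integrable \<mu> \<phi>"
proof -
  have \<mu>: "prob_space \<mu>" "sets \<mu> = sets (restrict_space borel K)" using assms(2) by (auto simp: prob_measures_def space_prob_algebra)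
  have sp: "space \<mu> = K" using sets_eq_imp_space_eq[OF \<mu>(2)] by (simp add: space_restrict_space)
  obtain C where "\<And>a. a \<in> K \<Longrightarrow> norm (\<phi> a) \<le> C" using compact_bounded_fun[OF assms(1,3)] by blast
  moreover have "\<phi> \<in> borel_measurable \<mu>"
    using borel_measurable_continuous_on_restrict[OF assms(3)] measurable_cong_sets[OF \<mu>(2) refl] by blast
  ultimately show ?thesis using prob_space.norm_integral_le_const(1)[OF \<mu>(1)] sp by blast
qed

lemma topspace_weak_star: "topspace (weak_star_topology K) = prob_measures K"
proof
  have "openin (weak_star_topology K) {\<mu> \<in> prob_measures K. (LINT a|\<mu>. 0) \<in> (UNIV :: real set)}"
    unfolding weak_star_topology_def using continuous_on_const open_UNIV by (intro topology_generated_by_Basis) blast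
  from openin_subset[OF this] show "prob_measures K \<subseteq> topspace (weak_star_topology K)" by simp
  show "topspace (weak_star_topology K) \<subseteq> prob_measures K"
    unfolding weak_star_topology_def topology_generated_by_topspace by blast
qed

text \<open>Integration of a continuous function is weak-star continuous, so these integrals are
  measurable in \<open>s\<close>. Continuous cut-offs converging to the indicator of a closed set
  then give its mass as a measurable function, and closed sets generate.\<close>

lemma relaxed_controls_subset:
  assumes K: "compact K" and u: "u \<in> relaxed_controls K"
  shows "u \<in> kernels K"
proof -
  let ?N = "restrict_space borel K"
  have us: "u s \<in> prob_measures K" if "0 \<le> s" for s
    using measurable_space[OF u[unfolded relaxed_controls_def], of s] that
    by (simp add: space_restrict_space topspace_weak_star space_measure_of_conv)
  then have ps: "prob_space (u s)" "sets (u s) = sets ?N" if "0 \<le> s" for s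
    using that by (auto simp: prob_measures_def space_prob_algebra)
  have int: "(\<lambda>s. LINT a|u s. \<phi> a) \<in> borel_measurable halfline" if "continuous_on K \<phi>" for \<phi> :: "'a \<Rightarrow> real"
  proof (rule borel_measurableI)
    fix U :: "real set" assume "open U"
    then have "openin (weak_star_topology K) {\<mu> \<in> prob_measures K. (LINT a|\<mu>. \<phi> a) \<in> U}"
      unfolding weak_star_topology_def using that by (intro topology_generated_by_Basis) blast
    then have "{\<mu> \<in> prob_measures K. (LINT a|\<mu>. \<phi> a) \<in> U} \<in> sets (sigma (topspace (weak_star_topology K)) {U. openin (weak_star_topology K) U})"
    proof -
      have "{U. openin (weak_star_topology K) U} \<subseteq> Pow (topspace (weak_star_topology K))" by (auto dest: openin_subset)
      with \<open>openin _ _\<close> show ?thesis by (subst sets_measure_of) (assumption, rule sigma_sets.Basic, rule CollectI)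
    qed
    from measurable_sets[OF u[unfolded relaxed_controls_def] this]
    have "u -` {\<mu> \<in> prob_measures K. (LINT a|\<mu>. \<phi> a) \<in> U} \<inter> space halfline \<in> sets halfline" .
    also have "u -` {\<mu> \<in> prob_measures K. (LINT a|\<mu>. \<phi> a) \<in> U} \<inter> space halfline = (\<lambda>s. LINT a|u s. \<phi> a) -` U \<inter> space halfline"
      using us by (auto simp: space_restrict_space)
    finally show "(\<lambda>s. LINT a|u s. \<phi> a) -` U \<inter> space halfline \<in> sets halfline" .
  qed
  show ?thesis
    unfolding kernels_def
  proof (rule measurable_prob_algebra_generated[OF sets_restrict_closed[OF compact_imp_closed[OF K]]])
    show "Int_stable {A. closed A \<and> A \<subseteq> K}" by (auto simp: Int_stable_def)
    fix A assume "A \<in> {A. closed A \<and> A \<subseteq> K}"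
    then have A: "closed A" "A \<subseteq> K" by auto
    show "(\<lambda>s. emeasure (u s) A) \<in> borel_measurable halfline"
    proof (cases "A = {}")
      case False
      let ?f = "\<lambda>n a. max 0 (1 - real n * infdist a A)"
      have lim: "(\<lambda>n. LINT a|u s. ?f n a) \<longlonglongrightarrow> measure (u s) A" if s: "0 \<le> s" for s
      proof -
        have As: "A \<in> sets (u s)" unfolding ps(2)[OF s] sets_restrict_closed[OF compact_imp_closed[OF K]] using A by blast
        have "(\<lambda>n. LINT a|u s. ?f n a) \<longlonglongrightarrow> (LINT a|u s. indicator A a)"
        proof (rule integral_dominated_convergence[where w="\<lambda>_. 1"])
          show "(indicator A :: _ \<Rightarrow> real) \<in> borel_measurable (u s)" using As by measurable
          have "continuous_on K (?f n)" for n by (intro continuous_intros)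
          then show "?f n \<in> borel_measurable (u s)" for n
            using integrable_prob_measures[OF K us[OF s]] by (auto intro: borel_measurable_integrable)
          show "integrable (u s) (\<lambda>_. 1 :: real)" using ps(1)[OF s] 
            using finite_measure.integrable_const prob_space_def by blast
          show "AE a in u s. (\<lambda>n. ?f n a) \<longlonglongrightarrow> indicator A a" using borel_approx_closed[OF A(1) False] by auto
          show "AE a in u s. norm (?f n a) \<le> 1" for n
          proof (intro AE_I2)
            fix a
            have "0 \<le> real n * infdist a A" by (simp add: infdist_nonneg)
            then show "norm (?f n a) \<le> 1" by simp
          qed
        qed
        then show ?thesis using As by simp
      qed
      have "(\<lambda>s. measure (u s) A) \<in> borel_measurable halfline"
        by (rule borel_measurable_LIMSEQ_real[of _ "\<lambda>n s. LINT a|u s. ?f n a"])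
          (use lim in \<open>auto simp: space_restrict_space intro!: int continuous_intros\<close>)
      then have "(\<lambda>s. ennreal (measure (u s) A)) \<in> borel_measurable halfline" by measurable
      also have "?this \<longleftrightarrow> ?thesis" using ps(1)
        by (intro measurable_cong) (auto simp: space_restrict_space prob_space_def finite_measure.emeasure_eq_measure)
      finally show ?thesis .
    qed simp
  qed (use ps in \<open>auto simp: space_restrict_space\<close>)
qed

text \<open>Generators of the topology have measurable preimages, but open sets are arbitrary unions
  of their finite intersections. A countable base is therefore needed: finite intersections of
  conditions \<open>q < \<integral> \<psi> d\<mu> < r\<close> with \<open>\<psi>\<close> in a
  countable dense set and rational \<open>q\<close>, \<open>r\<close>.\<close>

lemma kernels_subset_relaxed_controls:
  fixes K :: "'a::euclidean_space set"
  assumes K: "compact K" and u: "u \<in> kernels K"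
  shows "u \<in> relaxed_controls K"
proof -
  obtain D :: "('a \<Rightarrow> real) set" where D: "countable D" "\<And>\<psi>. \<psi> \<in> D \<Longrightarrow> continuous_on K \<psi>"
    "\<And>\<phi> e. continuous_on K \<phi> \<Longrightarrow> 0 < e \<Longrightarrow> \<exists>\<psi>\<in>D. \<forall>a\<in>K. \<bar>\<psi> a - \<phi> a\<bar> < e"
    using countable_dense_continuous[OF K] by blast
  let ?P = "prob_measures K"
  define I where "I = D \<times> (\<rat> :: real set) \<times> (\<rat> :: real set)"
  define b where "b = (\<lambda>X. {\<mu>\<in>?P. \<forall>(\<psi> :: 'a \<Rightarrow> real, q :: real, r :: real)\<in>X. q < (LINT a|\<mu>. \<psi> a) \<and> (LINT a|\<mu>. \<psi> a) < r})"
  define B where "B = b ` {X. finite X \<and> X \<subseteq> I}"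
  have cB: "countable B" unfolding B_def I_def
    by (intro countable_image countable_Collect_finite_subset countable_SIGMA D countable_rat)
  have base: "\<exists>V\<in>B. \<mu> \<in> V \<and> V \<subseteq> U" if "generate_topology_on 
     {{\<mu> \<in> prob_measures K. (LINT a|\<mu>. \<phi> a) \<in> U} |(\<phi> :: 'a \<Rightarrow> real) U. continuous_on K \<phi> \<and> open U} U" "\<mu> \<in> U" for U \<mu>
    using that
  proof (induction arbitrary: \<mu>)
    case (Int X Y)
    then have "\<mu> \<in> X" "\<mu> \<in> Y" by blast+
    from Int.IH(1)[OF this(1)] obtain V where V: "V \<in> B" "\<mu> \<in> V" "V \<subseteq> X" by blast
    from Int.IH(2)[OF \<open>\<mu> \<in> Y\<close>] obtain W where W: "W \<in> B" "\<mu> \<in> W" "W \<subseteq> Y" by blast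
    from V W obtain x y where "x \<in> {X. finite X \<and> X \<subseteq> I}" "y \<in> {X. finite X \<and> X \<subseteq> I}" "\<mu> \<in> b x" "b x \<subseteq> X" "\<mu> \<in> b y" "b y \<subseteq> Y"
      unfolding B_def by blast
    moreover have "b (x \<union> y) = b x \<inter> b y" unfolding b_def ball_Un by blast
    ultimately show ?case unfolding B_def by (intro bexI[of _ "b (x \<union> y)"]) auto
  next
    case (UN \<K>)
    then obtain k where "k \<in> \<K>" "\<mu> \<in> k" by blast
    with UN.IH[of k \<mu>] show ?case by blast
  next
    case (Basis s)
    then obtain \<phi> :: "'a \<Rightarrow> real" and U where s: "s = {\<mu> \<in> prob_measures K. (LINT a|\<mu>. \<phi> a) \<in> U}" and \<phi>: "continuous_on K \<phi>" and "open U"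
      by blast
    with Basis have \<mu>: "\<mu> \<in> ?P" "(LINT a|\<mu>. \<phi> a) \<in> U" by auto
    then obtain e where e: "0 < e" "\<And>x. \<bar>x - (LINT a|\<mu>. \<phi> a)\<bar> < e \<Longrightarrow> x \<in> U"
      using \<open>open U\<close> unfolding open_dist dist_real_def by blast
    \<comment> \<open>Replacing \<open>\<phi>\<close> by \<open>\<psi>\<close> costs
      \<open>e/5\<close> for each of the two measures, and the rational window around the integral
      of \<open>\<psi>\<close> another \<open>e/5\<close>.\<close>
    obtain \<psi> where \<psi>: "\<psi> \<in> D" "\<And>a. a \<in> K \<Longrightarrow> \<bar>\<psi> a - \<phi> a\<bar> < e / 5" using D(3)[OF \<phi>, of "e / 5"] e by auto
    have close: "\<bar>(LINT a|\<nu>. \<psi> a) - (LINT a|\<nu>. \<phi> a)\<bar> \<le> e / 5" if \<nu>: "\<nu> \<in> ?P" for \<nu>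
    proof -
      have p: "prob_space \<nu>" "sets \<nu> = sets (restrict_space borel K)" using \<nu> by (auto simp: prob_measures_def space_prob_algebra)
      have sp: "space \<nu> = K" using sets_eq_imp_space_eq[OF p(2)] by (simp add: space_restrict_space)
      have i: "integrable \<nu> \<psi>" "integrable \<nu> \<phi>" using integrable_prob_measures[OF K \<nu>] \<phi> D(2)[OF \<psi>(1)] by auto
      have "norm (LINT a|\<nu>. \<psi> a - \<phi> a) \<le> e / 5"
        using \<psi>(2) sp by (intro prob_space.norm_integral_le_const(2)[OF p(1)]) (auto simp: less_imp_le intro!: borel_measurable_diff borel_measurable_integrable i)
      then show ?thesis using i by simp
    qed
    obtain q where q: "q \<in> \<rat>" "(LINT a|\<mu>. \<psi> a) - e / 5 < q" "q < (LINT a|\<mu>. \<psi> a)"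
      using Rats_dense_in_real[of "(LINT a|\<mu>. \<psi> a) - e / 5" "(LINT a|\<mu>. \<psi> a)"] e by auto
    obtain r where r: "r \<in> \<rat>" "(LINT a|\<mu>. \<psi> a) < r" "r < (LINT a|\<mu>. \<psi> a) + e / 5"
      using Rats_dense_in_real[of "(LINT a|\<mu>. \<psi> a)" "(LINT a|\<mu>. \<psi> a) + e / 5"] e by auto
    have "b {(\<psi>, q, r)} \<subseteq> s"
    proof
      fix \<nu> assume "\<nu> \<in> b {(\<psi>, q, r)}"
      then have \<nu>: "\<nu> \<in> ?P" "q < (LINT a|\<nu>. \<psi> a)" "(LINT a|\<nu>. \<psi> a) < r" by (auto simp: b_def)
      have "\<bar>(LINT a|\<nu>. \<phi> a) - (LINT a|\<mu>. \<phi> a)\<bar> < e"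
        using close[OF \<nu>(1)] close[OF \<mu>(1)] \<nu>(2,3) q r e(1) by linarith
      then show "\<nu> \<in> s" using e(2) \<nu>(1) s by blast
    qed
    moreover have "\<mu> \<in> b {(\<psi>, q, r)}" using q r \<mu> by (auto simp: b_def)
    moreover have "b {(\<psi>, q, r)} \<in> B" unfolding B_def I_def using \<psi>(1) q r by (intro imageI) auto
    ultimately show ?case by blast
  qed simp
  have us: "u s \<in> ?P" if "0 \<le> s" for s
    using kernelsD[OF u that] by (auto simp: prob_measures_def space_prob_algebra)
  have meas: "u -` V \<inter> space halfline \<in> sets halfline" if "V \<in> B" for V
  proof -
    obtain X where X: "finite X" "X \<subseteq> I" "V = b X" using \<open>V \<in> B\<close> by (auto simp: B_def)
    have "u -` V \<inter> space halfline = {s\<in>space halfline. \<forall>x\<in>X. fst (snd x) < (LINT a|u s. fst x a) \<and> (LINT a|u s. fst x a) < snd (snd x)}"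
      using us X(3) by (fastforce simp: b_def space_restrict_space)
    also have "\<dots> \<in> sets halfline"
    proof (rule sets.sets_Collect_finite_All[OF _ X(1)])
      fix x assume "x \<in> X"
      then have "continuous_on K (fst x)" using X(2) D(2) by (auto simp: I_def)
      then have [measurable]: "(\<lambda>s. LINT a|u s. fst x a) \<in> borel_measurable halfline"
        by (intro measurable_kernel_integral[OF u[unfolded kernels_def]] borel_measurable_continuous_on_restrict)
      show "{s\<in>space halfline. fst (snd x) < (LINT a|u s. fst x a) \<and> (LINT a|u s. fst x a) < snd (snd x)} \<in> sets halfline"
        by measurable
    qed
    finally show ?thesis .
  qed
  show ?thesis
    unfolding relaxed_controls_def
  proof (rule measurable_measure_of)
    show "{U. openin (weak_star_topology K) U} \<subseteq> Pow (topspace (weak_star_topology K))" by (auto dest: openin_subset)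
    show "u \<in> space halfline \<rightarrow> topspace (weak_star_topology K)"
      using us by (auto simp: topspace_weak_star space_restrict_space)
    fix U assume "U \<in> {U. openin (weak_star_topology K) U}"
    then have U: "generate_topology_on 
     {{\<mu> \<in> prob_measures K. (LINT a|\<mu>. \<phi> a) \<in> U} |(\<phi> :: 'a \<Rightarrow> real) U. continuous_on K \<phi> \<and> open U} U"
      by (simp add: weak_star_topology_def openin_topology_generated_by_iff)
    \<comment> \<open>The countable base turns the preimage of an arbitrary open set into a
      countable union.\<close>
    have "u -` U \<inter> space halfline = (\<Union>V\<in>{V\<in>B. V \<subseteq> U}. u -` V \<inter> space halfline)"
      using base[OF U] by blast
    also have "\<dots> \<in> sets halfline"
      using cB meas by (intro sets.countable_UN'') auto
    finally show "u -` U \<inter> space halfline \<in> sets halfline" .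
  qed
qed

lemma relaxed_controls_eq_kernels: "compact K \<Longrightarrow> relaxed_controls K = kernels K"
  using relaxed_controls_subset kernels_subset_relaxed_controls by blast

section \<open>Caratheodory equations\<close>

lemma set_integrable_halfline_Icc:
  fixes h :: "real \<Rightarrow> 'c::euclidean_space"
  assumes "h \<in> borel_measurable halfline" "0 \<le> a" "\<And>s. s \<in> {a..b} \<Longrightarrow> norm (h s) \<le> C"
  shows "set_integrable lebesgue {a..b} h"
  by (rule set_integrable_halfline[OF assms(1)]) (use assms in auto)

lemma set_integral_dominated_halfline:
  fixes h :: "real \<Rightarrow> 'c::euclidean_space"
  assumes hk: "\<And>k. hk k \<in> borel_measurable halfline" and h: "h \<in> borel_measurable halfline"
    and lim: "\<And>s. s \<in> {0..t} \<Longrightarrow> (\<lambda>k. hk k s) \<longlonglongrightarrow> h s"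
    and bd: "\<And>k s. s \<in> {0..t} \<Longrightarrow> norm (hk k s) \<le> C"
  shows "(\<lambda>k. LINT s:{0..t}|lebesgue. hk k s) \<longlonglongrightarrow> (LINT s:{0..t}|lebesgue. h s)"
  unfolding set_lebesgue_integral_def
proof (rule integral_dominated_convergence[where w="\<lambda>s. indicator {0..t} s *\<^sub>R C"])
  have sb: "set_borel_measurable lebesgue {0..t} f" if "f \<in> borel_measurable halfline" for f :: "real \<Rightarrow> 'c"
    using that by (intro set_borel_measurable_halfline) auto
  show "(\<lambda>s. indicator {0..t} s *\<^sub>R h s) \<in> borel_measurable lebesgue"
    using sb[OF h] by (simp add: set_borel_measurable_def)
  show "(\<lambda>s. indicator {0..t} s *\<^sub>R hk k s) \<in> borel_measurable lebesgue" for k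
    using sb[OF hk] by (simp add: set_borel_measurable_def)
  show "integrable lebesgue (\<lambda>s. indicator {0..t} s *\<^sub>R C)"
    using set_integrable_halfline_Icc[of "\<lambda>_. C" 0 t "\<bar>C\<bar>"] by (simp add: set_integrable_def)
  show "AE s in lebesgue. (\<lambda>k. indicator {0..t} s *\<^sub>R hk k s) \<longlonglongrightarrow> indicator {0..t} s *\<^sub>R h s"
    using lim by (auto simp: indicator_def)
  show "AE s in lebesgue. norm (indicator {0..t} s *\<^sub>R hk k s) \<le> indicator {0..t} s *\<^sub>R C" for k
    using bd by (auto simp: indicator_def)
qed

lemma continuous_on_Ici:
  fixes f :: "real \<Rightarrow> 'c::topological_space"
  assumes "\<And>b. continuous_on {0..b} f"
  shows "continuous_on {0..} f"
  unfolding continuous_on_eq_continuous_within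
proof
  fix t :: real assume t: "t \<in> {0..}"
  have "at t within {0..} = at t within {0..t + 1}"
    by (rule at_within_nhd[of t "{..<t + 1}"]) auto
  then show "continuous (at t within {0..}) f"
    using assms[of "t + 1"] t by (auto simp: continuous_on_eq_continuous_within)
qed

lemma continuous_on_indefinite_integral:
  fixes h :: "real \<Rightarrow> 'c::euclidean_space"
  assumes "\<And>t. 0 \<le> t \<Longrightarrow> set_integrable lebesgue {0..t} h"
  shows "continuous_on {0..} (\<lambda>t. LINT s:{0..t}|lebesgue. h s)"
proof (rule continuous_on_Ici)
  fix b :: real
  show "continuous_on {0..b} (\<lambda>t. LINT s:{0..t}|lebesgue. h s)"
  proof (cases "0 \<le> b")
    case True
    have "continuous_on {0..b} (\<lambda>t. integral {0..t} h)"
      using assms[OF True] by (intro indefinite_integral_continuous_1 set_lebesgue_integral_eq_integral(1))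
    then show ?thesis
      by (rule continuous_on_eq) (use assms in \<open>auto simp: set_lebesgue_integral_eq_integral(2)\<close>)
  qed simp
qed

text \<open>The integrating factor: \<open>exp (- L t) (a + L \<integral>_0^t u)\<close> has
  nonpositive derivative, because \<open>u\<close> is at most the bracket.\<close>

lemma gronwall:
  fixes u :: "real \<Rightarrow> real"
  assumes u: "continuous_on {0..T} u" and L: "0 \<le> L"
    and le: "\<And>t. t \<in> {0..T} \<Longrightarrow> u t \<le> a + L * (LINT s:{0..t}|lebesgue. u s)"
    and t: "t \<in> {0..T}"
  shows "u t \<le> a * exp (L * t)"
proof -
  have eq: "(LINT s:{0..s'}|lebesgue. u s) = integral {0..s'} u" if "s' \<in> {0..T}" for s'
    by (intro set_lebesgue_integral_eq_integral(2) absolutely_integrable_continuous_real continuous_on_subset[OF u]) (use that in auto)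
  define w where "w = (\<lambda>t. exp (- L * t) * (a + L * integral {0..t} u))"
  have "w t \<le> w 0"
  proof (cases "0 < t")
    case True
    show ?thesis
    proof (rule DERIV_nonpos_imp_decreasing_open[of 0 t w])
      show "continuous_on {0..t} w" unfolding w_def
        by (intro continuous_intros indefinite_integral_continuous_1 integrable_continuous_real continuous_on_subset[OF u]) (use t in auto)
      fix x assume x: "0 < x" "x < t"
      have "((\<lambda>t. integral {0..t} u) has_real_derivative u x) (at x within {0..T})"
        using x t by (intro integral_has_real_derivative u) auto
      then have d: "((\<lambda>t. integral {0..t} u) has_real_derivative u x) (at x)"
        using x t by (subst (asm) at_within_Icc_at) auto
      have "(w has_real_derivative exp (- L * x) * (L * u x) + exp (- L * x) * (- L) * (a + L * integral {0..x} u)) (at x)"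
        unfolding w_def by (auto intro!: derivative_eq_intros d)
      moreover have "exp (- L * x) * (L * u x) + exp (- L * x) * (- L) * (a + L * integral {0..x} u) =
         exp (- L * x) * L * (u x - (a + L * integral {0..x} u))" by (simp add: algebra_simps)
      moreover have "\<dots> \<le> 0"
        using le[of x] eq[of x] x t L by (intro mult_nonneg_nonpos) auto
      ultimately show "\<exists>y. (w has_real_derivative y) (at x) \<and> y \<le> 0" by metis
    qed (use True in auto)
  next
    case False then show ?thesis using t by simp
  qed
  then have "exp (- L * t) * (a + L * integral {0..t} u) \<le> a" by (simp add: w_def)
  then have "a + L * integral {0..t} u \<le> a * exp (L * t)"
    by (simp add: exp_minus field_simps)
  then show ?thesis using le[OF t] eq[OF t] by simp
qed

lemma solution_continuous:
  assumes "solution g x y"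
  shows "continuous_on {0..} y"
proof -
  have "continuous_on {0..} (\<lambda>t. x + (LINT \<tau>:{0..t}|lebesgue. g \<tau> (y \<tau>)))"
    using assms by (intro continuous_intros continuous_on_indefinite_integral) (auto simp: solution_def)
  then show ?thesis
    by (rule continuous_on_eq) (use assms in \<open>auto simp: solution_def\<close>)
qed

lemma continuous_set_integrable:
  fixes u :: "real \<Rightarrow> 'c::euclidean_space"
  assumes "continuous_on {0..} u" "0 \<le> t"
  shows "set_integrable lebesgue {0..t} u"
  using assms by (intro absolutely_integrable_continuous_real continuous_on_subset[OF assms(1)]) auto

text \<open>Gronwall's inequality for \<open>1 + |y|\<close>, for which the growth condition is
  homogeneous.\<close>

lemma solution_bound:
  assumes y: "solution g x y" and t: "0 \<le> t" and B: "0 \<le> B"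
    and growth: "\<And>\<tau> z. 0 \<le> \<tau> \<Longrightarrow> norm (g \<tau> z) \<le> B * (1 + norm z)"
  shows "1 + norm (y t) \<le> (1 + norm x) * exp (B * t)"
proof (rule gronwall[of t _ B "1 + norm x"])
  have c: "continuous_on {0..} (\<lambda>t. 1 + norm (y t))" by (intro continuous_intros solution_continuous[OF y])
  show "continuous_on {0..t} (\<lambda>t. 1 + norm (y t))" by (rule continuous_on_subset[OF c]) auto
  fix s assume s: "s \<in> {0..t}"
  have i: "set_integrable lebesgue {0..s} (\<lambda>\<tau>. g \<tau> (y \<tau>))" and e: "y s = x + (LINT \<tau>:{0..s}|lebesgue. g \<tau> (y \<tau>))"
    using y s by (auto simp: solution_def)
  have "norm (y s) \<le> norm x + norm (LINT \<tau>:{0..s}|lebesgue. g \<tau> (y \<tau>))" unfolding e by (rule norm_triangle_ineq)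
  also have "norm (LINT \<tau>:{0..s}|lebesgue. g \<tau> (y \<tau>)) \<le> (LINT \<tau>:{0..s}|lebesgue. norm (g \<tau> (y \<tau>)))"
    using i by (rule set_integral_norm_bound)
  also have "\<dots> \<le> (LINT \<tau>:{0..s}|lebesgue. B * (1 + norm (y \<tau>)))"
    using set_integrable_norm[OF i] continuous_set_integrable[OF c, of s] s growth by (intro set_integral_mono) auto
  finally show "1 + norm (y s) \<le> 1 + norm x + B * (LINT \<tau>:{0..s}|lebesgue. 1 + norm (y \<tau>))"
    by simp
qed (use t B in auto)

text \<open>On \<open>[0,t]\<close> both solutions stay in a common ball, whose Lipschitz constant
  enters Gronwall's inequality with initial error 0. Extensionality settles the negative
  times.\<close>

lemma solution_unique:
  assumes y: "solution g x y1" "solution g x y2"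
    and lip: "\<And>R \<tau> z1 z2. 0 < R \<Longrightarrow> 0 \<le> \<tau> \<Longrightarrow> norm z1 \<le> R \<Longrightarrow> norm z2 \<le> R \<Longrightarrow>
      norm (g \<tau> z1 - g \<tau> z2) \<le> Lip R * norm (z1 - z2)"
    and Lip: "\<And>R. 0 < R \<Longrightarrow> 0 \<le> Lip R"
  shows "y1 = y2"
proof -
  have "y1 t = y2 t" if t: "0 \<le> t" for t
  proof -
    have c: "continuous_on {0..t} y1" "continuous_on {0..t} y2"
      using y by (auto intro: continuous_on_subset[OF solution_continuous])
    obtain R1 where R1: "\<And>s. s \<in> {0..t} \<Longrightarrow> norm (y1 s) \<le> R1"
      using compact_imp_bounded[OF compact_continuous_image[OF c(1)]] unfolding bounded_iff by blast
    obtain R2 where R2: "\<And>s. s \<in> {0..t} \<Longrightarrow> norm (y2 s) \<le> R2"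
      using compact_imp_bounded[OF compact_continuous_image[OF c(2)]] unfolding bounded_iff by blast
    define R where "R = max 1 (max R1 R2)"
    have R: "0 < R" "\<And>s. s \<in> {0..t} \<Longrightarrow> norm (y1 s) \<le> R" "\<And>s. s \<in> {0..t} \<Longrightarrow> norm (y2 s) \<le> R"
      using R1 R2 by (force simp: R_def le_max_iff_disj)+
    have cu: "continuous_on {0..} (\<lambda>s. norm (y1 s - y2 s))"
      using y by (intro continuous_intros solution_continuous) auto
    have "norm (y1 t - y2 t) \<le> 0 * exp (Lip R * t)"
    proof (rule gronwall[of t])
      show "continuous_on {0..t} (\<lambda>s. norm (y1 s - y2 s))" using c by (intro continuous_intros)
      show "0 \<le> Lip R" using Lip R(1) by simp
      fix s assume s: "s \<in> {0..t}"
      have i: "set_integrable lebesgue {0..s} (\<lambda>\<tau>. g \<tau> (y1 \<tau>))" "set_integrable lebesgue {0..s} (\<lambda>\<tau>. g \<tau> (y2 \<tau>))"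
        using y s by (auto simp: solution_def)
      have "y1 s = x + (LINT \<tau>:{0..s}|lebesgue. g \<tau> (y1 \<tau>))" "y2 s = x + (LINT \<tau>:{0..s}|lebesgue. g \<tau> (y2 \<tau>))"
        using y s unfolding solution_def by auto
      then have "y1 s - y2 s = (LINT \<tau>:{0..s}|lebesgue. g \<tau> (y1 \<tau>)) - (LINT \<tau>:{0..s}|lebesgue. g \<tau> (y2 \<tau>))"
        by simp
      also have "\<dots> = (LINT \<tau>:{0..s}|lebesgue. g \<tau> (y1 \<tau>) - g \<tau> (y2 \<tau>))"
        using set_integral_diff(2)[OF i] by simp
      finally have "norm (y1 s - y2 s) \<le> (LINT \<tau>:{0..s}|lebesgue. norm (g \<tau> (y1 \<tau>) - g \<tau> (y2 \<tau>)))"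
        using set_integral_norm_bound[OF set_integral_diff(1)[OF i]] by simp
      also have "\<dots> \<le> (LINT \<tau>:{0..s}|lebesgue. Lip R * norm (y1 \<tau> - y2 \<tau>))"
      proof (rule set_integral_mono)
        show "set_integrable lebesgue {0..s} (\<lambda>\<tau>. norm (g \<tau> (y1 \<tau>) - g \<tau> (y2 \<tau>)))"
          using set_integral_diff(1)[OF i] by (rule set_integrable_norm)
        show "set_integrable lebesgue {0..s} (\<lambda>\<tau>. Lip R * norm (y1 \<tau> - y2 \<tau>))"
          using continuous_set_integrable[OF cu, of s] s by auto
      qed (use s R lip in auto)
      finally show "norm (y1 s - y2 s) \<le> 0 + Lip R * (LINT \<tau>:{0..s}|lebesgue. norm (y1 \<tau> - y2 \<tau>))"
        by simp
    qed (use t in auto)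
    then show ?thesis by simp
  qed
  then show ?thesis using y by (intro extensionalityI[of _ "{0..}"]) (auto simp: solution_def)
qed

section \<open>Existence of solutions by truncation and successive approximation\<close>

definition radial_trunc :: "real \<Rightarrow> 'b::real_normed_vector \<Rightarrow> 'b" where
  "radial_trunc r z = (r / max r (norm z)) *\<^sub>R z"

text \<open>The constant 2 in the Lipschitz estimate comes from treating the change of the vector
  and the change of the scaling factor separately.\<close>

lemma radial_trunc:
  assumes "0 < r"
  shows "norm (radial_trunc r z) \<le> r" "norm (radial_trunc r z) \<le> norm z"
    "norm z \<le> r \<Longrightarrow> radial_trunc r z = z"
    "norm (radial_trunc r z - radial_trunc r z') \<le> 2 * norm (z - z')"
proof -
  have n: "norm (radial_trunc r z) = r * norm z / max r (norm z)"
    using assms by (simp add: radial_trunc_def)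
  have m: "0 < max r (norm z)" for z :: 'a using assms by (simp add: less_max_iff_disj)
  show "norm (radial_trunc r z) \<le> r" unfolding n pos_divide_le_eq[OF m] using assms by (simp add: mult_left_mono)
  show "norm (radial_trunc r z) \<le> norm z" unfolding n pos_divide_le_eq[OF m]
    by (subst mult.commute) (simp add: mult_left_mono)
  show "norm z \<le> r \<Longrightarrow> radial_trunc r z = z" using assms by (simp add: radial_trunc_def max_def)
  let ?m = "max r (norm z)" and ?m' = "max r (norm z')"
  have "radial_trunc r z - radial_trunc r z' = (r / ?m) *\<^sub>R (z - z') + (r / ?m - r / ?m') *\<^sub>R z'"
    by (simp add: radial_trunc_def algebra_simps)
  then have "norm (radial_trunc r z - radial_trunc r z') \<le> norm ((r / ?m) *\<^sub>R (z - z')) + norm ((r / ?m - r / ?m') *\<^sub>R z')"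
    by (metis norm_triangle_ineq)
  also have "norm ((r / ?m) *\<^sub>R (z - z')) \<le> norm (z - z')"
  proof -
    have "\<bar>r / ?m\<bar> \<le> 1" using assms m[of z] by (simp add: divide_le_eq)
    then show ?thesis using mult_right_mono[of "\<bar>r / ?m\<bar>" 1 "norm (z - z')"] by simp
  qed
  also have "norm ((r / ?m - r / ?m') *\<^sub>R z') \<le> norm (z - z')"
  proof -
    have "r / ?m - r / ?m' = (r / ?m) * ((?m' - ?m) / ?m')"
      using m[of z] m[of z'] by (simp add: field_simps)
    then have "norm ((r / ?m - r / ?m') *\<^sub>R z') = (r / ?m) * (\<bar>?m' - ?m\<bar> * (norm z' / ?m'))"
      using assms m[of z] m[of z'] by (simp add: abs_mult)
    also have "\<dots> \<le> 1 * (norm (z - z') * 1)"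
    proof (intro mult_mono)
      show "\<bar>?m' - ?m\<bar> \<le> norm (z - z')"
        using norm_triangle_ineq3[of z z'] norm_ge_zero[of "z-z'"] by linarith
    qed (use assms m[of z] m[of z'] in \<open>auto simp: divide_le_eq intro!: mult_nonneg_nonneg\<close>)
    finally show ?thesis by simp
  qed
  finally show "norm (radial_trunc r z - radial_trunc r z') \<le> 2 * norm (z - z')" by simp
qed

text \<open>Distances are measured with the weight \<open>exp (2 L t)\<close>: one integration
  halves the weighted distance of successive iterates, so the differences are summable on every
  bounded interval. The constants \<open>L T\<close> and \<open>C T\<close> are allowed to grow with
  the horizon.\<close>

lemma Picard_exists:
  fixes G :: "real \<Rightarrow> 'b::euclidean_space \<Rightarrow> 'b"
  assumes meas: "\<And>y. continuous_on {0..} y \<Longrightarrow> (\<lambda>\<tau>. G \<tau> (y \<tau>)) \<in> borel_measurable halfline"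
    and lip: "\<And>T \<tau> z1 z2. 0 \<le> \<tau> \<Longrightarrow> \<tau> \<le> T \<Longrightarrow> norm (G \<tau> z1 - G \<tau> z2) \<le> L T * norm (z1 - z2)"
    and bd: "\<And>T \<tau> z. 0 \<le> \<tau> \<Longrightarrow> \<tau> \<le> T \<Longrightarrow> norm (G \<tau> z) \<le> C T"
    and L: "\<And>T. 0 \<le> T \<Longrightarrow> 0 < L T"
  obtains y where "solution G x y"
proof -
  define Y where "Y = rec_nat (\<lambda>t. x) (\<lambda>_ y t. x + (LINT \<tau>:{0..t}|lebesgue. G \<tau> (y \<tau>)))"
  have Y0: "Y 0 = (\<lambda>t. x)" and YS: "Y (Suc k) = (\<lambda>t. x + (LINT \<tau>:{0..t}|lebesgue. G \<tau> (Y k \<tau>)))" for k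
    by (simp_all add: Y_def)
  have int: "set_integrable lebesgue {0..t} (\<lambda>\<tau>. G \<tau> (y \<tau>))" if "(\<lambda>\<tau>. G \<tau> (y \<tau>)) \<in> borel_measurable halfline" for y t
    using that bd by (intro set_integrable_halfline_Icc[where C="C t"]) auto
  have Yc: "continuous_on {0..} (Y k)" for k
  proof (induction k)
    case (Suc k) then show ?case unfolding YS by (intro continuous_intros continuous_on_indefinite_integral int meas)
  qed (simp add: Y0)
  note Ym = meas[OF Yc]
  have diff: "norm (Y (Suc k) t - Y k t) \<le> C T * T * (1/2) ^ k * exp (2 * L T * t)" if "0 \<le> t" "t \<le> T" for k t T
    using that
  proof (induction k arbitrary: t)
    case 0
    then have CT: "0 \<le> C T" using bd[of 0 T x] norm_ge_zero[of "G 0 x"] by linarith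
    have "norm (Y (Suc 0) t - Y 0 t) \<le> C T * (t - 0)"
      unfolding YS Y0 add_diff_cancel_left'
      by (rule norm_set_integral_le[OF Ym[of 0, unfolded Y0]]) (use 0 bd in auto)
    also have "C T * (t - 0) \<le> C T * T * 1" using 0 CT by (simp add: mult_left_mono)
    also have "\<dots> \<le> C T * T * exp (2 * L T * t)"
      using 0 CT L[of T] by (intro mult_left_mono) auto
    finally show ?case by simp
  next
    case (Suc k)
    let ?D = "C T * T * (1/2) ^ k"
    have LT: "0 < L T" using L Suc.prems by simp
    have "Y (Suc (Suc k)) t - Y (Suc k) t = (LINT \<tau>:{0..t}|lebesgue. G \<tau> (Y (Suc k) \<tau>)) - (LINT \<tau>:{0..t}|lebesgue. G \<tau> (Y k \<tau>))"
      by (subst (1) YS, subst (2) YS) simp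
    also have "\<dots> = (LINT \<tau>:{0..t}|lebesgue. G \<tau> (Y (Suc k) \<tau>) - G \<tau> (Y k \<tau>))"
      by (intro set_integral_diff(2)[symmetric] int Ym)
    finally have "norm (Y (Suc (Suc k)) t - Y (Suc k) t) \<le> (LINT \<tau>:{0..t}|lebesgue. norm (G \<tau> (Y (Suc k) \<tau>) - G \<tau> (Y k \<tau>)))"
      using set_integral_norm_bound[OF set_integral_diff(1)[OF int[OF Ym] int[OF Ym]]] by simp
    also have "\<dots> \<le> (LINT \<tau>:{0..t}|lebesgue. L T * (?D * exp (2 * L T * \<tau>)))"
    proof (rule set_integral_mono)
      show "set_integrable lebesgue {0..t} (\<lambda>\<tau>. norm (G \<tau> (Y (Suc k) \<tau>) - G \<tau> (Y k \<tau>)))"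
        by (intro set_integrable_norm set_integral_diff(1) int Ym)
      show "set_integrable lebesgue {0..t} (\<lambda>\<tau>. L T * (?D * exp (2 * L T * \<tau>)))"
        using Suc.prems by (intro continuous_set_integrable continuous_intros) auto
      fix \<tau> assume \<tau>: "\<tau> \<in> {0..t}"
      then have "norm (G \<tau> (Y (Suc k) \<tau>) - G \<tau> (Y k \<tau>)) \<le> L T * norm (Y (Suc k) \<tau> - Y k \<tau>)" using Suc.prems by (intro lip) auto
      also have "\<dots> \<le> L T * (?D * exp (2 * L T * \<tau>))" using Suc \<tau> LT by (intro mult_left_mono) auto
      finally show "norm (G \<tau> (Y (Suc k) \<tau>) - G \<tau> (Y k \<tau>)) \<le> L T * (?D * exp (2 * L T * \<tau>))" .
    qed
    also have "\<dots> = integral {0..t} (\<lambda>\<tau>. L T * (?D * exp (2 * L T * \<tau>)))"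
      using Suc.prems by (intro set_lebesgue_integral_eq_integral(2) continuous_set_integrable continuous_intros) auto
    \<comment> \<open>A primitive of \<open>L exp (2 L \<tau>)\<close> is
      \<open>exp (2 L \<tau>) / 2\<close>; this is the source of the factor 1/2 per step.\<close>
    also have "\<dots> = ?D / 2 * exp (2 * L T * t) - ?D / 2 * exp (2 * L T * 0)"
      using Suc.prems(1) LT by (intro integral_unique fundamental_theorem_of_calculus)
        (auto simp flip: has_real_derivative_iff_has_vector_derivative intro!: derivative_eq_intros)
    also have "\<dots> \<le> C T * T * (1/2) ^ Suc k * exp (2 * L T * t)"
    proof -
      have "0 \<le> C T" using Suc.prems bd[of 0 T x] norm_ge_zero[of "G 0 x"] by linarith
      then have "0 \<le> ?D" using Suc.prems by simp
      then show ?thesis by simp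
    qed
    finally show ?case .
  qed
  have "convergent (\<lambda>k. Y k t)" if t: "0 \<le> t" for t
  proof -
    have "summable (\<lambda>k. Y (Suc k) t - Y k t)"
    proof (rule summable_comparison_test')
      show "summable (\<lambda>k. C t * t * (1/2) ^ k * exp (2 * L t * t))"
        by (intro summable_mult summable_mult2 summable_geometric) simp
      show "norm (Y (Suc k) t - Y k t) \<le> C t * t * (1/2) ^ k * exp (2 * L t * t)" for k using diff[OF t order_refl] .
    qed
    then have "(\<lambda>n. \<Sum>k<n. Y (Suc k) t - Y k t) \<longlonglongrightarrow> (\<Sum>k. Y (Suc k) t - Y k t)"
      by (rule summable_LIMSEQ)
    then have "(\<lambda>n. Y n t - Y 0 t) \<longlonglongrightarrow> (\<Sum>k. Y (Suc k) t - Y k t)"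
      unfolding sum_lessThan_telescope[of "\<lambda>k. Y k t"] .
    from tendsto_add[OF this tendsto_const[of "Y 0 t"]] show ?thesis by (auto simp: convergent_def)
  qed
  then obtain y where y: "\<And>t. 0 \<le> t \<Longrightarrow> (\<lambda>k. Y k t) \<longlonglongrightarrow> y t"
    unfolding convergent_def by metis
  have Gl: "(\<lambda>k. G \<tau> (Y k \<tau>)) \<longlonglongrightarrow> G \<tau> (y \<tau>)" if "0 \<le> \<tau>" for \<tau>
  proof (rule LIM_zero_cancel, rule Lim_null_comparison)
    show "(\<lambda>k. L \<tau> * norm (Y k \<tau> - y \<tau>)) \<longlonglongrightarrow> 0"
      using tendsto_mult_right_zero[OF tendsto_norm_zero[OF LIM_zero[OF y[OF that]]]] .
    show "\<forall>\<^sub>F k in sequentially. norm (G \<tau> (Y k \<tau>) - G \<tau> (y \<tau>)) \<le> L \<tau> * norm (Y k \<tau> - y \<tau>)"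
      using lip[OF that] by (intro always_eventually allI) auto
  qed
  have ym: "(\<lambda>\<tau>. G \<tau> (y \<tau>)) \<in> borel_measurable halfline"
    by (rule borel_measurable_LIMSEQ_metric[OF Ym Gl]) (auto simp: space_restrict_space)
  have eq: "y t = x + (LINT \<tau>:{0..t}|lebesgue. G \<tau> (y \<tau>))" if t: "0 \<le> t" for t
  proof -
    have "(\<lambda>k. LINT \<tau>:{0..t}|lebesgue. G \<tau> (Y k \<tau>)) \<longlonglongrightarrow> (LINT \<tau>:{0..t}|lebesgue. G \<tau> (y \<tau>))"
      by (rule set_integral_dominated_halfline[OF Ym ym, where C="C t"]) (use Gl bd in auto)
    then have "(\<lambda>k. Y (Suc k) t) \<longlonglongrightarrow> x + (LINT \<tau>:{0..t}|lebesgue. G \<tau> (y \<tau>))"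
      unfolding YS by (intro tendsto_intros)
    then show ?thesis using LIMSEQ_unique[OF LIMSEQ_Suc[OF y[OF t]]] by blast
  qed
  have "solution G x (restrict y {0..})"
    unfolding solution_def
  proof (intro conjI allI impI)
    fix t :: real assume t: "0 \<le> t"
    have "set_integrable lebesgue {0..t} (\<lambda>\<tau>. G \<tau> (y \<tau>))" by (rule int[OF ym])
    then show "set_integrable lebesgue {0..t} (\<lambda>\<tau>. G \<tau> (restrict y {0..} \<tau>))"
      unfolding set_integrable_def by (rule Bochner_Integration.integrable_cong[THEN iffD1, rotated 2]) (auto simp: indicator_def)
    have "(LINT \<tau>:{0..t}|lebesgue. G \<tau> (y \<tau>)) = (LINT \<tau>:{0..t}|lebesgue. G \<tau> (restrict y {0..} \<tau>))"
      by (intro set_lebesgue_integral_cong) auto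
    then show "restrict y {0..} t = x + (LINT \<tau>:{0..t}|lebesgue. G \<tau> (restrict y {0..} \<tau>))"
      using eq[OF t] t by simp
  qed simp
  then show ?thesis by (rule that)
qed

lemma solution_cong:
  assumes "\<And>\<tau>. 0 \<le> \<tau> \<Longrightarrow> g \<tau> (y \<tau>) = g' \<tau> (y \<tau>)"
  shows "solution g x y \<longleftrightarrow> solution g' x y"
proof -
  have "set_integrable lebesgue {0..t} (\<lambda>\<tau>. g \<tau> (y \<tau>)) \<longleftrightarrow> set_integrable lebesgue {0..t} (\<lambda>\<tau>. g' \<tau> (y \<tau>))" for t
    unfolding set_integrable_def by (rule Bochner_Integration.integrable_cong) (use assms in \<open>auto simp: indicator_def\<close>)
  moreover have "(LINT \<tau>:{0..t}|lebesgue. g \<tau> (y \<tau>)) = (LINT \<tau>:{0..t}|lebesgue. g' \<tau> (y \<tau>))" for t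
    using assms by (intro set_lebesgue_integral_cong) auto
  ultimately show ?thesis by (simp add: solution_def)
qed

text \<open>The state is truncated at the time-dependent radius \<open>R t\<close> that Gronwall's
  inequality predicts for a solution. The truncated field is Lipschitz and bounded on bounded time
  intervals and obeys the same growth bound, so its solution stays where the truncation is
  inactive.\<close>

lemma solution_exists:
  fixes g :: "real \<Rightarrow> 'b::euclidean_space \<Rightarrow> 'b"
  assumes meas: "\<And>y. continuous_on {0..} y \<Longrightarrow> (\<lambda>\<tau>. g \<tau> (y \<tau>)) \<in> borel_measurable halfline"
    and lip: "\<And>R \<tau> z1 z2. 0 < R \<Longrightarrow> 0 \<le> \<tau> \<Longrightarrow> norm z1 \<le> R \<Longrightarrow> norm z2 \<le> R \<Longrightarrow>
      norm (g \<tau> z1 - g \<tau> z2) \<le> Lip R * norm (z1 - z2)"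
    and Lip: "\<And>R. 0 < R \<Longrightarrow> 0 < Lip R"
    and growth: "\<And>\<tau> z. 0 \<le> \<tau> \<Longrightarrow> norm (g \<tau> z) \<le> B * (1 + norm z)" and B: "0 < B"
  obtains y where "solution g x y"
proof -
  define R where "R = (\<lambda>t. (1 + norm x) * exp (B * t))"
  have R0: "0 < R t" for t by (simp add: R_def add_pos_nonneg)
  have Rm: "R s \<le> R t" if "s \<le> t" for s t using that B by (auto simp: R_def intro!: mult_left_mono)
  define G where "G = (\<lambda>\<tau> z. g \<tau> (radial_trunc (R \<tau>) z))"
  \<comment> \<open>The 2 is the Lipschitz constant of \<open>radial_trunc\<close>, and
    \<open>B (1 + R T)\<close> is the growth bound on the largest ball up to time
    \<open>T\<close>.\<close>
  obtain y where y: "solution G x y"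
  proof (rule Picard_exists[of G "\<lambda>T. 2 * Lip (R T)" "\<lambda>T. B * (1 + R T)" x])
    fix y :: "real \<Rightarrow> 'b" assume y: "continuous_on {0..} y"
    have "continuous_on {0..} R" unfolding R_def by (intro continuous_intros)
    moreover have "max (R \<tau>) (norm (y \<tau>)) \<noteq> 0" for \<tau> using R0[of \<tau>] by (auto simp: max_def)
    ultimately have "continuous_on {0..} (\<lambda>\<tau>. radial_trunc (R \<tau>) (y \<tau>))"
      unfolding radial_trunc_def using y by (intro continuous_intros) auto
    then show "(\<lambda>\<tau>. G \<tau> (y \<tau>)) \<in> borel_measurable halfline" unfolding G_def by (rule meas)
  next
    fix T \<tau> :: real and z1 z2 :: 'b assume t: "0 \<le> \<tau>" "\<tau> \<le> T"
    have "norm (G \<tau> z1 - G \<tau> z2) \<le> Lip (R T) * norm (radial_trunc (R \<tau>) z1 - radial_trunc (R \<tau>) z2)"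
      unfolding G_def using t R0 by (intro lip) (auto intro: order_trans[OF radial_trunc(1) Rm])
    also have "\<dots> \<le> Lip (R T) * (2 * norm (z1 - z2))"
      using Lip[OF R0] R0 by (intro mult_left_mono radial_trunc(4)) (auto intro: less_imp_le)
    finally show "norm (G \<tau> z1 - G \<tau> z2) \<le> 2 * Lip (R T) * norm (z1 - z2)" by simp
  next
    fix T \<tau> :: real and z :: 'b assume t: "0 \<le> \<tau>" "\<tau> \<le> T"
    have "norm (G \<tau> z) \<le> B * (1 + norm (radial_trunc (R \<tau>) z))" unfolding G_def by (rule growth[OF t(1)])
    also have "\<dots> \<le> B * (1 + R T)" using B order_trans[OF radial_trunc(1)[OF R0] Rm[OF t(2)], of z] by simp
    finally show "norm (G \<tau> z) \<le> B * (1 + R T)" .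
  qed (use Lip R0 in auto)
  have "norm (y t) \<le> R t" if "0 \<le> t" for t
  proof -
    have "1 + norm (y t) \<le> (1 + norm x) * exp (B * t)"
    proof (rule solution_bound[OF y that])
      fix \<tau> :: real and z :: 'b assume "0 \<le> \<tau>"
      then have "norm (G \<tau> z) \<le> B * (1 + norm (radial_trunc (R \<tau>) z))" unfolding G_def by (rule growth)
      also have "\<dots> \<le> B * (1 + norm z)" using B radial_trunc(2)[OF R0, of \<tau> z] by simp
      finally show "norm (G \<tau> z) \<le> B * (1 + norm z)" .
    qed (use B in auto)
    then show ?thesis by (simp add: R_def)
  qed
  then have "solution g x y"
    using y by (subst solution_cong[of _ _ G]) (auto simp: G_def radial_trunc(3)[OF R0])
  then show ?thesis by (rule that)
qed

lemma trajectory_eqI: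
  assumes "solution (\<lambda>\<tau> z. F z (u \<tau>)) x y"
    and "\<And>y'. solution (\<lambda>\<tau> z. F z (u \<tau>)) x y' \<Longrightarrow> y' = y"
  shows "trajectory F x u = y"
  unfolding trajectory_def using assms by (rule the_equality)

section \<open>Stability under Young convergence\<close>

text \<open>Integrand and measure both depend on \<open>s\<close>. Pushing \<open>m s\<close>
  forward by \<open>\<Phi> (y s)\<close> gives a measurable family of laws on the target space,
  whose mean is the relaxed value.\<close>

lemma measurable_relax:
  fixes \<Phi> :: "'b::euclidean_space \<Rightarrow> 'a::euclidean_space \<Rightarrow> 'c::euclidean_space"
  assumes \<Phi>: "continuous_on (UNIV \<times> K) (\<lambda>(x, a). \<Phi> x a)"
    and y: "continuous_on {0..} y" and m: "m \<in> kernels K"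
  shows "(\<lambda>s. relax \<Phi> (y s) (m s)) \<in> borel_measurable halfline"
proof -
  have m': "m \<in> halfline \<rightarrow>\<^sub>M subprob_algebra (restrict_space borel K)"
    using m unfolding kernels_def by (rule measurable_prob_algebraD)
  have ym: "y \<in> borel_measurable halfline"
    using y by (intro continuous_imp_measurable_on_sets_lebesgue) auto
  have "(\<lambda>(s, a). (y s, a)) \<in> halfline \<Otimes>\<^sub>M restrict_space borel K \<rightarrow>\<^sub>M restrict_space borel (UNIV \<times> K)"
  proof (rule measurable_restrict_space2)
    show "(\<lambda>(s, a). (y s, a)) \<in> space (halfline \<Otimes>\<^sub>M restrict_space borel K) \<rightarrow> UNIV \<times> K"
      by (auto simp: space_pair_measure space_restrict_space)
    have [measurable]: "(\<lambda>x. x) \<in> restrict_space borel K \<rightarrow>\<^sub>M borel" by (simp add: measurable_restrict_space1)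
    note ym[measurable]
    have "(\<lambda>(s, a). (y s, a)) \<in> halfline \<Otimes>\<^sub>M restrict_space borel K \<rightarrow>\<^sub>M borel \<Otimes>\<^sub>M borel"
      by measurable
    then show "(\<lambda>(s, a). (y s, a)) \<in> halfline \<Otimes>\<^sub>M restrict_space borel K \<rightarrow>\<^sub>M borel" by (simp add: borel_prod)
  qed
  from measurable_compose[OF this borel_measurable_continuous_on_restrict[OF \<Phi>]]
  have c: "(\<lambda>(s, a). \<Phi> (y s) a) \<in> borel_measurable (halfline \<Otimes>\<^sub>M restrict_space borel K)"
    by (simp add: case_prod_unfold)
  have "(\<lambda>s. LINT z|distr (m s) borel (\<Phi> (y s)). z) \<in> borel_measurable halfline"
    by (rule measurable_compose[OF measurable_distr2[OF _ m'] integral_measurable_subprob_algebra]) (use c in auto)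
  also have "?this \<longleftrightarrow> (\<lambda>s. relax \<Phi> (y s) (m s)) \<in> borel_measurable halfline"
  proof (rule measurable_cong)
    fix s assume s: "s \<in> space halfline"
    then have "\<Phi> (y s) \<in> borel_measurable (restrict_space borel K)"
      using measurable_Pair2[OF c s] by simp
    then have "\<Phi> (y s) \<in> borel_measurable (m s)"
      using s by (intro borel_measurable_kernel[OF m]) (auto simp: space_restrict_space)
    then show "(LINT z|distr (m s) borel (\<Phi> (y s)). z) = relax \<Phi> (y s) (m s)"
      unfolding relax_def by (intro integral_distr) auto
  qed
  finally show ?thesis .
qed

lemma relax_bound:
  fixes \<Phi> :: "'b \<Rightarrow> 'a::euclidean_space \<Rightarrow> 'c::euclidean_space"
  assumes m: "m \<in> kernels K" "0 \<le> s" and c: "continuous_on K (\<Phi> z)" and bd: "\<And>a. a \<in> K \<Longrightarrow> norm (\<Phi> z a) \<le> C"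
  shows "norm (relax \<Phi> z (m s)) \<le> C"
  unfolding relax_def using kernelsD[OF m] bd
  by (intro prob_space.norm_integral_le_const(2) borel_measurable_kernel[OF m] borel_measurable_continuous_on_restrict c) auto

lemma integrable_kernel:
  fixes \<phi> :: "'a::euclidean_space \<Rightarrow> 'c::euclidean_space"
  assumes K: "compact K" and m: "m \<in> kernels K" "0 \<le> s" and c: "continuous_on K \<phi>"
  shows "integrable (m s) \<phi>"
proof -
  obtain C where "\<And>a. a \<in> K \<Longrightarrow> norm (\<phi> a) \<le> C" using compact_bounded_fun[OF K c] by blast
  then show ?thesis
    using kernelsD[OF m] 
    by (intro prob_space.norm_integral_le_const(1)[where C=C] borel_measurable_kernel[OF m] borel_measurable_continuous_on_restrict c) auto
qed

lemma relax_diff_bound: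
  fixes \<Phi> :: "'b \<Rightarrow> 'a::euclidean_space \<Rightarrow> 'c::euclidean_space"
  assumes K: "compact K" and m: "m \<in> kernels K" "0 \<le> s" and c: "continuous_on K (\<Phi> z)" "continuous_on K (\<Phi> z')"
    and bd: "\<And>a. a \<in> K \<Longrightarrow> norm (\<Phi> z a - \<Phi> z' a) \<le> C"
  shows "norm (relax \<Phi> z (m s) - relax \<Phi> z' (m s)) \<le> C"
proof -
  have "relax \<Phi> z (m s) - relax \<Phi> z' (m s) = (LINT a|m s. \<Phi> z a - \<Phi> z' a)"
    unfolding relax_def by (intro Bochner_Integration.integral_diff[symmetric] integrable_kernel[OF K m] c)
  also have "norm \<dots> \<le> C"
    using kernelsD[OF m] bd c
    by (intro prob_space.norm_integral_le_const(2) borel_measurable_kernel[OF m] borel_measurable_continuous_on_restrict continuous_on_diff) auto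
  finally show ?thesis .
qed

lemma young_conv_vector:
  fixes \<phi> :: "'a::euclidean_space \<Rightarrow> 'c::euclidean_space"
  assumes K: "compact K" and ms: "\<And>k. ms k \<in> kernels K" and m: "m \<in> kernels K"
    and Y: "young_conv K ms m" and \<phi>: "continuous_on K \<phi>" and t: "0 \<le> t"
  shows "(\<lambda>k. LINT s:{0..t}|lebesgue. LINT a|ms k s. \<phi> a) \<longlonglongrightarrow> (LINT s:{0..t}|lebesgue. LINT a|m s. \<phi> a)"
proof (subst tendsto_componentwise_iff, intro ballI)
  fix b :: 'c assume b: "b \<in> Basis"
  obtain C where C: "\<And>a. a \<in> K \<Longrightarrow> norm (\<phi> a) \<le> C" using compact_bounded_fun[OF K \<phi>] by blast
  have cb: "continuous_on K (\<lambda>a. \<phi> a \<bullet> b)" by (intro continuous_intros \<phi>)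
  have eq: "(LINT s:{0..t}|lebesgue. LINT a|n s. \<phi> a) \<bullet> b = (LINT s:{0..t}|lebesgue. LINT a|n s. \<phi> a \<bullet> b)"
    if n: "n \<in> kernels K" for n
  proof -
    have "set_integrable lebesgue {0..t} (\<lambda>s. LINT a|n s. \<phi> a)"
      using relax_bound[OF n, of _ "\<lambda>_. \<phi>", OF _ \<phi> C] 
        measurable_kernel_integral[OF n[unfolded kernels_def] borel_measurable_continuous_on_restrict[OF \<phi>]] unfolding relax_def
      by (intro set_integrable_halfline_Icc[where C=C]) auto
    then have "(LINT s:{0..t}|lebesgue. LINT a|n s. \<phi> a) \<bullet> b = (LINT s:{0..t}|lebesgue. (LINT a|n s. \<phi> a) \<bullet> b)"
      unfolding set_integrable_def set_lebesgue_integral_def by (subst integral_inner_left[symmetric]) auto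
    also have "\<dots> = (LINT s:{0..t}|lebesgue. LINT a|n s. \<phi> a \<bullet> b)"
      using integrable_kernel[OF K n _ \<phi>] by (intro set_lebesgue_integral_cong) auto
    finally show ?thesis .
  qed
  show "(\<lambda>k. (LINT s:{0..t}|lebesgue. LINT a|ms k s. \<phi> a) \<bullet> b) \<longlonglongrightarrow> (LINT s:{0..t}|lebesgue. LINT a|m s. \<phi> a) \<bullet> b"
    unfolding eq[OF ms] eq[OF m] using Y cb t by (simp add: young_conv_def)
qed

lemma young_conv_interval:
  fixes \<phi> :: "'a::euclidean_space \<Rightarrow> 'c::euclidean_space"
  assumes K: "compact K" and ms: "\<And>k. ms k \<in> kernels K" and m: "m \<in> kernels K"
    and Y: "young_conv K ms m" and \<phi>: "continuous_on K \<phi>" and t: "0 \<le> s" "s \<le> t"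
  shows "(\<lambda>k. LINT s:{s..t}|lebesgue. LINT a|ms k s. \<phi> a) \<longlonglongrightarrow> (LINT s:{s..t}|lebesgue. LINT a|m s. \<phi> a)"
proof -
  obtain C where C: "\<And>a. a \<in> K \<Longrightarrow> norm (\<phi> a) \<le> C" using compact_bounded_fun[OF K \<phi>] by blast
  have "(LINT s:{s..t}|lebesgue. LINT a|n s. \<phi> a) = (LINT s:{0..t}|lebesgue. LINT a|n s. \<phi> a) - (LINT s:{0..s}|lebesgue. LINT a|n s. \<phi> a)"
    if n: "n \<in> kernels K" for n
  proof -
    have "set_integrable lebesgue {0..t} (\<lambda>s. LINT a|n s. \<phi> a)"
      using relax_bound[OF n, of _ "\<lambda>_. \<phi>", OF _ \<phi> C] 
        measurable_kernel_integral[OF n[unfolded kernels_def] borel_measurable_continuous_on_restrict[OF \<phi>]] unfolding relax_def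
      by (intro set_integrable_halfline_Icc[where C=C]) auto
    from set_integral_Icc_combine[OF this t] show ?thesis by simp
  qed
  then show ?thesis using ms m
    by (auto intro!: tendsto_diff young_conv_vector[OF K ms m Y \<phi>] t order_trans[OF t])
qed

lemma set_integral_partition:
  fixes h :: "real \<Rightarrow> 'c::euclidean_space"
  assumes "0 \<le> d" "set_integrable lebesgue {0..real n * d} h"
  shows "(LINT s:{0..real n * d}|lebesgue. h s) = (\<Sum>i<n. LINT s:{real i * d..real (Suc i) * d}|lebesgue. h s)"
  using assms(2)
proof (induction n)
  case 0
  have "(LINT s:{0..0}|lebesgue. h s) = 0"
    unfolding set_lebesgue_integral_def
    by (intro integral_eq_zero_AE AE_I'[of "{0}"]) (auto simp: indicator_def)
  then show ?case by simp
next
  case (Suc n)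
  have le: "0 \<le> real n * d" "real n * d \<le> real (Suc n) * d" using assms(1) by (auto simp: mult_right_mono)
  have "set_integrable lebesgue {0..real n * d} h"
    by (rule set_integrable_subset[OF Suc.prems]) (use le in auto)
  then show ?case using Suc.IH set_integral_Icc_combine[OF Suc.prems le] by simp
qed

text \<open>Uniform continuity on \<open>[0,t] \<times> K\<close> allows freezing the time argument
  on a fine partition; the resulting finite sum converges interval by interval. Measurability in
  time is a hypothesis because \<open>\<phi>\<close> is controlled only on
  \<open>[0,t]\<close>.\<close>

lemma young_conv_time:
  fixes \<phi> :: "real \<Rightarrow> 'a::euclidean_space \<Rightarrow> 'c::euclidean_space"
  assumes K: "compact K" and ms: "\<And>k. ms k \<in> kernels K" and m: "m \<in> kernels K"
    and Y: "young_conv K ms m" and \<phi>: "continuous_on ({0..t} \<times> K) (\<lambda>(s, a). \<phi> s a)" and t: "0 \<le> t"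
    and meas: "\<And>n. n \<in> kernels K \<Longrightarrow> (\<lambda>s. LINT a|n s. \<phi> s a) \<in> borel_measurable halfline"
  shows "(\<lambda>k. LINT s:{0..t}|lebesgue. LINT a|ms k s. \<phi> s a) \<longlonglongrightarrow> (LINT s:{0..t}|lebesgue. LINT a|m s. \<phi> s a)"
proof (rule metric_LIMSEQ_I)
  fix e :: real assume e: "0 < e"
  define e' where "e' = e / (4 * (t + 1))"
  have e': "0 < e'" "e' * t < e / 3" using e t mult_nonneg_nonneg[of e t] by (auto simp: e'_def field_simps add_nonneg_pos)
  have cpt: "compact ({0..t} \<times> K)" using K by (intro compact_Times) auto
  obtain d where d: "0 < d" "\<And>s s' a. s \<in> {0..t} \<Longrightarrow> s' \<in> {0..t} \<Longrightarrow> a \<in> K \<Longrightarrow> \<bar>s - s'\<bar> < d \<Longrightarrow> norm (\<phi> s a - \<phi> s' a) < e'"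
  proof -
    obtain d where d: "0 < d" "\<And>p p'. p \<in> {0..t} \<times> K \<Longrightarrow> p' \<in> {0..t} \<times> K \<Longrightarrow> dist p' p < d \<Longrightarrow> dist (case p' of (s, a) \<Rightarrow> \<phi> s a) (case p of (s, a) \<Rightarrow> \<phi> s a) < e'"
      using compact_uniformly_continuous[OF \<phi> cpt] e'(1) unfolding uniformly_continuous_on_def by metis
    show ?thesis
    proof (rule that[OF d(1)])
      fix s s' a assume "s \<in> {0..t}" "s' \<in> {0..t}" "a \<in> K" "\<bar>s - s'\<bar> < d"
      then show "norm (\<phi> s a - \<phi> s' a) < e'"
        using d(2)[of "(s', a)" "(s, a)"] by (simp add: dist_Pair_Pair dist_norm)
    qed
  qed
  obtain N where N: "t / real (Suc N) < d" 
  proof -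
    obtain N where "t < real N * d" using reals_Archimedean3[OF d(1)] by blast
    also have "\<dots> \<le> real (Suc N) * d" using d(1) by (intro mult_right_mono) auto
    finally show ?thesis by (intro that[of N]) (simp add: field_simps)
  qed
  define n where "n = Suc N"
  define w where "w = t / real n"
  have w: "0 \<le> w" "w < d" "real n * w = t" using t N by (auto simp: w_def n_def)
  have iw: "0 \<le> real i * w" "real i * w \<le> real (Suc i) * w" "real (Suc i) * w \<le> t" if "i < n" for i
  proof -
    have "real (Suc i) * w \<le> real n * w" using that w by (intro mult_right_mono) auto
    then show "real (Suc i) * w \<le> t" using w by simp
  qed (use w in \<open>auto simp: mult_right_mono\<close>)
  obtain C where C: "\<And>p. p \<in> {0..t} \<times> K \<Longrightarrow> norm (case p of (s, a) \<Rightarrow> \<phi> s a) \<le> C" using compact_bounded_fun[OF cpt \<phi>] by blast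
  have ct: "continuous_on K (\<phi> s)" if "s \<in> {0..t}" for s
  proof -
    have "continuous_on K (\<lambda>a. (s, a))" by (intro continuous_intros)
    moreover have "(\<lambda>a. (s, a)) ` K \<subseteq> {0..t} \<times> K" using that by blast
    ultimately show ?thesis using continuous_on_compose2[OF \<phi>] by force
  qed
  define A where "A = (\<lambda>n'. \<Sum>i<n. LINT s:{real i * w..real (Suc i) * w}|lebesgue. LINT a|n' s. \<phi> (real i * w) a)"
  have approx: "norm ((LINT s:{0..t}|lebesgue. LINT a|n' s. \<phi> s a) - A n') \<le> e' * t" if n': "n' \<in> kernels K" for n'
  proof -
    have bd: "norm (LINT a|n' s. \<phi> s' a) \<le> C" if "0 \<le> s" "s' \<in> {0..t}" for s s'
    proof -
      have "norm (\<phi> s' a) \<le> C" if "a \<in> K" for a using C[of "(s', a)"] \<open>s' \<in> {0..t}\<close> that by simp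
      from relax_bound[where \<Phi>=\<phi> and z=s', OF n' that(1) ct[OF that(2)] this]
      show ?thesis by (simp add: relax_def)
    qed
    have i1: "set_integrable lebesgue {0..real n * w} (\<lambda>s. LINT a|n' s. \<phi> s a)"
      using bd w(3) by (intro set_integrable_halfline_Icc[where C=C] meas n') auto
    have mi: "(\<lambda>s. LINT a|n' s. \<phi> (real i * w) a) \<in> borel_measurable halfline" if "i < n" for i
      using iw[OF that] by (intro measurable_kernel_integral[OF n'[unfolded kernels_def]] borel_measurable_continuous_on_restrict ct) auto
    have "(LINT s:{0..t}|lebesgue. LINT a|n' s. \<phi> s a) - A n' =
      (\<Sum>i<n. (LINT s:{real i * w..real (Suc i) * w}|lebesgue. LINT a|n' s. \<phi> s a) - (LINT s:{real i * w..real (Suc i) * w}|lebesgue. LINT a|n' s. \<phi> (real i * w) a))"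
      using set_integral_partition[OF w(1) i1] unfolding A_def w(3) by (simp add: sum_subtractf)
    also have "\<dots> = (\<Sum>i<n. LINT s:{real i * w..real (Suc i) * w}|lebesgue. (LINT a|n' s. \<phi> s a) - (LINT a|n' s. \<phi> (real i * w) a))"
    proof (intro sum.cong refl set_integral_diff(2)[symmetric])
      fix i assume "i \<in> {..<n}"
      then have i: "i < n" by simp
      show "set_integrable lebesgue {real i * w..real (Suc i) * w} (\<lambda>s. LINT a|n' s. \<phi> s a)"
        by (rule set_integrable_subset[OF i1]) (use iw[OF i] w(3) in auto)
      show "set_integrable lebesgue {real i * w..real (Suc i) * w} (\<lambda>s. LINT a|n' s. \<phi> (real i * w) a)"
        using iw[OF i] bd by (intro set_integrable_halfline_Icc[where C=C] mi[OF i]) auto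
    qed
    also have "norm \<dots> \<le> (\<Sum>i<n. e' * (real (Suc i) * w - real i * w))"
    proof (intro order_trans[OF norm_sum] sum_mono norm_set_integral_le)
      fix i assume "i \<in> {..<n}"
      then have i: "i < n" by simp
      show "(\<lambda>s. (LINT a|n' s. \<phi> s a) - (LINT a|n' s. \<phi> (real i * w) a)) \<in> borel_measurable halfline"
        by (intro borel_measurable_diff meas mi n' i)
      show "0 \<le> real i * w" "real i * w \<le> real (Suc i) * w" using iw[OF i] by auto
      fix s assume s: "s \<in> {real i * w..real (Suc i) * w}"
      then have st: "s \<in> {0..t}" "real i * w \<in> {0..t}" "0 \<le> s" using iw[OF i] by auto
      have "\<bar>s - real i * w\<bar> < d" using s w by (auto simp: algebra_simps)
      then show "norm ((LINT a|n' s. \<phi> s a) - (LINT a|n' s. \<phi> (real i * w) a)) \<le> e'"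
        using relax_diff_bound[where \<Phi>=\<phi> and z=s and z'="real i * w", OF K n' st(3) ct[OF st(1)] ct[OF st(2)], of e'] d(2)[OF st(1,2)]
        by (auto simp: relax_def less_imp_le)
    qed
    also have "\<dots> = e' * t" using w(3) by (simp add: algebra_simps)
    finally show ?thesis .
  qed
  have "(\<lambda>k. A (ms k)) \<longlonglongrightarrow> A m"
    unfolding A_def using iw by (intro tendsto_sum young_conv_interval[OF K ms m Y] ct) (auto intro: order_trans)
  then obtain k0 where k0: "\<And>k. k \<ge> k0 \<Longrightarrow> norm (A (ms k) - A m) < e / 3"
    using e by (metis LIMSEQ_D divide_pos_pos zero_less_numeral)
  have "dist (LINT s:{0..t}|lebesgue. LINT a|ms k s. \<phi> s a) (LINT s:{0..t}|lebesgue. LINT a|m s. \<phi> s a) < e" if "k \<ge> k0" for k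
  proof -
    let ?X = "LINT s:{0..t}|lebesgue. LINT a|ms k s. \<phi> s a" and ?Z = "LINT s:{0..t}|lebesgue. LINT a|m s. \<phi> s a"
    have eq: "?X - ?Z = (?X - A (ms k)) + (A (ms k) - A m) - (?Z - A m)" by simp
    have "norm (?X - ?Z) \<le> norm (?X - A (ms k)) + norm (A (ms k) - A m) + norm (?Z - A m)"
      unfolding eq using norm_triangle_ineq[of "?X - A (ms k)" "A (ms k) - A m"]
        norm_triangle_ineq4[of "(?X - A (ms k)) + (A (ms k) - A m)" "?Z - A m"] by linarith
    then show ?thesis unfolding dist_norm using approx[OF ms, of k] approx[OF m] k0[OF that] e'(2) by linarith
  qed
  then show "\<exists>no. \<forall>k\<ge>no. dist (LINT s:{0..t}|lebesgue. LINT a|ms k s. \<phi> s a) (LINT s:{0..t}|lebesgue. LINT a|m s. \<phi> s a) < e"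
    by blast
qed

section \<open>The control problem with a compact set of control values\<close>

locale compact_problem =
  fixes K :: "'a::euclidean_space set" and F :: "'b::euclidean_space \<Rightarrow> 'a \<Rightarrow> 'b" and L :: "'b \<Rightarrow> 'a \<Rightarrow> real"
    and B :: real and Lip :: "real \<Rightarrow> real"
  assumes K: "compact K" "K \<noteq> {}"
    and F_cont: "continuous_on (UNIV \<times> K) (\<lambda>(x, a). F x a)"
    and L_cont: "continuous_on (UNIV \<times> K) (\<lambda>(x, a). L x a)"
    and Lip_pos: "\<And>R. 0 < R \<Longrightarrow> 0 < Lip R"
    and F_lip: "\<And>R a x1 x2. 0 < R \<Longrightarrow> a \<in> K \<Longrightarrow> norm x1 \<le> R \<Longrightarrow> norm x2 \<le> R \<Longrightarrow>
      norm (F x1 a - F x2 a) \<le> Lip R * norm (x1 - x2)"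
    and F_growth: "\<And>x a. a \<in> K \<Longrightarrow> norm (F x a) \<le> B * (1 + norm x)"
    and B: "0 < B"
    and L_nonneg: "\<And>x a. a \<in> K \<Longrightarrow> 0 \<le> L x a"
begin

abbreviation "traj x m \<equiv> trajectory (relax F) x m"

text \<open>A real Bochner integral, so that limits can be taken by dominated convergence;
  \<open>cost_eq_J\<close> links it with the extended-valued cost.\<close>

definition "J x m t = (LINT s:{0..t}|lebesgue. relax L (traj x m s) (m s))"

lemma section_cont:
  assumes "continuous_on (UNIV \<times> K) (\<lambda>(x, a). \<Phi> x a)"
  shows "continuous_on K (\<Phi> x)"
proof -
  have "continuous_on K (\<lambda>a. (x, a))" by (intro continuous_intros)
  from continuous_on_compose2[OF assms this] show ?thesis by auto
qed

lemmas F_sec = section_cont[OF F_cont] and L_sec = section_cont[OF L_cont]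

lemma relax_F_growth: "m \<in> kernels K \<Longrightarrow> 0 \<le> s \<Longrightarrow> norm (relax F z (m s)) \<le> B * (1 + norm z)"
  using relax_bound[where \<Phi>=F and z=z, OF _ _ F_sec F_growth] by blast

lemma relax_F_lip:
  "m \<in> kernels K \<Longrightarrow> 0 \<le> s \<Longrightarrow> 0 < R \<Longrightarrow> norm z1 \<le> R \<Longrightarrow> norm z2 \<le> R \<Longrightarrow>
    norm (relax F z1 (m s) - relax F z2 (m s)) \<le> Lip R * norm (z1 - z2)"
  using relax_diff_bound[where \<Phi>=F and z=z1 and z'=z2, OF K(1) _ _ F_sec F_sec F_lip] by blast

lemma traj_unique:
  assumes m: "m \<in> kernels K" and y: "solution (\<lambda>s z. relax F z (m s)) x y"
  shows "y = traj x m"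
proof -
  have "y' = y" if "solution (\<lambda>s z. relax F z (m s)) x y'" for y'
    using that y
  proof (rule solution_unique[where Lip=Lip])
    show "norm (relax F z1 (m \<tau>) - relax F z2 (m \<tau>)) \<le> Lip R * norm (z1 - z2)"
      if "0 < R" "0 \<le> \<tau>" "norm z1 \<le> R" "norm z2 \<le> R" for R \<tau> z1 z2
      using relax_F_lip[OF m] that by blast
    show "0 \<le> Lip R" if "0 < R" for R using Lip_pos[OF that] by simp
  qed
  then show ?thesis using trajectory_eqI[of "relax F" m x y] y by metis
qed

lemma traj_solution:
  assumes m: "m \<in> kernels K"
  shows "solution (\<lambda>s z. relax F z (m s)) x (traj x m)"
proof -
  obtain y where "solution (\<lambda>s z. relax F z (m s)) x y"
    by (rule solution_exists[of "\<lambda>s z. relax F z (m s)" Lip B x])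
      (use measurable_relax[OF F_cont _ m] relax_F_lip[OF m] Lip_pos relax_F_growth[OF m] B in auto)
  then show ?thesis using traj_unique[OF m] by metis
qed

lemma traj_cont: "m \<in> kernels K \<Longrightarrow> continuous_on {0..} (traj x m)"
  by (rule solution_continuous[OF traj_solution])

lemma traj_bound:
  assumes "m \<in> kernels K" "0 \<le> t"
  shows "norm (traj x m t) \<le> (1 + norm x) * exp (B * t)"
proof -
  have "1 + norm (traj x m t) \<le> (1 + norm x) * exp (B * t)"
    by (rule solution_bound[OF traj_solution[OF assms(1)] assms(2)]) (use B relax_F_growth[OF assms(1)] in auto)
  then show ?thesis by simp
qed

lemma compact_cball_K: "compact (cball (0::'b) R \<times> K)"
  using K by (intro compact_Times) auto

lemma fun_bound:
  fixes \<Phi> :: "'b \<Rightarrow> 'a \<Rightarrow> 'c::euclidean_space"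
  assumes "continuous_on (UNIV \<times> K) (\<lambda>(x, a). \<Phi> x a)"
  obtains C where "0 < C" "\<And>x a. norm x \<le> R \<Longrightarrow> a \<in> K \<Longrightarrow> norm (\<Phi> x a) \<le> C"
proof -
  have "continuous_on (cball (0::'b) R \<times> K) (\<lambda>(x, a). \<Phi> x a)" by (rule continuous_on_subset[OF assms]) auto
  from compact_bounded_fun[OF compact_cball_K this] obtain C where
    C: "0 < C" "\<And>p. p \<in> cball (0::'b) R \<times> K \<Longrightarrow> norm (case p of (x, a) \<Rightarrow> \<Phi> x a) \<le> C" by blast
  show ?thesis
  proof (rule that[of C])
    fix x :: 'b and a assume "norm x \<le> R" "a \<in> K"
    then show "norm (\<Phi> x a) \<le> C" using C(2)[of "(x, a)"] by simp
  qed fact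
qed

lemma young_conv_relax:
  fixes \<Phi> :: "'b \<Rightarrow> 'a \<Rightarrow> 'c::euclidean_space"
  assumes \<Phi>: "continuous_on (UNIV \<times> K) (\<lambda>(x, a). \<Phi> x a)" and ms: "\<And>k. ms k \<in> kernels K" and m: "m \<in> kernels K"
    and Y: "young_conv K ms m" and y: "continuous_on {0..} y" and t: "0 \<le> t"
  shows "(\<lambda>k. LINT s:{0..t}|lebesgue. relax \<Phi> (y s) (ms k s)) \<longlonglongrightarrow> (LINT s:{0..t}|lebesgue. relax \<Phi> (y s) (m s))"
  unfolding relax_def
proof (rule young_conv_time[OF K(1) ms m Y _ t, of "\<lambda>s. \<Phi> (y s)"])
  have "continuous_on ({0..t} \<times> K) (\<lambda>p. (y (fst p), snd p))"
    by (intro continuous_intros continuous_on_compose2[OF y]) auto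
  moreover have "(\<lambda>p. (y (fst p), snd p)) ` ({0..t} \<times> K) \<subseteq> UNIV \<times> K" by auto
  ultimately show "continuous_on ({0..t} \<times> K) (\<lambda>(s, a). \<Phi> (y s) a)"
    using continuous_on_compose2[OF \<Phi>, of "{0..t} \<times> K" "\<lambda>p. (y (fst p), snd p)"]
    by (simp add: case_prod_unfold)
  show "(\<lambda>s. LINT a|n s. \<Phi> (y s) a) \<in> borel_measurable halfline" if "n \<in> kernels K" for n
    using measurable_relax[OF \<Phi> y that] unfolding relax_def .
qed

lemma trajectories_bounded:
  assumes ms: "\<And>k. ms k \<in> kernels K" and m: "m \<in> kernels K" and xs: "xs \<longlonglongrightarrow> x"
  obtains R where "0 < R" "\<And>k. norm (xs k) \<le> R" "norm x \<le> R"
    "\<And>k t. t \<in> {0..T} \<Longrightarrow> norm (traj (xs k) (ms k) t) \<le> R" "\<And>t. t \<in> {0..T} \<Longrightarrow> norm (traj x m t) \<le> R"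
proof -
  obtain X where X: "\<And>k. norm (xs k) \<le> X" "norm x \<le> X"
  proof -
    obtain X1 where X1: "\<And>k. norm (xs k) \<le> X1" 
      using convergent_imp_Bseq[of xs] xs by (metis BseqE convergentI)
    show ?thesis by (rule that[of "max X1 (norm x)"]) (auto simp: X1 le_max_iff_disj)
  qed
  have X0: "0 \<le> X" using X(2) norm_ge_zero order_trans by blast
  define R where "R = (1 + X) * exp (B * \<bar>T\<bar>)"
  have "(1 + X) * 1 \<le> R" unfolding R_def using X0 B by (intro mult_left_mono) auto
  then have XR: "1 + X \<le> R" by simp
  have yR: "norm (traj z n t) \<le> R" if "norm z \<le> X" "n \<in> kernels K" "t \<in> {0..T}" for z n t
  proof -
    have "norm (traj z n t) \<le> (1 + norm z) * exp (B * t)" using that by (intro traj_bound) auto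
    also have "\<dots> \<le> R" unfolding R_def using that X0 B by (intro mult_mono) auto
    finally show ?thesis .
  qed
  show ?thesis
  proof (rule that)
    show "0 < R" using XR X0 by linarith
    show "norm (xs k) \<le> R" for k using X(1)[of k] XR by linarith
    show "norm x \<le> R" using X(2) XR by linarith
  qed (use yR X ms m in auto)
qed

text \<open>The controls \<open>ms k\<close> and \<open>m\<close> are compared along the limit
  trajectory, which makes the error \<open>E k t\<close> vanish for each fixed \<open>t\<close>.
  This is not uniform in \<open>t\<close>, so Gronwall's inequality is applied to the time integral
  of the deviation, whose error term \<open>cT k\<close> tends to 0 by dominated convergence. The
  deviation at \<open>T\<close> is then recovered from \<open>key\<close>.\<close>

theorem stability:
  assumes ms: "\<And>k. ms k \<in> kernels K" and m: "m \<in> kernels K" and Y: "young_conv K ms m"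
    and xs: "xs \<longlonglongrightarrow> x" and T: "0 \<le> T"
  shows "(\<lambda>k. traj (xs k) (ms k) T) \<longlonglongrightarrow> traj x m T"
proof -
  obtain R where R: "0 < R" and xR: "\<And>k. norm (xs k) \<le> R" "norm x \<le> R"
    and yR: "\<And>k t. t \<in> {0..T} \<Longrightarrow> norm (traj (xs k) (ms k) t) \<le> R" "\<And>t. t \<in> {0..T} \<Longrightarrow> norm (traj x m t) \<le> R"
    using trajectories_bounded[of ms m xs x T, OF ms m xs] by blast
  define y where "y = traj x m"
  define yk where "yk = (\<lambda>k. traj (xs k) (ms k))"
  have yc: "continuous_on {0..} y" "\<And>k. continuous_on {0..} (yk k)" using traj_cont m ms by (auto simp: y_def yk_def)
  have yb: "norm (y t) \<le> R" "norm (yk k t) \<le> R" if "t \<in> {0..T}" for k t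
    using yR that by (auto simp: y_def yk_def)
  let ?I = "\<lambda>t h. LINT s:{0..t}|lebesgue. (h s :: 'b)"
  define E where "E = (\<lambda>k t. ?I t (\<lambda>s. relax F (y s) (ms k s)) - ?I t (\<lambda>s. relax F (y s) (m s)))"
  have meas: "(\<lambda>s. relax F (z s) (n s)) \<in> borel_measurable halfline" if "continuous_on {0..} z" "n \<in> kernels K" for z n
    using measurable_relax[OF F_cont that] .
  have int: "set_integrable lebesgue {0..t} (\<lambda>s. relax F (z s) (n s))" if "continuous_on {0..} z" "n \<in> kernels K" "t \<le> T"
    "\<And>s. s \<in> {0..T} \<Longrightarrow> norm (z s) \<le> R" for z n t
  proof (rule set_integrable_halfline_Icc[OF meas[OF that(1,2)], where C="B * (1 + R)"])
    fix s assume s: "s \<in> {0..t}"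
    have "norm (relax F (z s) (n s)) \<le> B * (1 + norm (z s))" using s that by (intro relax_F_growth) auto
    also have "\<dots> \<le> B * (1 + R)" using s that B by (intro mult_left_mono) auto
    finally show "norm (relax F (z s) (n s)) \<le> B * (1 + R)" .
  qed auto
  have E0: "(\<lambda>k. E k t) \<longlonglongrightarrow> 0" if "t \<in> {0..T}" for t
    unfolding E_def using LIM_zero[OF young_conv_relax[OF F_cont ms m Y yc(1)]] that by auto
  have Ib: "norm (?I t (\<lambda>s. relax F (y s) (n s))) \<le> B * (1 + R) * T" if "n \<in> kernels K" "t \<in> {0..T}" for n t
  proof -
    have "norm (?I t (\<lambda>s. relax F (y s) (n s))) \<le> B * (1 + R) * (t - 0)"
    proof (rule norm_set_integral_le[OF meas[OF yc(1) that(1)]])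
      fix s assume s: "s \<in> {0..t}"
      have "norm (relax F (y s) (n s)) \<le> B * (1 + norm (y s))" using s that by (intro relax_F_growth) auto
      also have "\<dots> \<le> B * (1 + R)" using s that yb(1)[of s] B by (intro mult_left_mono) auto
      finally show "norm (relax F (y s) (n s)) \<le> B * (1 + R)" .
    qed (use that in auto)
    also have "\<dots> \<le> B * (1 + R) * T" using that B R by (intro mult_left_mono) auto
    finally show ?thesis .
  qed
  have Ebd: "norm (E k t) \<le> 2 * (B * (1 + R) * T)" if "t \<in> {0..T}" for k t
    using Ib[OF ms that, of k] Ib[OF m that] norm_triangle_ineq4[of "?I t (\<lambda>s. relax F (y s) (ms k s))" "?I t (\<lambda>s. relax F (y s) (m s))"]
    unfolding E_def by linarith
  define u where "u = (\<lambda>k t. norm (yk k t - y t))"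
  define c where "c = (\<lambda>k t. norm (xs k - x) + norm (E k t))"
  define \<Lambda> where "\<Lambda> = Lip R"
  have \<Lambda>: "0 < \<Lambda>" unfolding \<Lambda>_def by (rule Lip_pos[OF R])
  have uc: "continuous_on {0..} (u k)" for k unfolding u_def by (intro continuous_intros yc)
  have loc: "set_integrable lebesgue {0..t} (\<lambda>s. relax F (z s) (n s))" if "continuous_on {0..} z" "n \<in> kernels K" for z n t
  proof (cases "0 \<le> t")
    case True
    have "continuous_on {0..t} z" by (rule continuous_on_subset[OF that(1)]) auto
    from compact_bounded_fun[OF _ this] obtain C where C: "\<And>s. s \<in> {0..t} \<Longrightarrow> norm (z s) \<le> C" by auto
    show ?thesis
    proof (rule set_integrable_halfline_Icc[OF meas[OF that], where C="B * (1 + C)"])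
      fix s assume s: "s \<in> {0..t}"
      have "norm (relax F (z s) (n s)) \<le> B * (1 + norm (z s))" using s that by (intro relax_F_growth) auto
      also have "\<dots> \<le> B * (1 + C)" using s C[of s] B by (intro mult_left_mono) auto
      finally show "norm (relax F (z s) (n s)) \<le> B * (1 + C)" .
    qed auto
  qed (simp add: set_integrable_def)
  have Ec: "continuous_on {0..} (E k)" for k
    unfolding E_def using yc(1) ms m by (intro continuous_intros continuous_on_indefinite_integral loc) auto
  have cc: "continuous_on {0..} (c k)" for k unfolding c_def by (intro continuous_intros Ec)
  have key: "u k t \<le> c k t + \<Lambda> * (LINT s:{0..t}|lebesgue. u k s)" if t: "t \<in> {0..T}" for k t
  proof -
    have t0: "0 \<le> t" "t \<le> T" using t by auto
    have e1: "yk k t = xs k + ?I t (\<lambda>s. relax F (yk k s) (ms k s))"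
      using traj_solution[OF ms, of k "xs k"] t0 unfolding solution_def yk_def by auto
    have e2: "y t = x + ?I t (\<lambda>s. relax F (y s) (m s))"
      using traj_solution[OF m, of x] t0 unfolding solution_def y_def by auto
    have i: "set_integrable lebesgue {0..t} (\<lambda>s. relax F (yk k s) (ms k s))" "set_integrable lebesgue {0..t} (\<lambda>s. relax F (y s) (ms k s))"
      using int yc ms t0 yb by auto
    have eq: "yk k t - y t = (xs k - x) + E k t + ?I t (\<lambda>s. relax F (yk k s) (ms k s) - relax F (y s) (ms k s))"
      unfolding set_integral_diff(2)[OF i] e1 e2 E_def by simp
    have "u k t \<le> c k t + norm (?I t (\<lambda>s. relax F (yk k s) (ms k s) - relax F (y s) (ms k s)))"
      unfolding u_def c_def eq using norm_triangle_ineq[of "xs k - x" "E k t"]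
        norm_triangle_ineq[of "(xs k - x) + E k t" "?I t (\<lambda>s. relax F (yk k s) (ms k s) - relax F (y s) (ms k s))"] by linarith
    also have "norm (?I t (\<lambda>s. relax F (yk k s) (ms k s) - relax F (y s) (ms k s))) \<le>
        (LINT s:{0..t}|lebesgue. norm (relax F (yk k s) (ms k s) - relax F (y s) (ms k s)))"
      using set_integral_diff(1)[OF i] by (rule set_integral_norm_bound)
    also have "\<dots> \<le> (LINT s:{0..t}|lebesgue. \<Lambda> * u k s)"
    proof (rule set_integral_mono)
      show "set_integrable lebesgue {0..t} (\<lambda>s. norm (relax F (yk k s) (ms k s) - relax F (y s) (ms k s)))"
        using set_integral_diff(1)[OF i] by (rule set_integrable_norm)
      show "set_integrable lebesgue {0..t} (\<lambda>s. \<Lambda> * u k s)" using continuous_set_integrable[OF uc t0(1)] by auto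
      show "norm (relax F (yk k s) (ms k s) - relax F (y s) (ms k s)) \<le> \<Lambda> * u k s" if "s \<in> {0..t}" for s
        unfolding \<Lambda>_def u_def using that t0 yb by (intro relax_F_lip ms R) auto
    qed
    finally show ?thesis by simp
  qed
  \<comment> \<open>The integrated deviation obeys a Gronwall inequality with the constant
    \<open>cT k\<close> in place of the time-dependent \<open>c k\<close>.\<close>
  define w where "w = (\<lambda>k t. LINT s:{0..t}|lebesgue. u k s)"
  define cT where "cT = (\<lambda>k. LINT s:{0..T}|lebesgue. c k s)"
  have wc: "continuous_on {0..} (w k)" for k
    unfolding w_def by (intro continuous_on_indefinite_integral continuous_set_integrable uc)
  have w: "w k T \<le> cT k * exp (\<Lambda> * T)" for k
  proof (rule gronwall[of T])
    show "continuous_on {0..T} (w k)" by (rule continuous_on_subset[OF wc]) auto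
    fix t assume t: "t \<in> {0..T}"
    have "w k t \<le> (LINT s:{0..t}|lebesgue. c k s + \<Lambda> * w k s)"
    proof -
      have "set_integrable lebesgue {0..t} (u k)" "set_integrable lebesgue {0..t} (\<lambda>s. c k s + \<Lambda> * w k s)"
        using t by (auto intro!: continuous_set_integrable continuous_on_add continuous_on_mult_left uc cc wc)
      then show ?thesis unfolding w_def using t key by (intro set_integral_mono) auto
    qed
    also have "\<dots> = (LINT s:{0..t}|lebesgue. c k s) + \<Lambda> * (LINT s:{0..t}|lebesgue. w k s)"
    proof -
      have "set_integrable lebesgue {0..t} (c k)" "set_integrable lebesgue {0..t} (\<lambda>s. \<Lambda> * w k s)"
        using t by (auto intro!: continuous_set_integrable continuous_on_mult_left cc wc)
      from set_integral_add(2)[OF this] show ?thesis by simp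
    qed
    also have "(LINT s:{0..t}|lebesgue. c k s) \<le> cT k"
    proof -
      have "set_integrable lebesgue {0..T} (c k)" using T by (intro continuous_set_integrable cc)
      from set_integral_Icc_combine[OF this, of t] t
      have "cT k = (LINT s:{0..t}|lebesgue. c k s) + (LINT s:{t..T}|lebesgue. c k s)" by (simp add: cT_def)
      moreover have "0 \<le> (LINT s:{t..T}|lebesgue. c k s)"
        unfolding set_lebesgue_integral_def by (intro integral_nonneg_AE AE_I2) (auto simp: c_def)
      ultimately show ?thesis by simp
    qed
    finally show "w k t \<le> cT k + \<Lambda> * (LINT s:{0..t}|lebesgue. w k s)" by simp
  qed (use T \<Lambda> in auto)
  have c0: "(\<lambda>k. c k t) \<longlonglongrightarrow> 0" if "t \<in> {0..T}" for t
    unfolding c_def using tendsto_add[OF tendsto_norm_zero[OF LIM_zero[OF xs]] tendsto_norm_zero[OF E0[OF that]]] by simp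
  have "(\<lambda>k. cT k) \<longlonglongrightarrow> (LINT s:{0..T}|lebesgue. 0)"
    unfolding cT_def
  proof (rule set_integral_dominated_halfline[where C="2 * R + 2 * (B * (1 + R) * T)"])
    show "c k \<in> borel_measurable halfline" for k by (intro continuous_imp_measurable_on_sets_lebesgue cc) auto
    show "norm (c k s) \<le> 2 * R + 2 * (B * (1 + R) * T)" if "s \<in> {0..T}" for k s
      using Ebd[OF that, of k] norm_triangle_ineq4[of "xs k" x] xR(1)[of k] xR(2) by (simp add: c_def)
  qed (use c0 in auto)
  then have cT0: "cT \<longlonglongrightarrow> 0" by simp
  have "(\<lambda>k. c k T + \<Lambda> * (cT k * exp (\<Lambda> * T))) \<longlonglongrightarrow> 0 + \<Lambda> * (0 * exp (\<Lambda> * T))"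
    using T by (intro tendsto_intros c0 cT0) auto
  then have lim: "(\<lambda>k. c k T + \<Lambda> * (cT k * exp (\<Lambda> * T))) \<longlonglongrightarrow> 0" by simp
  have "(\<lambda>k. u k T) \<longlonglongrightarrow> 0"
  proof (rule tendsto_sandwich[OF _ _ tendsto_const lim])
    show "\<forall>\<^sub>F k in sequentially. u k T \<le> c k T + \<Lambda> * (cT k * exp (\<Lambda> * T))"
    proof (intro always_eventually allI)
      fix k
      have "u k T \<le> c k T + \<Lambda> * w k T" using key[of T k] T by (simp add: w_def)
      also have "\<dots> \<le> c k T + \<Lambda> * (cT k * exp (\<Lambda> * T))" using w[of k] \<Lambda> by simp
      finally show "u k T \<le> c k T + \<Lambda> * (cT k * exp (\<Lambda> * T))" .
    qed
  qed (auto simp: u_def)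
  then show ?thesis unfolding u_def y_def yk_def by (simp add: tendsto_norm_zero_iff LIM_zero_iff)
qed

lemma running_cost_bound:
  assumes n: "n \<in> kernels K" and y: "continuous_on {0..} y"
  shows "set_integrable lebesgue {0..t} (\<lambda>s. relax L (y s) (n s))"
proof -
  obtain C where C: "\<And>s. s \<in> {0..t} \<Longrightarrow> norm (y s) \<le> C"
    using compact_bounded_fun[OF _ continuous_on_subset[OF y], of "{0..t}"] by auto
  obtain C' where C': "0 < C'" "\<And>x a. norm x \<le> C \<Longrightarrow> a \<in> K \<Longrightarrow> norm (L x a) \<le> C'"
    using fun_bound[OF L_cont] by blast
  show ?thesis
  proof (rule set_integrable_halfline_Icc[OF measurable_relax[OF L_cont y n], where C=C'])
    fix s assume s: "s \<in> {0..t}"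
    show "norm (relax L (y s) (n s)) \<le> C'"
    proof (rule relax_bound[where \<Phi>=L, OF n _ L_sec])
      show "norm (L (y s) a) \<le> C'" if "a \<in> K" for a using C[OF s] C'(2) that by blast
    qed (use s in auto)
  qed simp
qed

text \<open>The error splits into the effect of the state, handled by convergence of the
  trajectories and uniform continuity of \<open>L\<close> on a ball times \<open>K\<close>, and the
  effect of the control along the fixed limit trajectory, which is Young convergence.\<close>

theorem cost_stability:
  assumes ms: "\<And>k. ms k \<in> kernels K" and m: "m \<in> kernels K" and Y: "young_conv K ms m"
    and xs: "xs \<longlonglongrightarrow> x" and T: "0 \<le> T"
  shows "(\<lambda>k. J (xs k) (ms k) T) \<longlonglongrightarrow> J x m T"
proof -
  obtain R where R: "0 < R" and xR: "\<And>k. norm (xs k) \<le> R" "norm x \<le> R"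
    and yR: "\<And>k t. t \<in> {0..T} \<Longrightarrow> norm (traj (xs k) (ms k) t) \<le> R" "\<And>t. t \<in> {0..T} \<Longrightarrow> norm (traj x m t) \<le> R"
    using trajectories_bounded[of ms m xs x T, OF ms m xs] by blast
  obtain C where C: "0 < C" "\<And>x a. norm x \<le> R \<Longrightarrow> a \<in> K \<Longrightarrow> norm (L x a) \<le> C"
    using fun_bound[OF L_cont] by blast
  define y where "y = traj x m"
  define yk where "yk = (\<lambda>k. traj (xs k) (ms k))"
  have yc: "continuous_on {0..} y" "\<And>k. continuous_on {0..} (yk k)" using traj_cont m ms by (auto simp: y_def yk_def)
  have yb: "norm (y t) \<le> R" "norm (yk k t) \<le> R" if "t \<in> {0..T}" for k t
    using yR that by (auto simp: y_def yk_def)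
  have lim: "(\<lambda>k. relax L (yk k s) (ms k s) - relax L (y s) (ms k s)) \<longlonglongrightarrow> 0" if s: "s \<in> {0..T}" for s
  proof (rule metric_LIMSEQ_I)
    fix e :: real assume e: "0 < e"
    have "continuous_on (cball (0::'b) R \<times> K) (\<lambda>(x, a). L x a)" by (rule continuous_on_subset[OF L_cont]) auto
    from compact_uniformly_continuous[OF this compact_cball_K] 
    obtain d where d: "0 < d" "\<And>p p'. p \<in> cball (0::'b) R \<times> K \<Longrightarrow> p' \<in> cball (0::'b) R \<times> K \<Longrightarrow> dist p' p < d \<Longrightarrow> dist (case p' of (x, a) \<Rightarrow> L x a) (case p of (x, a) \<Rightarrow> L x a) < e / 2"
      unfolding uniformly_continuous_on_def using e by (metis half_gt_zero)
    have "(\<lambda>k. yk k s) \<longlonglongrightarrow> y s" unfolding yk_def y_def using s by (intro stability ms m Y xs) auto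
    then obtain k0 where k0: "\<And>k. k \<ge> k0 \<Longrightarrow> dist (yk k s) (y s) < d" using d(1) by (meson metric_LIMSEQ_D)
    have "norm (relax L (yk k s) (ms k s) - relax L (y s) (ms k s)) \<le> e / 2" if k: "k \<ge> k0" for k
    proof (rule relax_diff_bound[where \<Phi>=L, OF K(1) ms _ L_sec L_sec])
      fix a assume a: "a \<in> K"
      then show "norm (L (yk k s) a - L (y s) a) \<le> e / 2"
        using d(2)[of "(y s, a)" "(yk k s, a)"] yb[OF s] k0[OF k] by (simp add: dist_Pair_Pair dist_norm less_imp_le)
    qed (use s in auto)
    then have "\<forall>k\<ge>k0. dist (relax L (yk k s) (ms k s) - relax L (y s) (ms k s)) 0 < e"
      unfolding dist_norm diff_zero using e by (metis half_gt_zero_iff le_less_trans field_sum_of_halves less_add_same_cancel1)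
    then show "\<exists>no. \<forall>k\<ge>no. dist (relax L (yk k s) (ms k s) - relax L (y s) (ms k s)) 0 < e" by blast
  qed
  have bd: "norm (relax L v (n s)) \<le> C" if "n \<in> kernels K" "norm v \<le> R" "0 \<le> s" for n v s
    using that C(2) by (intro relax_bound[where \<Phi>=L, OF _ _ L_sec])
  have "(\<lambda>k. LINT s:{0..T}|lebesgue. relax L (yk k s) (ms k s) - relax L (y s) (ms k s)) \<longlonglongrightarrow> (LINT s:{0..T}|lebesgue. 0)"
  proof (rule set_integral_dominated_halfline[where C="2 * C"])
    show "(\<lambda>s. relax L (yk k s) (ms k s) - relax L (y s) (ms k s)) \<in> borel_measurable halfline" for k
      by (intro borel_measurable_diff measurable_relax[OF L_cont] yc ms)
    show "norm (relax L (yk k s) (ms k s) - relax L (y s) (ms k s)) \<le> 2 * C" if "s \<in> {0..T}" for k s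
      using bd[OF ms[of k] yb(2)[OF that, of k], of s] bd[OF ms[of k] yb(1)[OF that], of s] that norm_triangle_ineq4[of "relax L (yk k s) (ms k s)" "relax L (y s) (ms k s)"] by auto
  qed (use lim in auto)
  moreover have "(\<lambda>k. LINT s:{0..T}|lebesgue. relax L (y s) (ms k s)) \<longlonglongrightarrow> (LINT s:{0..T}|lebesgue. relax L (y s) (m s))"
    by (rule young_conv_relax[OF L_cont ms m Y yc(1) T])
  ultimately have "(\<lambda>k. (LINT s:{0..T}|lebesgue. relax L (yk k s) (ms k s) - relax L (y s) (ms k s)) + (LINT s:{0..T}|lebesgue. relax L (y s) (ms k s)))
    \<longlonglongrightarrow> (LINT s:{0..T}|lebesgue. 0) + (LINT s:{0..T}|lebesgue. relax L (y s) (m s))"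
    by (rule tendsto_add)
  moreover have "(LINT s:{0..T}|lebesgue. relax L (yk k s) (ms k s) - relax L (y s) (ms k s)) + (LINT s:{0..T}|lebesgue. relax L (y s) (ms k s)) = J (xs k) (ms k) T" for k
    using set_integral_diff(2)[OF running_cost_bound[OF ms yc(2)] running_cost_bound[OF ms yc(1)], of T k k k] by (simp add: J_def yk_def)
  ultimately show ?thesis by (simp add: J_def y_def)
qed

lemma relax_L_nonneg:
  assumes "m \<in> kernels K" "0 \<le> s"
  shows "0 \<le> relax L z (m s)"
  unfolding relax_def using kernelsD[OF assms] L_nonneg by (intro integral_nonneg_AE AE_I2) auto

lemma J_mono:
  assumes m: "m \<in> kernels K" and "0 \<le> s" "s \<le> t"
  shows "J x m s \<le> J x m t"
proof -
  have "J x m t = J x m s + (LINT r:{s..t}|lebesgue. relax L (traj x m r) (m r))"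
    unfolding J_def by (rule set_integral_Icc_combine[OF running_cost_bound[OF m traj_cont[OF m]] assms(2,3)])
  moreover have "0 \<le> (LINT r:{s..t}|lebesgue. relax L (traj x m r) (m r))"
    unfolding set_lebesgue_integral_def
    using assms relax_L_nonneg[OF m] by (intro integral_nonneg_AE AE_I2) (auto simp: indicator_def)
  ultimately show ?thesis by simp
qed

lemma J_nonneg: "m \<in> kernels K \<Longrightarrow> 0 \<le> t \<Longrightarrow> 0 \<le> J x m t"
  unfolding J_def set_lebesgue_integral_def
  using relax_L_nonneg[of m] by (intro integral_nonneg_AE AE_I2) (auto simp: indicator_def)

lemma cost_eq_J:
  assumes m: "m \<in> kernels K"
  shows "cost (relax F) (relax L) {0..t} x m = ennreal (J x m t)"
proof -
  have i: "integrable lebesgue (\<lambda>s. indicator {0..t} s *\<^sub>R relax L (traj x m s) (m s))"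
    using running_cost_bound[OF m traj_cont[OF m]] by (simp add: set_integrable_def)
  have "cost (relax F) (relax L) {0..t} x m = (\<integral>\<^sup>+s. ennreal (indicator {0..t} s *\<^sub>R relax L (traj x m s) (m s)) \<partial>lebesgue)"
    unfolding cost_def by (intro nn_integral_cong) (auto simp: indicator_def)
  also have "\<dots> = ennreal (LINT s|lebesgue. indicator {0..t} s *\<^sub>R relax L (traj x m s) (m s))"
    using relax_L_nonneg[OF m] by (intro nn_integral_eq_integral i AE_I2) (auto simp: indicator_def)
  finally show ?thesis by (simp add: J_def set_lebesgue_integral_def)
qed

text \<open>Integer horizons exhaust the half-line, and monotone convergence passes the bound to the
  limit.\<close>

lemma cost_halfline_le:
  assumes m: "m \<in> kernels K" and le: "\<And>n. ennreal (J x m (real n)) \<le> c"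
  shows "cost (relax F) (relax L) {0..} x m \<le> c"
proof -
  let ?g = "\<lambda>s. relax L (traj x m s) (m s)"
  have "cost (relax F) (relax L) {0..} x m = (\<integral>\<^sup>+s. (SUP n. ennreal (?g s) * indicator {0..real n} s) \<partial>lebesgue)"
    unfolding cost_def
  proof (intro nn_integral_cong)
    fix s :: real
    have "(SUP n. ennreal (?g s) * indicator {0..real n} s) = ennreal (?g s) * indicator {0..} s"
    proof (intro antisym SUP_least)
      show "ennreal (?g s) * indicator {0..real n} s \<le> ennreal (?g s) * indicator {0..} s" for n
        by (auto simp: indicator_def)
      obtain n where "s \<le> real n" using real_arch_simple by blast
      then show "ennreal (?g s) * indicator {0..} s \<le> (SUP n. ennreal (?g s) * indicator {0..real n} s)"
        by (intro SUP_upper2[of n]) (auto simp: indicator_def)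
    qed
    then show "ennreal (?g s) * indicator {0..} s = (SUP n. ennreal (?g s) * indicator {0..real n} s)" by simp
  qed
  also have "\<dots> = (SUP n. \<integral>\<^sup>+s. ennreal (?g s) * indicator {0..real n} s \<partial>lebesgue)"
  proof (rule nn_integral_monotone_convergence_SUP)
    show "incseq (\<lambda>n s. ennreal (?g s) * indicator {0..real n} s)"
      by (auto simp: incseq_def le_fun_def indicator_def)
    fix n
    have "(\<lambda>s. indicator {0..real n} s *\<^sub>R ?g s) \<in> borel_measurable lebesgue"
      using set_borel_measurable_halfline[OF measurable_relax[OF L_cont traj_cont[OF m] m], of "{0..real n}"] 
      by (auto simp: set_borel_measurable_def)
    then have "(\<lambda>s. ennreal (indicator {0..real n} s *\<^sub>R ?g s)) \<in> borel_measurable lebesgue" by measurable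
    also have "(\<lambda>s. ennreal (indicator {0..real n} s *\<^sub>R ?g s)) = (\<lambda>s. ennreal (?g s) * indicator {0..real n} s)"
      by (auto simp: indicator_def)
    finally show "(\<lambda>s. ennreal (?g s) * indicator {0..real n} s) \<in> borel_measurable lebesgue" .
  qed
  also have "\<dots> \<le> c"
    using le cost_eq_J[OF m, of _ x] by (intro SUP_least) (simp add: cost_def)
  finally show ?thesis .
qed

lemma J_le_cost:
  assumes m: "m \<in> kernels K"
  shows "ennreal (J x m t) \<le> cost (relax F) (relax L) {0..} x m"
  unfolding cost_eq_J[OF m, symmetric] cost_def
  by (intro nn_integral_mono) (auto simp: indicator_def)

text \<open>The direct method. The bound is asked for at each integer horizon only for large
  \<open>k\<close> and up to any \<open>e > 0\<close>, so that controls that are good on growing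
  horizons qualify. The initial state varies with \<open>k\<close> for the sake of
  semicontinuity.\<close>

theorem relaxed_compactness:
  assumes ms: "\<And>k::nat. ms k \<in> kernels K" and xs: "xs \<longlonglongrightarrow> x"
    and le: "\<And>n e. 0 < e \<Longrightarrow> \<forall>\<^sub>F k in sequentially. ennreal (J (xs k) (ms k) (real n)) \<le> c + ennreal e"
  obtains m where "m \<in> kernels K" "cost (relax F) (relax L) {0..} x m \<le> c"
proof -
  obtain r m where r: "strict_mono (r :: nat \<Rightarrow> nat)" and m: "m \<in> kernels K" and Y: "young_conv K (\<lambda>k. ms (r k)) m"
    using young_compactness[of K ms, OF K ms] by blast
  have "cost (relax F) (relax L) {0..} x m \<le> c"
  proof (rule cost_halfline_le[OF m])
    fix n
    have "(\<lambda>k. J (xs (r k)) (ms (r k)) (real n)) \<longlonglongrightarrow> J x m (real n)"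
      using LIMSEQ_subseq_LIMSEQ[OF xs r] by (intro cost_stability[OF ms m Y]) (auto simp: o_def)
    then have "(\<lambda>k. ennreal (J (xs (r k)) (ms (r k)) (real n))) \<longlonglongrightarrow> ennreal (J x m (real n))" by (rule tendsto_ennrealI)
    then have lim: "(\<lambda>k. ennreal (J (xs (r k)) (ms (r k)) (real n))) \<longlonglongrightarrow> ennreal (J x m (real n))" .
    have "ennreal (J x m (real n)) \<le> c + ennreal e" if e: "0 < e" for e
    proof (rule tendsto_upperbound[OF lim])
      show "\<forall>\<^sub>F k in sequentially. ennreal (J (xs (r k)) (ms (r k)) (real n)) \<le> c + ennreal e"
        by (rule eventually_subseq[OF r, of "\<lambda>k. ennreal (J (xs k) (ms k) (real n)) \<le> c + ennreal e", OF le[OF e]])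
    qed simp
    then show "ennreal (J x m (real n)) \<le> c" by (rule ennreal_le_epsilon)
  qed
  with m show ?thesis by (rule that)
qed

end

section \<open>Chattering\<close>

lemma dirac_kernel:
  assumes "w \<in> restrict_space borel {0..} \<rightarrow>\<^sub>M restrict_space borel K"
  shows "(\<lambda>s. return (restrict_space borel K) (w s)) \<in> kernels K"
proof -
  have "w \<in> halfline \<rightarrow>\<^sub>M restrict_space borel K"
  proof (rule measurableI)
    fix A assume A: "A \<in> sets (restrict_space borel K)"
    have "w -` A \<inter> {0..} \<in> sets (restrict_space borel {0..})"
      using measurable_sets[OF assms A] by (simp add: space_restrict_space)
    then have "w -` A \<inter> {0..} \<in> sets borel" by (subst (asm) sets_restrict_space_iff) auto
    then show "w -` A \<inter> space halfline \<in> sets halfline"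
      by (subst sets_restrict_space_iff) (auto simp: space_restrict_space)
  qed (use measurable_space[OF assms] in \<open>auto simp: space_restrict_space\<close>)
  from measurable_compose[OF this measurable_return_prob_space] show ?thesis
    by (simp add: kernels_def)
qed

definition block_integral :: "(real \<Rightarrow> real) \<Rightarrow> real \<Rightarrow> nat \<Rightarrow> real" where
  "block_integral q h i = (LINT s:{real i * h..real (Suc i) * h}|lebesgue. q s)"

text \<open>Pulse-width modulation: on each block of length \<open>h\<close> the set of times that satisfy the predicate
  is an initial segment whose length is the integral of \<open>q\<close> over the block.\<close>

definition pulse :: "(real \<Rightarrow> real) \<Rightarrow> real \<Rightarrow> real \<Rightarrow> bool" where
  "pulse q h s \<longleftrightarrow> s - real (nat \<lfloor>s / h\<rfloor>) * h < block_integral q h (nat \<lfloor>s / h\<rfloor>)"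

lemma borel_measurable_nat_compose:
  fixes g :: "nat \<Rightarrow> 'a::topological_space"
  assumes "f \<in> M \<rightarrow>\<^sub>M count_space UNIV"
  shows "(\<lambda>x. g (f x)) \<in> borel_measurable M"
  by (rule measurable_compose[OF assms]) simp

lemma pulse_measurable: "Measurable.pred borel (pulse q h)"
proof -
  have [measurable]: "(\<lambda>s::real. nat \<lfloor>s / h\<rfloor>) \<in> borel \<rightarrow>\<^sub>M count_space UNIV" by measurable
  have [measurable]: "(\<lambda>s::real. real (nat \<lfloor>s / h\<rfloor>)) \<in> borel_measurable borel"
    by (rule borel_measurable_nat_compose) measurable
  have [measurable]: "(\<lambda>s::real. block_integral q h (nat \<lfloor>s / h\<rfloor>)) \<in> borel_measurable borel"
    by (rule borel_measurable_nat_compose) measurable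
  show ?thesis unfolding pulse_def by measurable
qed

lemma floor_block:
  assumes "0 < h" "real i * h \<le> s" "s < real (Suc i) * h"
  shows "nat \<lfloor>s / h\<rfloor> = i"
proof -
  have "real i \<le> s / h" "s / h < real i + 1" using assms by (auto simp: field_simps)
  then have "\<lfloor>s / h\<rfloor> = int i" by (intro floor_unique) auto
  then show ?thesis by simp
qed

lemma block_integral_bounds:
  assumes q: "q \<in> borel_measurable halfline" "\<And>s. 0 \<le> s \<Longrightarrow> 0 \<le> q s \<and> q s \<le> 1" and h: "0 < h"
  shows "0 \<le> block_integral q h i" "block_integral q h i \<le> h"
proof -
  have le: "0 \<le> real i * h" "real i * h \<le> real (Suc i) * h" using h by (auto simp: mult_right_mono)
  show "0 \<le> block_integral q h i"
    unfolding block_integral_def set_lebesgue_integral_def using q(2) le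
    by (intro integral_nonneg_AE AE_I2) (auto simp: indicator_def)
  have "norm (block_integral q h i) \<le> 1 * (real (Suc i) * h - real i * h)"
    unfolding block_integral_def using q le by (intro norm_set_integral_le) auto
  then show "block_integral q h i \<le> h" by (simp add: algebra_simps)
qed

text \<open>A larger \<open>q\<close> gives a longer initial segment of the same block. This nesting
  allows several levels to be combined into one control.\<close>

lemma pulse_mono:
  assumes q: "q \<in> borel_measurable halfline" "\<And>s. 0 \<le> s \<Longrightarrow> 0 \<le> q s \<and> q s \<le> 1"
    and q': "q' \<in> borel_measurable halfline" "\<And>s. 0 \<le> s \<Longrightarrow> 0 \<le> q' s \<and> q' s \<le> 1"
    and le: "\<And>s. 0 \<le> s \<Longrightarrow> q s \<le> q' s" and h: "0 < h" and p: "pulse q h s"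
  shows "pulse q' h s"
proof -
  let ?i = "nat \<lfloor>s / h\<rfloor>"
  have i: "0 \<le> real ?i * h" using h by auto
  have "block_integral q h ?i \<le> block_integral q' h ?i"
    unfolding block_integral_def using q q' le i
    by (intro set_integral_mono set_integrable_halfline_Icc[where C=1]) auto
  then show ?thesis using p unfolding pulse_def by linarith
qed

lemma pulse_one:
  assumes "\<And>s. 0 \<le> s \<Longrightarrow> q s = 1" "0 < h"  "0 \<le> s"
  shows "pulse q h s"
proof -
  let ?i = "nat \<lfloor>s / h\<rfloor>"
  have i: "0 \<le> real ?i * h" "real ?i * h \<le> real (Suc ?i) * h" using assms(2) by (auto simp: mult_right_mono)
  have "block_integral q h ?i = (LINT s:{real ?i * h..real (Suc ?i) * h}|lebesgue. 1)"
    unfolding block_integral_def using assms(1) i by (intro set_lebesgue_integral_cong) auto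
  also have "\<dots> = h" using i by (simp add: set_lebesgue_integral_def algebra_simps)
  finally have b: "block_integral q h ?i = h" .
  have "real ?i = of_int \<lfloor>s / h\<rfloor>" using assms by simp
  then have "s / h < real ?i + 1" by linarith
  then have "s < real ?i * h + h" using assms(2) by (simp add: field_simps)
  then show ?thesis unfolding pulse_def b by linarith
qed

lemma pulse_block:
  assumes q: "q \<in> borel_measurable halfline" "\<And>s. 0 \<le> s \<Longrightarrow> 0 \<le> q s \<and> q s \<le> 1" and h: "0 < h"
  shows "(LINT s:{real i * h..real (Suc i) * h}|lebesgue. of_bool (pulse q h s)) = block_integral q h i"
proof -
  let ?b = "block_integral q h i"
  have b: "0 \<le> ?b" "?b \<le> h" using block_integral_bounds[OF assms] by auto
  have "(LINT s:{real i * h..real (Suc i) * h}|lebesgue. of_bool (pulse q h s)) = (LINT s|lebesgue. indicator {real i * h..<real i * h + ?b} s :: real)"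
    unfolding set_lebesgue_integral_def
  proof (rule integral_cong_AE)
    have "(\<lambda>s. of_bool (pulse q h s) :: real) \<in> borel_measurable borel" using pulse_measurable[of q h] by measurable
    then show "(\<lambda>s. indicator {real i * h..real (Suc i) * h} s *\<^sub>R (of_bool (pulse q h s) :: real)) \<in> borel_measurable lebesgue"
      by (intro measurable_completion) simp
    \<comment> \<open>The right endpoint belongs to the next block and is discarded as a null
      set.\<close>
    have "AE s in lebesgue. s \<noteq> real (Suc i) * h"
      by (rule AE_completion) (rule AE_lborel_singleton)
    then show "AE s in lebesgue. indicator {real i * h..real (Suc i) * h} s *\<^sub>R (of_bool (pulse q h s) :: real) = indicator {real i * h..<real i * h + ?b} s"
    proof eventually_elim
      case (elim s)
      show ?case
      proof (cases "real i * h \<le> s \<and> s < real (Suc i) * h")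
        case True
        then have "nat \<lfloor>s / h\<rfloor> = i" using h by (intro floor_block) auto
        then show ?thesis using True by (auto simp: pulse_def indicator_def)
      next
        case False
        then have "s \<notin> {real i * h..<real i * h + ?b}" "s \<notin> {real i * h..real (Suc i) * h}"
          using elim b by (auto simp: algebra_simps)
        then show ?thesis by simp
      qed
    qed
  qed (auto intro!: measurable_completion)
  also have "\<dots> = ?b" using b by simp
  finally show ?thesis .
qed

text \<open>On complete blocks the pulse and \<open>q\<close> have equal integrals. Only the last
  incomplete block is left, of length at most \<open>h\<close>, where the integrand is bounded by
  1.\<close>

lemma pulse_integral:
  assumes q: "q \<in> borel_measurable halfline" "\<And>s. 0 \<le> s \<Longrightarrow> 0 \<le> q s \<and> q s \<le> 1" and h: "0 < h" and t: "0 \<le> t"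
  shows "\<bar>LINT s:{0..t}|lebesgue. of_bool (pulse q h s) - q s\<bar> \<le> h"
proof -
  let ?f = "\<lambda>s. of_bool (pulse q h s) - q s"
  have "(\<lambda>s. of_bool (pulse q h s) :: real) \<in> borel_measurable borel" using pulse_measurable[of q h] by measurable
  then have pm: "(\<lambda>s. of_bool (pulse q h s) :: real) \<in> borel_measurable halfline"
    by (intro measurable_restrict_space1 measurable_completion) simp
  have m: "?f \<in> borel_measurable halfline" using pm q(1) by (rule borel_measurable_diff)
  have bd: "norm (?f s) \<le> 1" if "0 \<le> s" for s using q(2)[OF that] by (auto simp: of_bool_def)
  have int: "set_integrable lebesgue {a..b} ?f" if "0 \<le> a" for a b
    using that bd by (intro set_integrable_halfline_Icc[OF m, where C=1]) auto
  let ?i = "nat \<lfloor>t / h\<rfloor>"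
  have le: "real ?i * h \<le> t" "t \<le> real ?i * h + h"
  proof -
    have "real ?i = of_int \<lfloor>t / h\<rfloor>" using t h by simp
    then have "real ?i \<le> t / h" "t / h \<le> real ?i + 1" by linarith+
    then show "real ?i * h \<le> t" "t \<le> real ?i * h + h" using h by (auto simp: field_simps)
  qed
  have i0: "0 \<le> real i * h" for i using h by simp
  have "(LINT s:{0..real ?i * h}|lebesgue. ?f s) = (\<Sum>i<?i. LINT s:{real i * h..real (Suc i) * h}|lebesgue. ?f s)"
    using h by (intro set_integral_partition int) auto
  also have "\<dots> = (\<Sum>i<?i. 0)"
  proof (intro sum.cong refl)
    fix i
    have "set_integrable lebesgue {real i * h..real (Suc i) * h} (\<lambda>s. of_bool (pulse q h s) :: real)"
      by (rule set_integrable_halfline_Icc[OF pm i0, where C=1]) simp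
    moreover have "set_integrable lebesgue {real i * h..real (Suc i) * h} q"
      using i0[of i] q(2) by (intro set_integrable_halfline_Icc[OF q(1) i0, where C=1]) auto
    ultimately have "(LINT s:{real i * h..real (Suc i) * h}|lebesgue. ?f s) =
        (LINT s:{real i * h..real (Suc i) * h}|lebesgue. of_bool (pulse q h s)) - (LINT s:{real i * h..real (Suc i) * h}|lebesgue. q s)"
      by (rule set_integral_diff(2))
    also have "(LINT s:{real i * h..real (Suc i) * h}|lebesgue. of_bool (pulse q h s)) = block_integral q h i"
      by (rule pulse_block[OF q h])
    also have "block_integral q h i - (LINT s:{real i * h..real (Suc i) * h}|lebesgue. q s) = 0"
      unfolding block_integral_def by (rule diff_self)
    finally show "(LINT s:{real i * h..real (Suc i) * h}|lebesgue. ?f s) = 0" .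
  qed
  finally have z: "(LINT s:{0..real ?i * h}|lebesgue. ?f s) = 0" by simp
  have "(LINT s:{0..t}|lebesgue. ?f s) = (LINT s:{real ?i * h..t}|lebesgue. ?f s)"
    using set_integral_Icc_combine[OF int[OF order_refl] i0 le(1)] z by simp
  also have "norm \<dots> \<le> 1 * (t - real ?i * h)"
    using i0[of ?i] le(1) bd by (intro norm_set_integral_le m) auto
  finally show ?thesis using le(2) by simp
qed

text \<open>Summation by parts for an increasing family of conditions: a function of the first index
  that holds becomes a linear expression in the truth values and can be integrated term by term. It
  is applied once to times and once to points of \<open>K\<close>.\<close>

lemma Least_telescope:
  fixes \<psi> :: "nat \<Rightarrow> real"
  assumes mono: "\<And>j. P j \<Longrightarrow> P (Suc j)" and N: "P N"
  shows "\<psi> (LEAST j. P j) = \<psi> N + (\<Sum>j<N. (\<psi> j - \<psi> (Suc j)) * of_bool (P j))"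
proof -
  define l where "l = (LEAST j. P j)"
  have l: "P l" "l \<le> N" unfolding l_def using N by (auto intro: LeastI Least_le)
  have iff: "P j \<longleftrightarrow> l \<le> j" for j
  proof
    show "P j \<Longrightarrow> l \<le> j" unfolding l_def by (rule Least_le)
    show "l \<le> j \<Longrightarrow> P j" by (induction rule: dec_induct) (use l mono in auto)
  qed
  have "(\<Sum>j<N. (\<psi> j - \<psi> (Suc j)) * of_bool (P j)) = (\<Sum>j\<in>{l..<N}. \<psi> j - \<psi> (Suc j))"
    by (rule sum.mono_neutral_cong_right) (auto simp: iff)
  also have "\<dots> = \<psi> l - \<psi> N" using sum_Suc_diff'[OF l(2), of "\<lambda>j. - \<psi> j"] by simp
  finally show ?thesis by (simp add: l_def)
qed

text \<open>A finite net in \<open>K0\<close> yields increasing sets \<open>D j\<close>, unions of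
  balls within \<open>K\<close>, whose masses \<open>q j s\<close> increase to 1. The control takes
  the value \<open>a j\<close> while \<open>j\<close> is the first level whose pulse is on, so in
  each block it spends there the integrated mass of \<open>D j - D (j - 1)\<close>. The pulses cause
  the error \<open>2 C \<epsilon>\<close>, the shift of mass to the net causes \<open>e t\<close>.
  One \<open>w\<close> serves for all test functions.\<close>

lemma chattering_step:
  fixes K :: "'a::euclidean_space set"
  assumes K: "compact K" "K \<noteq> {}" and m: "m \<in> kernels K" and K0: "K0 \<subseteq> K" "K \<subseteq> closure K0"
    and \<eta>: "0 < \<eta>" and \<epsilon>: "0 < \<epsilon>"
  obtains w where "w \<in> borel_measurable borel" "finite (range w)" "range w \<subseteq> K0"
    "\<And>\<phi> C e t. continuous_on K \<phi> \<Longrightarrow> (\<And>a. a \<in> K \<Longrightarrow> \<bar>\<phi> a\<bar> \<le> C) \<Longrightarrow>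
      (\<And>a b. a \<in> K \<Longrightarrow> b \<in> K \<Longrightarrow> dist a b < \<eta> \<Longrightarrow> \<bar>\<phi> a - \<phi> b\<bar> \<le> e) \<Longrightarrow> 0 \<le> t \<Longrightarrow>
      \<bar>(LINT s:{0..t}|lebesgue. \<phi> (w s)) - (LINT s:{0..t}|lebesgue. LINT a|m s. \<phi> a)\<bar> \<le> 2 * C * \<epsilon> + e * t"
proof -
  have "K \<subseteq> (\<Union>c\<in>K0. ball c \<eta>)"
  proof
    fix x assume "x \<in> K"
    then have "x \<in> closure K0" using K0 by auto
    then obtain c where "c \<in> K0" "dist c x < \<eta>" using \<eta> unfolding closure_approachable by blast
    then show "x \<in> (\<Union>c\<in>K0. ball c \<eta>)" by auto
  qed
  then obtain S where S: "S \<subseteq> K0" "finite S" "K \<subseteq> (\<Union>c\<in>S. ball c \<eta>)"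
    using compactE_image[OF K(1), of K0 "\<lambda>c. ball c \<eta>"] by (metis open_ball)
  obtain as where as: "set as = S" using finite_list[OF S(2)] by blast
  have "S \<noteq> {}" using S(3) K(2) by auto
  then have as0: "as \<noteq> []" using as by auto
  define N where "N = length as - 1"
  \<comment> \<open>Indices beyond the last one repeat the last net point, so that
    \<open>a j\<close> lies in the net for every \<open>j\<close>.\<close>
  define a where "a = (\<lambda>j. as ! (min j N))"
  have aS: "a j \<in> S" for j
  proof -
    have "min j N < length as" using as0 by (simp add: N_def min_def) (metis Suc_pred diff_less length_greater_0_conv lessI less_imp_diff_less linorder_not_le nat_less_le zero_less_one)
    then show ?thesis using as by (auto simp: a_def)
  qed
  then have aK: "a j \<in> K" for j using S(1) K0(1) by auto
  define D where "D = (\<lambda>j. K \<inter> (\<Union>i\<le>j. ball (a i) \<eta>))"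
  have DN: "D N = K"
  proof -
    have "x \<in> (\<Union>i\<le>N. ball (a i) \<eta>)" if "x \<in> K" for x
    proof -
      have "x \<in> (\<Union>c\<in>S. ball c \<eta>)" using that S(3) by blast
      then obtain c where "c \<in> set as" "x \<in> ball c \<eta>" unfolding as by blast
      then obtain j where "j < length as" "as ! j = c" by (auto simp: in_set_conv_nth)
      then have "j \<le> N" "a j = c" by (auto simp: N_def a_def min_def)
      then show ?thesis using \<open>x \<in> ball c \<eta>\<close> by blast
    qed
    then show ?thesis by (auto simp: D_def)
  qed
  have Dmono: "D j \<subseteq> D (Suc j)" for j unfolding D_def by (intro Int_mono UN_mono) auto
  have Ds: "D j \<in> sets (restrict_space borel K)" for j
    unfolding D_def sets_restrict_space by (intro imageI) auto
  have Dm: "D j \<in> sets (m s)" if "0 \<le> s" for j s using Ds kernelsD(2)[OF m that] by simp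
  define q where "q = (\<lambda>j s. measure (m s) (D j))"
  have qm: "q j \<in> borel_measurable halfline" for j
    unfolding q_def
    using measurable_compose[OF measurable_prob_algebraD[OF m[unfolded kernels_def]] measurable_measure_subprob_algebra[OF Ds]] .
  have q01: "0 \<le> q j s \<and> q j s \<le> 1" if "0 \<le> s" for j s
    unfolding q_def using prob_space.prob_le_1[OF kernelsD(1)[OF m that]] by simp
  have qmono: "q j s \<le> q (Suc j) s" if "0 \<le> s" for j s
    unfolding q_def using Dmono Dm[OF that] prob_space.finite_measure[OF kernelsD(1)[OF m that]]
    by (intro finite_measure.finite_measure_mono) auto
  have qN: "q N s = 1" if "0 \<le> s" for s
    unfolding q_def DN using prob_space.prob_space[OF kernelsD(1)[OF m that]] kernelsD(3)[OF m that] by simp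
  \<comment> \<open>Each of the \<open>N\<close> levels contributes a pulse error of at most
    \<open>2 C h\<close>; dividing by \<open>N + 1\<close> is safe also for a net of one
    point.\<close>
  define h where "h = \<epsilon> / real (Suc N)"
  have h: "0 < h" using \<epsilon> by (simp add: h_def)
  define U where "U = (\<lambda>j s. pulse (q j) h s)"
  have Um[measurable]: "Measurable.pred borel (U j)" for j unfolding U_def by (rule pulse_measurable)
  have Umono: "U j s \<Longrightarrow> U (Suc j) s" for j s
    unfolding U_def by (rule pulse_mono[OF qm q01 qm q01 qmono h])
  have UN: "U N s" if "0 \<le> s" for s unfolding U_def by (rule pulse_one[OF qN h that])
  define w where "w = (\<lambda>s. a (LEAST j. U j s))"
  have wm: "w \<in> borel_measurable borel"
    unfolding w_def
  proof (rule borel_measurable_nat_compose)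
    show "(\<lambda>s. LEAST j. U j s) \<in> borel \<rightarrow>\<^sub>M count_space UNIV" by measurable
  qed
  have wS: "range w \<subseteq> S" using aS by (auto simp: w_def)
  \<comment> \<open>Each point is assigned to the first ball that contains it, and its mass is moved
    to that centre.\<close>
  define \<iota> where "\<iota> = (\<lambda>x. LEAST j. x \<in> D j)"
  have \<iota>: "dist (a (\<iota> x)) x < \<eta>" if "x \<in> K" for x
  proof -
    have "x \<in> D N" using that DN by blast
    then have "x \<in> D (\<iota> x)" unfolding \<iota>_def by (rule LeastI)
    then obtain i where i: "i \<le> \<iota> x" "x \<in> ball (a i) \<eta>" unfolding D_def by blast
    then have "x \<in> D i" using that unfolding D_def by blast
    then have "\<iota> x \<le> i" unfolding \<iota>_def by (rule Least_le)
    then show ?thesis using i by auto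
  qed
  show ?thesis
  proof (rule that[OF wm])
    show "finite (range w)" using wS S(2) by (rule finite_subset)
    show "range w \<subseteq> K0" using wS S(1) by blast
    fix \<phi> :: "'a \<Rightarrow> real" and C e t :: real
    assume \<phi>: "continuous_on K \<phi>" and C: "\<And>a. a \<in> K \<Longrightarrow> \<bar>\<phi> a\<bar> \<le> C"
      and osc: "\<And>a b. a \<in> K \<Longrightarrow> b \<in> K \<Longrightarrow> dist a b < \<eta> \<Longrightarrow> \<bar>\<phi> a - \<phi> b\<bar> \<le> e" and t: "0 \<le> t"
    have C0: "0 \<le> C" using C[OF aK[of 0]] by linarith
    let ?d = "\<lambda>j. \<phi> (a j) - \<phi> (a (Suc j))"
    have \<phi>m: "\<phi> \<in> borel_measurable (restrict_space borel K)" using \<phi> by (rule borel_measurable_continuous_on_restrict)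
    \<comment> \<open>The integral of \<open>\<phi>\<close> against the kernel whose mass has been
      moved to the net points.\<close>
    define g where "g = (\<lambda>s. \<phi> (a N) + (\<Sum>j<N. ?d j * q j s))"
    have w_eq: "\<phi> (w s) = \<phi> (a N) + (\<Sum>j<N. ?d j * of_bool (U j s))" if "0 \<le> s" for s
      unfolding w_def using Least_telescope[of "\<lambda>j. U j s" N "\<lambda>j. \<phi> (a j)"] Umono UN[OF that] by auto
    have gm: "g \<in> borel_measurable halfline" unfolding g_def using qm by measurable
    have osc_g: "\<bar>g s - (LINT x|m s. \<phi> x)\<bar> \<le> e" if s: "0 \<le> s" for s
    proof -
      interpret prob_space "m s" by (rule kernelsD(1)[OF m s])
      have "\<phi> (a (\<iota> x)) = \<phi> (a N) + (\<Sum>j<N. ?d j * indicator (D j) x)" if "x \<in> K" for x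
      proof -
        have "\<phi> (a (\<iota> x)) = \<phi> (a N) + (\<Sum>j<N. ?d j * of_bool (x \<in> D j))"
          unfolding \<iota>_def using Least_telescope[of "\<lambda>j. x \<in> D j" N "\<lambda>j. \<phi> (a j)"] Dmono DN that by auto
        then show ?thesis by (simp add: indicator_def of_bool_def)
      qed
      then have b: "norm ((\<phi> (a N) + (\<Sum>j<N. ?d j * indicator (D j) x)) - \<phi> x) \<le> e" if "x \<in> space (m s)" for x
        using osc[OF aK _ \<iota>, of x] that kernelsD(3)[OF m s] by simp
      have i: "integrable (m s) (\<lambda>x. \<phi> (a N) + (\<Sum>j<N. ?d j * indicator (D j) x))"
        using Dm[OF s] by (intro Bochner_Integration.integrable_add Bochner_Integration.integrable_sum integrable_mult_right integrable_real_indicator) (auto simp: emeasure_eq_measure)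
      have i\<phi>: "integrable (m s) \<phi>" by (rule integrable_kernel[OF K(1) m s \<phi>])
      have "(LINT x|m s. \<phi> (a N) + (\<Sum>j<N. ?d j * indicator (D j) x)) = g s"
    proof -
      have ii: "integrable (m s) (\<lambda>x. ?d j * indicator (D j) x)" for j
        using Dm[OF s, of j] by (intro integrable_mult_right integrable_real_indicator) (auto simp: emeasure_eq_measure)
      have "(LINT x|m s. \<phi> (a N) + (\<Sum>j<N. ?d j * indicator (D j) x)) = (LINT x|m s. \<phi> (a N)) + (LINT x|m s. (\<Sum>j<N. ?d j * indicator (D j) x))"
        by (intro Bochner_Integration.integral_add Bochner_Integration.integrable_sum ii) simp
      also have "(LINT x|m s. (\<Sum>j<N. ?d j * indicator (D j) x)) = (\<Sum>j<N. LINT x|m s. ?d j * indicator (D j) x)"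
        by (intro Bochner_Integration.integral_sum ii)
      also have "\<dots> = (\<Sum>j<N. ?d j * q j s)"
        using Dm[OF s] by (intro sum.cong refl) (simp add: q_def)
      finally show ?thesis by (simp add: g_def prob_space)
    qed
      then have "g s - (LINT x|m s. \<phi> x) = (LINT x|m s. (\<phi> (a N) + (\<Sum>j<N. ?d j * indicator (D j) x)) - \<phi> x)"
        using i i\<phi> by simp
      also have "norm \<dots> \<le> e"
        using b i i\<phi> by (intro norm_integral_le_const(2) borel_measurable_integrable Bochner_Integration.integrable_diff) auto
      finally show ?thesis by simp
    qed
    have "(\<lambda>s. \<phi> (w s)) \<in> borel_measurable borel"
    proof -
      have "w \<in> borel \<rightarrow>\<^sub>M restrict_space borel K"
        using wm aK by (intro measurable_restrict_space2) (auto simp: w_def)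
      from measurable_compose[OF this \<phi>m] show ?thesis .
    qed
    then have pwm: "(\<lambda>s. \<phi> (w s)) \<in> borel_measurable halfline"
      by (intro measurable_restrict_space1 measurable_completion) simp
    have gb: "norm (g s) \<le> \<bar>\<phi> (a N)\<bar> + (\<Sum>j<N. \<bar>?d j\<bar>)" if "0 \<le> s" for s
    proof -
      have "\<bar>\<Sum>j<N. ?d j * q j s\<bar> \<le> (\<Sum>j<N. \<bar>?d j\<bar>)"
        using q01[OF that] by (intro order_trans[OF sum_abs] sum_mono) (auto simp: abs_mult mult_left_le)
      then show ?thesis unfolding g_def by (auto intro: order_trans[OF abs_triangle_ineq])
    qed
    have ig: "set_integrable lebesgue {0..t} g" using gb by (intro set_integrable_halfline_Icc[OF gm]) auto
    have iw: "set_integrable lebesgue {0..t} (\<lambda>s. \<phi> (w s))"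
      using C aK by (intro set_integrable_halfline_Icc[OF pwm, where C=C]) (auto simp: w_def)
    have im: "set_integrable lebesgue {0..t} (\<lambda>s. LINT x|m s. \<phi> x)"
    proof (rule set_integrable_halfline_Icc[where C=C])
      show "(\<lambda>s. LINT x|m s. \<phi> x) \<in> borel_measurable halfline"
        by (rule measurable_kernel_integral[OF m[unfolded kernels_def] \<phi>m])
      show "norm (LINT x|m s. \<phi> x) \<le> C" if "s \<in> {0..t}" for s
        using relax_bound[where \<Phi>="\<lambda>_. \<phi>" and z="()" and C=C, OF m _ \<phi>] C that by (simp add: relax_def)
    qed simp
    have fm: "(\<lambda>s. of_bool (U j s) - q j s) \<in> borel_measurable halfline" for j
    proof -
      have "(\<lambda>s. of_bool (U j s) :: real) \<in> borel_measurable borel" by measurable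
      then have "(\<lambda>s. of_bool (U j s) :: real) \<in> borel_measurable halfline"
        by (intro measurable_restrict_space1 measurable_completion) simp
      then show ?thesis using qm by (rule borel_measurable_diff)
    qed
    have fi: "set_integrable lebesgue {0..t} (\<lambda>s. ?d j * (of_bool (U j s) - q j s))" for j
    proof -
      have "norm (of_bool (U j s) - q j s :: real) \<le> 1" if "s \<in> {0..t}" for s
        using q01[of s j] that by (auto simp: of_bool_def)
      then have "set_integrable lebesgue {0..t} (\<lambda>s. of_bool (U j s) - q j s)"
        by (intro set_integrable_halfline_Icc[OF fm, where C=1]) auto
      then show ?thesis by simp
    qed
    have "(LINT s:{0..t}|lebesgue. \<phi> (w s)) - (LINT s:{0..t}|lebesgue. g s) = (LINT s:{0..t}|lebesgue. \<phi> (w s) - g s)"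
      using iw ig by (rule set_integral_diff(2)[symmetric])
    also have "\<dots> = (LINT s:{0..t}|lebesgue. \<Sum>j<N. ?d j * (of_bool (U j s) - q j s))"
      by (intro set_lebesgue_integral_cong) (auto simp: w_eq g_def sum_subtractf right_diff_distrib)
    also have "\<dots> = (\<Sum>j<N. LINT s:{0..t}|lebesgue. ?d j * (of_bool (U j s) - q j s))"
      using fi unfolding set_lebesgue_integral_def set_integrable_def
      by (simp only: scaleR_sum_right) (rule Bochner_Integration.integral_sum, auto)
    also have "\<dots> = (\<Sum>j<N. ?d j * (LINT s:{0..t}|lebesgue. of_bool (U j s) - q j s))"
      by simp
    also have "\<bar>\<dots>\<bar> \<le> (\<Sum>j<N. (2 * C) * h)"
    proof (intro order_trans[OF sum_abs] sum_mono)
      fix j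
      have "\<bar>?d j\<bar> \<le> 2 * C" using C[OF aK[of j]] C[OF aK[of "Suc j"]] by linarith
      moreover have "\<bar>LINT s:{0..t}|lebesgue. of_bool (U j s) - q j s\<bar> \<le> h"
        unfolding U_def by (rule pulse_integral[OF qm q01 h t])
      ultimately show "\<bar>?d j * (LINT s:{0..t}|lebesgue. of_bool (U j s) - q j s)\<bar> \<le> (2 * C) * h"
        unfolding abs_mult using C0 by (intro mult_mono) auto
    qed
    also have "\<dots> = 2 * C * (real N * h)" by simp
    also have "\<dots> \<le> 2 * C * \<epsilon>"
      using C0 \<epsilon> by (intro mult_left_mono) (auto simp: h_def divide_le_eq algebra_simps)
    finally have 1: "\<bar>(LINT s:{0..t}|lebesgue. \<phi> (w s)) - (LINT s:{0..t}|lebesgue. g s)\<bar> \<le> 2 * C * \<epsilon>" .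
    have "(LINT s:{0..t}|lebesgue. g s) - (LINT s:{0..t}|lebesgue. LINT x|m s. \<phi> x) = (LINT s:{0..t}|lebesgue. g s - (LINT x|m s. \<phi> x))"
      using ig im by (rule set_integral_diff(2)[symmetric])
    also have "norm \<dots> \<le> e * (t - 0)"
      using t osc_g by (intro norm_set_integral_le borel_measurable_diff gm measurable_kernel_integral[OF m[unfolded kernels_def] \<phi>m]) auto
    finally have 2: "\<bar>(LINT s:{0..t}|lebesgue. g s) - (LINT s:{0..t}|lebesgue. LINT x|m s. \<phi> x)\<bar> \<le> e * t" by simp
    show "\<bar>(LINT s:{0..t}|lebesgue. \<phi> (w s)) - (LINT s:{0..t}|lebesgue. LINT a|m s. \<phi> a)\<bar> \<le> 2 * C * \<epsilon> + e * t"
      using 1 2 by linarith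
  qed
qed

theorem chattering:
  fixes K :: "'a::euclidean_space set"
  assumes K: "compact K" "K \<noteq> {}" and m: "m \<in> kernels K" and K0: "K0 \<subseteq> K" "K \<subseteq> closure K0"
  obtains w :: "nat \<Rightarrow> real \<Rightarrow> 'a" where "\<And>n. w n \<in> borel_measurable borel" "\<And>n. finite (range (w n))" "\<And>n. range (w n) \<subseteq> K0"
    "young_conv K (\<lambda>n s. return (restrict_space borel K) (w n s)) m"
proof -
  have "\<exists>w. w \<in> borel_measurable borel \<and> finite (range w) \<and> range w \<subseteq> K0 \<and>
    (\<forall>\<phi> C e t. continuous_on K \<phi> \<longrightarrow> (\<forall>a. a \<in> K \<longrightarrow> \<bar>\<phi> a\<bar> \<le> C) \<longrightarrow>
      (\<forall>a b. a \<in> K \<longrightarrow> b \<in> K \<longrightarrow> dist a b < 1 / real (Suc n) \<longrightarrow> \<bar>\<phi> a - \<phi> b\<bar> \<le> e) \<longrightarrow> 0 \<le> t \<longrightarrow>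
      \<bar>(LINT s:{0..t}|lebesgue. \<phi> (w s)) - (LINT s:{0..t}|lebesgue. LINT a|m s. \<phi> a)\<bar> \<le> 2 * C * (1 / real (Suc n)) + e * t)" for n
    by (rule chattering_step[OF K m K0, of "1 / real (Suc n)" "1 / real (Suc n)"]) (simp, simp, blast)
  then obtain w where w: "\<And>n. w n \<in> borel_measurable borel" "\<And>n. finite (range (w n))" "\<And>n. range (w n) \<subseteq> K0"
    and approx: "\<And>n \<phi> C e t. continuous_on K \<phi> \<Longrightarrow> (\<And>a. a \<in> K \<Longrightarrow> \<bar>\<phi> a\<bar> \<le> C) \<Longrightarrow>
      (\<And>a b. a \<in> K \<Longrightarrow> b \<in> K \<Longrightarrow> dist a b < 1 / real (Suc n) \<Longrightarrow> \<bar>\<phi> a - \<phi> b\<bar> \<le> e) \<Longrightarrow> 0 \<le> t \<Longrightarrow>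
      \<bar>(LINT s:{0..t}|lebesgue. \<phi> (w n s)) - (LINT s:{0..t}|lebesgue. LINT a|m s. \<phi> a)\<bar> \<le> 2 * C * (1 / real (Suc n)) + e * t"
    by metis
  have "young_conv K (\<lambda>n s. return (restrict_space borel K) (w n s)) m"
    unfolding young_conv_def
  proof (intro allI impI)
    fix \<phi> :: "'a \<Rightarrow> real" and t :: real assume \<phi>: "continuous_on K \<phi>" and t: "0 \<le> t"
    obtain C where C: "0 < C" "\<And>a. a \<in> K \<Longrightarrow> norm (\<phi> a) \<le> C" using compact_bounded_fun[OF K(1) \<phi>] by blast
    have eq: "(LINT a|return (restrict_space borel K) (w n s). \<phi> a) = \<phi> (w n s)" for n s
      using w(3)[of n] K0(1) borel_measurable_continuous_on_restrict[OF \<phi>]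
      by (intro integral_return) (auto simp: space_restrict_space)
    show "(\<lambda>n. LINT s:{0..t}|lebesgue. LINT a|return (restrict_space borel K) (w n s). \<phi> a) \<longlonglongrightarrow> (LINT s:{0..t}|lebesgue. LINT a|m s. \<phi> a)"
      unfolding eq
    proof (rule LIMSEQ_I)
      fix e :: real assume e: "0 < e"
      define e' where "e' = e / (2 * (t + 1))"
      have "0 < e'" using e t by (simp add: e'_def)
      then obtain d where d: "0 < d" "\<And>x y. x \<in> K \<Longrightarrow> y \<in> K \<Longrightarrow> dist y x < d \<Longrightarrow> dist (\<phi> y) (\<phi> x) < e'"
        using compact_uniformly_continuous[OF \<phi> K(1)] unfolding uniformly_continuous_on_def by metis
      have "min d (e / (4 * C)) > 0" using d(1) e C(1) by simp
      then obtain n0 where n0: "1 / real (Suc n0) < min d (e / (4 * C))" using nat_approx_posE by blast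
      have "norm ((LINT s:{0..t}|lebesgue. \<phi> (w n s)) - (LINT s:{0..t}|lebesgue. LINT a|m s. \<phi> a)) < e" if "n \<ge> n0" for n
      proof -
        have "1 / real (Suc n) \<le> 1 / real (Suc n0)" using that by (intro divide_left_mono) auto
        then have n: "1 / real (Suc n) < d" "1 / real (Suc n) < e / (4 * C)" using n0 by auto
        have "\<bar>(LINT s:{0..t}|lebesgue. \<phi> (w n s)) - (LINT s:{0..t}|lebesgue. LINT a|m s. \<phi> a)\<bar> \<le> 2 * C * (1 / real (Suc n)) + e' * t"
        proof (rule approx[OF \<phi> _ _ t])
          fix a b assume "a \<in> K" "b \<in> K" "dist a b < 1 / real (Suc n)"
          then show "\<bar>\<phi> a - \<phi> b\<bar> \<le> e'" using d(2)[of b a] n(1) by (simp add: dist_real_def)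
        qed (use C in auto)
        moreover have "2 * C * (1 / real (Suc n)) < e / 2"
        proof -
          have "2 * C * (1 / real (Suc n)) < 2 * C * (e / (4 * C))" using n(2) C(1) by (intro mult_strict_left_mono) auto
          also have "\<dots> = e / 2" using C(1) by simp
          finally show ?thesis .
        qed
        moreover have "e' * t \<le> e / 2"
        proof -
          have "e' * t \<le> e' * (t + 1)" using \<open>0 < e'\<close> by simp
          also have "\<dots> = e / 2" using t by (simp add: e'_def field_simps)
          finally show ?thesis .
        qed
        ultimately show ?thesis unfolding real_norm_def by linarith
      qed
      then show "\<exists>no. \<forall>n\<ge>no. norm ((LINT s:{0..t}|lebesgue. \<phi> (w n s)) - (LINT s:{0..t}|lebesgue. LINT a|m s. \<phi> a)) < e" by blast
    qed
  qed
  with w show ?thesis by (rule that)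
qed

section \<open>Change of time\<close>

text \<open>The lower bound \<open>\<delta>\<close> makes \<open>S\<close> strictly increasing and
  unbounded, with an inverse of Lipschitz constant \<open>1/\<delta>\<close>. It is used with
  \<open>\<rho> = 1 + |\<alpha>|^q\<close> from original to compactified time, and with
  \<open>\<rho> = 1 - |w|^q\<close> for finitely valued \<open>w\<close> in the opposite
  direction.\<close>

locale time_change =
  fixes \<rho> :: "real \<Rightarrow> real" and \<delta> :: real
  assumes \<rho>_meas[measurable]: "\<rho> \<in> borel_measurable borel"
    and \<delta>: "0 < \<delta>" and \<rho>_ge: "\<And>u. 0 \<le> u \<Longrightarrow> \<delta> \<le> \<rho> u"
    and \<rho>_int: "\<And>t. 0 \<le> t \<Longrightarrow> set_integrable lebesgue {0..t} \<rho>"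
begin

definition S :: "real \<Rightarrow> real" where "S t = (LINT u:{0..t}|lebesgue. \<rho> u)"

definition T :: "real \<Rightarrow> real" where "T s = (SOME t. 0 \<le> t \<and> S t = s)"

lemma S_diff:
  assumes "0 \<le> a" "a \<le> b"
  shows "\<delta> * (b - a) \<le> S b - S a"
proof -
  have "S b = S a + (LINT u:{a..b}|lebesgue. \<rho> u)"
    unfolding S_def using assms by (intro set_integral_Icc_combine \<rho>_int) auto
  moreover have "(LINT u:{a..b}|lebesgue. \<delta>) \<le> (LINT u:{a..b}|lebesgue. \<rho> u)"
  proof (rule set_integral_mono)
    show "set_integrable lebesgue {a..b} (\<lambda>u. \<delta>)"
      using assms by (intro set_integrable_halfline_Icc[where C="\<bar>\<delta>\<bar>"]) auto
    show "set_integrable lebesgue {a..b} \<rho>"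
      using assms by (intro set_integrable_subset[OF \<rho>_int[of b]]) auto
  qed (use assms \<rho>_ge in auto)
  moreover have "(LINT u:{a..b}|lebesgue. \<delta>) = \<delta> * (b - a)" using assms by (simp add: set_lebesgue_integral_def)
  ultimately show ?thesis by simp
qed

lemma S_neg: "t < 0 \<Longrightarrow> S t = 0"
  by (simp add: S_def set_lebesgue_integral_def)

lemma S_0 [simp]: "S 0 = 0"
  unfolding S_def set_lebesgue_integral_def
  by (intro integral_eq_zero_AE AE_I'[of "{0}"]) (auto simp: indicator_def)

lemma S_strict: "0 \<le> a \<Longrightarrow> a < b \<Longrightarrow> S a < S b"
  using S_diff[of a b] \<delta> mult_pos_pos[of \<delta> "b - a"] by linarith

lemma S_le_iff: "0 \<le> a \<Longrightarrow> 0 \<le> b \<Longrightarrow> S a \<le> S b \<longleftrightarrow> a \<le> b"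
  using S_strict[of a b] S_strict[of b a] by (cases a b rule: linorder_cases) auto

lemma S_nonneg: "0 \<le> S t"
proof (cases "0 \<le> t")
  case True then show ?thesis using S_le_iff[of 0 t] by simp
qed (simp add: S_neg)

lemma S_mono: "mono S"
proof (rule monoI)
  fix a b :: real assume "a \<le> b"
  then show "S a \<le> S b"
  proof (cases "0 \<le> a")
    case True then show ?thesis using S_le_iff[of a b] \<open>a \<le> b\<close> by simp
  qed (use S_nonneg in \<open>simp add: S_neg\<close>)
qed

lemma S_meas [measurable]: "S \<in> borel_measurable borel"
  by (rule borel_measurable_mono[OF S_mono])

lemma S_cont: "continuous_on {0..} S"
  unfolding S_def[abs_def] by (rule continuous_on_indefinite_integral[OF \<rho>_int])

lemma T_props:
  assumes "0 \<le> s"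
  shows "0 \<le> T s" "S (T s) = s"
proof -
  have "\<exists>t\<ge>0. t \<le> s / \<delta> \<and> S t = s"
  proof (rule IVT')
    show "s \<le> S (s / \<delta>)" using S_diff[of 0 "s / \<delta>"] assms \<delta> by simp
    show "continuous_on {0..s / \<delta>} S" by (rule continuous_on_subset[OF S_cont]) auto
  qed (use assms \<delta> in auto)
  then have "\<exists>t. 0 \<le> t \<and> S t = s" by blast
  from someI_ex[OF this] show "0 \<le> T s" "S (T s) = s" unfolding T_def by blast+
qed

lemma T_S: "0 \<le> t \<Longrightarrow> T (S t) = t"
  using T_props[OF S_nonneg, of t] S_le_iff[of t "T (S t)"] S_le_iff[of "T (S t)" t] by simp

lemma T_cont: "continuous_on {0..} T"
proof -
  have "dist (T x) (T y) \<le> (1 / \<delta>) * dist x y" if "x \<in> {0..}" "y \<in> {0..}" for x y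
  proof -
    have *: "\<bar>T b - T a\<bar> \<le> (1 / \<delta>) * \<bar>b - a\<bar>" if "0 \<le> a" "a \<le> b" for a b
    proof -
      have "T a \<le> T b" using S_le_iff[of "T a" "T b"] T_props[of a] T_props[of b] that by simp
      moreover from this have "\<delta> * (T b - T a) \<le> b - a"
        using S_diff[of "T a" "T b"] T_props[of a] T_props[of b] that by simp
      ultimately show ?thesis using \<delta> that by (simp add: field_simps)
    qed
    show ?thesis
      using *[of x y] *[of y x] that unfolding dist_real_def by (cases "x \<le> y") (auto simp: abs_minus_commute)
  qed
  then have "(1 / \<delta>)-lipschitz_on {0..} T" using \<delta> by (intro lipschitz_onI) auto
  then show ?thesis by (rule lipschitz_on_continuous_on)
qed

definition weighted :: "real measure" where
  "weighted = density lborel (\<lambda>u. ennreal (indicator {0..} u * \<rho> u))"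

lemma weighted_atMost: "emeasure weighted {..t} = ennreal (S t)"
proof -
  have "emeasure weighted {..t} = (\<integral>\<^sup>+u. ennreal (indicator {0..} u * \<rho> u) * indicator {..t} u \<partial>lborel)"
    unfolding weighted_def by (subst emeasure_density) auto
  also have "\<dots> = (\<integral>\<^sup>+u. ennreal (indicator {0..t} u * \<rho> u) \<partial>lborel)"
    by (intro nn_integral_cong) (auto simp: indicator_def)
  also have "\<dots> = ennreal (S t)"
  proof (cases "0 \<le> t")
    case True
    have m: "(\<lambda>u. indicator {0..t} u * \<rho> u) \<in> borel_measurable lborel" by measurable
    have "integrable lborel (\<lambda>u. indicator {0..t} u * \<rho> u)"
      using \<rho>_int[OF True] unfolding set_integrable_def by (simp add: integrable_completion[OF m])
    moreover have "0 \<le> indicator {0..t} u * \<rho> u" for u using \<rho>_ge[of u] \<delta> by (auto simp: indicator_def)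
    ultimately have "(\<integral>\<^sup>+u. ennreal (indicator {0..t} u * \<rho> u) \<partial>lborel) = ennreal (LINT u|lborel. indicator {0..t} u * \<rho> u)"
      by (intro nn_integral_eq_integral) auto
    also have "(LINT u|lborel. indicator {0..t} u * \<rho> u) = S t"
      unfolding S_def set_lebesgue_integral_def using integral_completion[OF m] by simp
    finally show ?thesis .
  qed (simp add: S_neg)
  finally show ?thesis .
qed

text \<open>The substitution rule in measure form: the image of \<open>\<rho> u du\<close> under
  \<open>S\<close> is Lebesgue measure on the half-line. For \<open>c \<ge> 0\<close> the preimage
  of \<open>{..c}\<close> is \<open>{..T c}\<close>, and these sets generate; no derivative of
  \<open>S\<close> enters.\<close>

lemma distr_weighted: "distr weighted borel S = density lborel (indicator {0..})"
proof (rule measure_eqI_generator_eq[where \<Omega>=UNIV and E="range (\<lambda>a. {..a::real})" and A="\<lambda>i. {..real i}"])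
  have g: "emeasure (distr weighted borel S) {..c} = (if 0 \<le> c then ennreal c else 0)" for c
  proof -
    have "emeasure (distr weighted borel S) {..c} = emeasure weighted (S -` {..c} \<inter> space weighted)"
      by (intro emeasure_distr) (auto simp: weighted_def)
    also have "S -` {..c} \<inter> space weighted = (if 0 \<le> c then {..T c} else {})"
    proof (cases "0 \<le> c")
      case True
      have "S u \<le> c \<longleftrightarrow> u \<le> T c" for u
      proof (cases "0 \<le> u")
        case True then show ?thesis using S_le_iff[of u "T c"] T_props[OF \<open>0 \<le> c\<close>] by simp
      next
        case False then show ?thesis using T_props[OF \<open>0 \<le> c\<close>] \<open>0 \<le> c\<close> by (simp add: S_neg)
      qed
      then show ?thesis using True by (auto simp: weighted_def)
    next
      case False
      then have "\<not> S u \<le> c" for u using S_nonneg[of u] by linarith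
      then show ?thesis using False by auto
    qed
    also have "emeasure weighted \<dots> = (if 0 \<le> c then ennreal c else 0)"
      using T_props(2)[of c] by (simp add: weighted_atMost)
    finally show ?thesis .
  qed
  show "Int_stable (range (\<lambda>a. {..a::real}))" by (auto simp: Int_stable_def)
  show "sets (distr weighted borel S) = sigma_sets UNIV (range (\<lambda>a. {..a}))"
    "sets (density lborel (indicator {0..})) = sigma_sets UNIV (range (\<lambda>a. {..a::real}))"
    by (simp_all add: borel_eq_atMost)
  show "emeasure (distr weighted borel S) {..real i} \<noteq> \<infinity>" for i by (simp add: g)
  show "(\<Union>i. {..real i}) = UNIV" using real_arch_simple by auto
  fix X :: "real set" assume "X \<in> range (\<lambda>a. {..a})"
  then obtain c where X: "X = {..c}" by auto
  have "emeasure (density lborel (indicator {0..})) {..c} = (\<integral>\<^sup>+u. indicator {0..} u * indicator {..c} u \<partial>lborel)"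
    by (subst emeasure_density) auto
  also have "\<dots> = (\<integral>\<^sup>+u. indicator {0..c} u \<partial>lborel)"
    by (intro nn_integral_cong) (auto simp: indicator_def)
  also have "\<dots> = (if 0 \<le> c then ennreal c else 0)" by simp
  finally show "emeasure (distr weighted borel S) X = emeasure (density lborel (indicator {0..})) X"
    unfolding X g by simp
qed auto

lemma indicator_halfline_borel:
  fixes h :: "real \<Rightarrow> 'c::{banach,second_countable_topology}"
  assumes "h \<in> borel_measurable (restrict_space borel {0..})"
  shows "(\<lambda>s. indicator {0..t} s *\<^sub>R h s) \<in> borel_measurable borel"
proof -
  have "set_borel_measurable borel {0..} h"
    using assms unfolding set_borel_measurable_def by (subst (asm) borel_measurable_restrict_space_iff) auto
  then have "set_borel_measurable borel {0..t} h" by (rule set_borel_measurable_subset) auto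
  then show ?thesis by (simp add: set_borel_measurable_def)
qed

text \<open>Density and image rules applied to \<open>distr_weighted\<close>. Borel measurability of
  \<open>h\<close> makes \<open>h o S\<close> measurable. Integrability is stated as an equivalence
  because solutions are carried over in both directions.\<close>

lemma change_of_variables:
  fixes h :: "real \<Rightarrow> 'c::euclidean_space"
  assumes h: "h \<in> borel_measurable (restrict_space borel {0..})" and t: "0 \<le> t"
  shows "set_integrable lebesgue {0..S t} h \<longleftrightarrow> set_integrable lebesgue {0..t} (\<lambda>u. \<rho> u *\<^sub>R h (S u))" (is ?int)
    and "(LINT s:{0..S t}|lebesgue. h s) = (LINT u:{0..t}|lebesgue. \<rho> u *\<^sub>R h (S u))" (is ?eq)
proof -
  let ?H = "\<lambda>s. indicator {0..S t} s *\<^sub>R h s"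
  have H[measurable]: "?H \<in> borel_measurable borel" by (rule indicator_halfline_borel[OF h])
  have HS: "(\<lambda>u. ?H (S u)) \<in> borel_measurable borel" using measurable_compose[OF S_meas H] .
  have eq: "(indicator {0..} u * \<rho> u) *\<^sub>R ?H (S u) = indicator {0..t} u *\<^sub>R (\<rho> u *\<^sub>R h (S u))" for u
    using S_le_iff[of u t] t S_nonneg[of u] by (auto simp: indicator_def)
  have eq': "indicator {0..} s *\<^sub>R ?H s = ?H s" for s :: real by (auto simp: indicator_def)
  have m2: "(\<lambda>u. indicator {0..t} u *\<^sub>R (\<rho> u *\<^sub>R h (S u))) \<in> borel_measurable lborel"
    unfolding eq[symmetric] using HS by measurable
  have dens: "density lborel (indicator {0..}) = density lborel (\<lambda>s::real. ennreal (indicator {0..} s))"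
    by (intro density_cong) (auto simp: indicator_def)
  have nn: "0 \<le> indicator {0..} u * \<rho> u" for u using \<rho>_ge[of u] \<delta> by (auto simp: indicator_def)
  have "integrable lborel ?H \<longleftrightarrow> integrable (density lborel (\<lambda>s::real. ennreal (indicator {0..} s))) ?H"
  proof -
    have "integrable (density lborel (\<lambda>s::real. ennreal (indicator {0..} s))) ?H \<longleftrightarrow> integrable lborel (\<lambda>s. indicator {0..} s *\<^sub>R ?H s)"
      using H by (intro integrable_density) auto
    then show ?thesis unfolding eq' ..
  qed
  also have "\<dots> \<longleftrightarrow> integrable (distr weighted borel S) ?H" unfolding distr_weighted dens ..
  also have "\<dots> \<longleftrightarrow> integrable weighted (\<lambda>u. ?H (S u))"
    by (intro integrable_distr_eq) (auto simp: weighted_def)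
  also have "\<dots> \<longleftrightarrow> integrable lborel (\<lambda>u. (indicator {0..} u * \<rho> u) *\<^sub>R ?H (S u))"
    unfolding weighted_def using nn HS by (intro integrable_density) auto
  finally show ?int
    unfolding set_integrable_def eq using integrable_completion[OF m2] integrable_completion[of ?H lborel] H by simp
  have "(LINT s|lborel. ?H s) = (LINT s|density lborel (\<lambda>s::real. ennreal (indicator {0..} s)). ?H s)"
  proof -
    have "(LINT s|density lborel (\<lambda>s::real. ennreal (indicator {0..} s)). ?H s) = (LINT s|lborel. indicator {0..} s *\<^sub>R ?H s)"
      using H by (intro integral_density) auto
    then show ?thesis unfolding eq' ..
  qed
  also have "\<dots> = (LINT s|distr weighted borel S. ?H s)" unfolding distr_weighted dens ..
  also have "\<dots> = (LINT u|weighted. ?H (S u))"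
    by (intro integral_distr) (auto simp: weighted_def)
  also have "\<dots> = (LINT u|lborel. (indicator {0..} u * \<rho> u) *\<^sub>R ?H (S u))"
    unfolding weighted_def using nn HS by (intro integral_density) auto
  finally show ?eq
    unfolding set_lebesgue_integral_def eq using integral_completion[OF m2] integral_completion[of ?H lborel] H by simp
qed

lemma nn_change_of_variables:
  fixes h :: "real \<Rightarrow> real"
  assumes h: "h \<in> borel_measurable (restrict_space borel {0..})" and t: "0 \<le> t"
  shows "(\<integral>\<^sup>+s\<in>{0..S t}. ennreal (h s) \<partial>lebesgue) = (\<integral>\<^sup>+u\<in>{0..t}. ennreal (\<rho> u * h (S u)) \<partial>lebesgue)"
proof -
  let ?H = "\<lambda>s. ennreal (indicator {0..S t} s *\<^sub>R h s)"
  have H[measurable]: "?H \<in> borel_measurable borel" using measurable_compose[OF indicator_halfline_borel[OF h] measurable_ennreal] .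
  have HS: "(\<lambda>u. ?H (S u)) \<in> borel_measurable borel" using measurable_compose[OF S_meas H] .
  have "(\<integral>\<^sup>+s\<in>{0..S t}. ennreal (h s) \<partial>lebesgue) = (\<integral>\<^sup>+s. ?H s \<partial>lebesgue)"
    by (intro nn_integral_cong) (auto simp: indicator_def)
  also have "\<dots> = (\<integral>\<^sup>+s. ?H s \<partial>lborel)" using H by (subst nn_integral_completion) auto
  also have "\<dots> = (\<integral>\<^sup>+s. indicator {0..} s * ?H s \<partial>lborel)"
    by (intro nn_integral_cong) (auto simp: indicator_def)
  also have "\<dots> = (\<integral>\<^sup>+s. ?H s \<partial>density lborel (indicator {0..}))"
  proof (rule nn_integral_density[symmetric])
    show "?H \<in> borel_measurable lborel" unfolding measurable_lborel2 by (rule H)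
  qed simp
  also have "\<dots> = (\<integral>\<^sup>+s. ?H s \<partial>distr weighted borel S)" unfolding distr_weighted ..
  also have "\<dots> = (\<integral>\<^sup>+u. ?H (S u) \<partial>weighted)"
  proof (rule nn_integral_distr)
    show "?H \<in> borel_measurable (distr weighted borel S)" unfolding measurable_distr_eq1 by (rule H)
  qed (simp add: weighted_def)
  also have "\<dots> = (\<integral>\<^sup>+u. ennreal (indicator {0..} u * \<rho> u) * ?H (S u) \<partial>lborel)"
    unfolding weighted_def using HS by (intro nn_integral_density) auto
  also have "\<dots> = (\<integral>\<^sup>+u. ennreal (indicator {0..} u * \<rho> u) * ?H (S u) \<partial>lebesgue)"
    by (rule nn_integral_completion[symmetric])
  also have "\<dots> = (\<integral>\<^sup>+u\<in>{0..t}. ennreal (\<rho> u * h (S u)) \<partial>lebesgue)"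
  proof (intro nn_integral_cong)
    fix u :: real
    show "ennreal (indicator {0..} u * \<rho> u) * ?H (S u) = ennreal (\<rho> u * h (S u)) * indicator {0..t} u"
    proof (cases "0 \<le> u")
      case True
      then have "0 \<le> \<rho> u" using \<rho>_ge[of u] \<delta> by linarith
      then show ?thesis using S_le_iff[of u t] t True S_nonneg[of u] by (auto simp: indicator_def ennreal_mult')
    qed simp
  qed
  finally show ?thesis .
qed

text \<open>The substitution \<open>s = S u\<close> in the integral equation;
  \<open>solution_fast\<close> is the converse, by composition with \<open>T\<close>.\<close>

lemma solution_slow:
  fixes g g' :: "real \<Rightarrow> 'b::euclidean_space \<Rightarrow> 'b"
  assumes meas: "\<And>y. continuous_on {0..} y \<Longrightarrow> (\<lambda>s. g' s (y s)) \<in> borel_measurable (restrict_space borel {0..})"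
    and g: "\<And>u z. 0 \<le> u \<Longrightarrow> \<rho> u *\<^sub>R g' (S u) z = g u z"
    and y: "solution g' x y"
  shows "solution g x (restrict (\<lambda>u. y (S u)) {0..})"
  unfolding solution_def
proof (intro conjI allI impI)
  let ?y = "restrict (\<lambda>u. y (S u)) {0..}"
  have m: "(\<lambda>s. g' s (y s)) \<in> borel_measurable (restrict_space borel {0..})"
    by (rule meas[OF solution_continuous[OF y]])
  fix t :: real assume t: "0 \<le> t"
  have eq: "\<rho> u *\<^sub>R g' (S u) (y (S u)) = g u (?y u)" if "u \<in> {0..t}" for u using g[of u "y (S u)"] that by simp
  have "set_integrable lebesgue {0..S t} (\<lambda>s. g' s (y s))" using y S_nonneg[of t] by (simp add: solution_def)
  then have "set_integrable lebesgue {0..t} (\<lambda>u. \<rho> u *\<^sub>R g' (S u) (y (S u)))" by (simp add: change_of_variables(1)[OF m t])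
  then show "set_integrable lebesgue {0..t} (\<lambda>u. g u (?y u))"
    unfolding set_integrable_def by (rule Bochner_Integration.integrable_cong[THEN iffD1, rotated 2]) (auto simp: indicator_def g)
  have "?y t = x + (LINT s:{0..S t}|lebesgue. g' s (y s))"
    using y S_nonneg[of t] t by (simp add: solution_def)
  also have "(LINT s:{0..S t}|lebesgue. g' s (y s)) = (LINT u:{0..t}|lebesgue. g u (?y u))"
    unfolding change_of_variables(2)[OF m t] using eq by (intro set_lebesgue_integral_cong) auto
  finally show "?y t = x + (LINT u:{0..t}|lebesgue. g u (?y u))" .
qed simp

lemma solution_fast:
  fixes g g' :: "real \<Rightarrow> 'b::euclidean_space \<Rightarrow> 'b"
  assumes meas: "\<And>y. continuous_on {0..} y \<Longrightarrow> (\<lambda>s. g' s (y s)) \<in> borel_measurable (restrict_space borel {0..})"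
    and g: "\<And>u z. 0 \<le> u \<Longrightarrow> \<rho> u *\<^sub>R g' (S u) z = g u z"
    and y: "solution g x y"
  shows "solution g' x (restrict (\<lambda>s. y (T s)) {0..})"
  unfolding solution_def
proof (intro conjI allI impI)
  let ?y = "restrict (\<lambda>s. y (T s)) {0..}"
  have "continuous_on {0..} (\<lambda>s. y (T s))"
    by (rule continuous_on_compose2[OF solution_continuous[OF y] T_cont]) (use T_props in auto)
  then have "continuous_on {0..} ?y" by (rule continuous_on_eq) simp
  then have m: "(\<lambda>s. g' s (?y s)) \<in> borel_measurable (restrict_space borel {0..})" by (rule meas)
  fix s :: real assume s: "0 \<le> s"
  define t where "t = T s"
  have t: "0 \<le> t" "S t = s" using T_props[OF s] by (auto simp: t_def)
  have eq: "\<rho> u *\<^sub>R g' (S u) (?y (S u)) = g u (y u)" if "0 \<le> u" for u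
    using g[OF that, of "y u"] T_S[OF that] S_nonneg[of u] by simp
  have "set_integrable lebesgue {0..t} (\<lambda>u. g u (y u))" using y t by (simp add: solution_def)
  moreover have "indicator {0..t} u *\<^sub>R (\<rho> u *\<^sub>R g' (S u) (?y (S u))) = indicator {0..t} u *\<^sub>R g u (y u)" for u :: real
  proof (cases "u \<in> {0..t}")
    case True
    then have "\<rho> u *\<^sub>R g' (S u) (?y (S u)) = g u (y u)" by (intro eq) simp
    then show ?thesis by (simp only:)
  qed simp
  ultimately have "set_integrable lebesgue {0..t} (\<lambda>u. \<rho> u *\<^sub>R g' (S u) (?y (S u)))"
    unfolding set_integrable_def by (simp only:)
  then show "set_integrable lebesgue {0..s} (\<lambda>s. g' s (?y s))" using change_of_variables(1)[OF m t(1)] t(2) by simp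
  have "?y s = x + (LINT u:{0..t}|lebesgue. g u (y u))"
    using y t s by (simp add: solution_def t_def)
  also have "(LINT u:{0..t}|lebesgue. g u (y u)) = (LINT u:{0..t}|lebesgue. \<rho> u *\<^sub>R g' (S u) (?y (S u)))"
  proof (intro set_lebesgue_integral_cong allI impI)
    fix u assume "u \<in> {0..t}"
    then show "g u (y u) = \<rho> u *\<^sub>R g' (S u) (?y (S u))" by (intro eq[symmetric]) simp
  qed simp
  also have "\<dots> = (LINT s:{0..s}|lebesgue. g' s (?y s))"
    using change_of_variables(2)[OF m t(1)] t(2) by simp
  finally show "?y s = x + (LINT s:{0..s}|lebesgue. g' s (?y s))" .
qed simp

text \<open>Composition with \<open>S\<close> and composition with \<open>T\<close> are mutually
  inverse maps between the two sets of solutions, thanks to extensionality. In the applications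
  unique solvability is known for the compactified equation and is carried to the original
  one.\<close>

lemma solution_unique_transfer:
  fixes g g' :: "real \<Rightarrow> 'b::euclidean_space \<Rightarrow> 'b"
  assumes meas: "\<And>y. continuous_on {0..} y \<Longrightarrow> (\<lambda>s. g' s (y s)) \<in> borel_measurable (restrict_space borel {0..})"
    and g: "\<And>u z. 0 \<le> u \<Longrightarrow> \<rho> u *\<^sub>R g' (S u) z = g u z"
  shows "(\<exists>!y. solution g' x y) \<longleftrightarrow> (\<exists>!y. solution g x y)"
    and "\<exists>!y. solution g x y \<Longrightarrow> 0 \<le> u \<Longrightarrow> (THE y. solution g' x y) (S u) = (THE y. solution g x y) u"
proof -
  let ?s = "\<lambda>y. restrict (\<lambda>u. y (S u)) {0..}" and ?f = "\<lambda>y. restrict (\<lambda>s. y (T s)) {0..}"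
  have slow: "solution g x (?s y)" if "solution g' x y" for y using solution_slow[of g' g, OF meas g that] .
  have fast: "solution g' x (?f y)" if "solution g x y" for y using solution_fast[of g' g, OF meas g that] .
  have fs: "?f (?s y) = y" if "solution g' x y" for y
    using that T_props by (intro extensionalityI[of _ "{0..}"]) (auto simp: solution_def)
  have sf: "?s (?f y) = y" if "solution g x y" for y
    using that T_S S_nonneg by (intro extensionalityI[of _ "{0..}"]) (auto simp: solution_def)
  show iff: "(\<exists>!y. solution g' x y) \<longleftrightarrow> (\<exists>!y. solution g x y)"
    using slow fast fs sf by metis
  assume *: "\<exists>!y. solution g x y" and u: "0 \<le> u"
  have y: "solution g x (THE y. solution g x y)" by (rule theI'[OF *])
  have y': "solution g' x (THE y. solution g' x y)" by (rule theI'[OF iff[THEN iffD2, OF *]])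
  have "?s (THE y. solution g' x y) = (THE y. solution g x y)" by (rule the1_equality[symmetric], rule *, rule slow[OF y'])
  then have "?s (THE y. solution g' x y) u = (THE y. solution g x y) u" by (rule fun_cong)
  moreover have "?s (THE y. solution g' x y) u = (THE y. solution g' x y) (S u)"
    by (rule restrict_apply') (use u in simp)
  ultimately show "(THE y. solution g' x y) (S u) = (THE y. solution g x y) u" by (rule trans[OF sym, rotated])
qed

end

section \<open>The relaxation theorem\<close>

context compact_problem
begin

lemma solution_dirac_iff:
  assumes w: "\<And>s. 0 \<le> s \<Longrightarrow> w s \<in> K"
  shows "solution (\<lambda>s z. relax F z (return (restrict_space borel K) (w s))) x y \<longleftrightarrow> solution (\<lambda>s z. F z (w s)) x y"
  using w borel_measurable_continuous_on_restrict[OF F_sec]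
  by (intro solution_cong) (auto simp: relax_def integral_return space_restrict_space)

lemma trajectory_dirac:
  assumes w: "\<And>s. 0 \<le> s \<Longrightarrow> w s \<in> K"
  shows "trajectory (relax F) x (\<lambda>s. return (restrict_space borel K) (w s)) = trajectory F x w"
proof -
  have "solution (\<lambda>s z. relax F z (return (restrict_space borel K) (w s))) x = solution (\<lambda>s z. F z (w s)) x"
    by (rule ext) (rule solution_dirac_iff, rule w)
  then show ?thesis unfolding trajectory_def by (simp only:)
qed

lemma cost_dirac:
  assumes w: "\<And>s. 0 \<le> s \<Longrightarrow> w s \<in> K" and I: "I \<subseteq> {0..}"
  shows "cost (relax F) (relax L) I x (\<lambda>s. return (restrict_space borel K) (w s)) = cost F L I x w"
proof -
  have tr: "trajectory (relax F) x (\<lambda>s. return (restrict_space borel K) (w s)) = trajectory F x w"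
    by (rule trajectory_dirac) (rule w)
  show ?thesis
    unfolding cost_def tr
  proof (intro nn_integral_cong)
    fix s
    show "ennreal (relax L (trajectory F x w s) (return (restrict_space borel K) (w s))) * indicator I s =
      ennreal (L (trajectory F x w s) (w s)) * indicator I s"
    proof (cases "s \<in> I")
      case True
      then have "w s \<in> K" using w I by auto
      then have "relax L (trajectory F x w s) (return (restrict_space borel K) (w s)) = L (trajectory F x w s) (w s)"
        unfolding relax_def using borel_measurable_continuous_on_restrict[OF L_sec]
        by (intro integral_return) (auto simp: space_restrict_space)
      then show ?thesis by simp
    qed simp
  qed
qed

lemma solution_dirac_ex1:
  assumes "w \<in> restrict_space borel {0..} \<rightarrow>\<^sub>M restrict_space borel K"
  shows "\<exists>!y. solution (\<lambda>s z. F z (w s)) x y"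
proof -
  have w: "w s \<in> K" if "0 \<le> s" for s
    using measurable_space[OF assms, of s] that by (simp add: space_restrict_space)
  have iff: "solution (\<lambda>s z. relax F z (return (restrict_space borel K) (w s))) x y \<longleftrightarrow> solution (\<lambda>s z. F z (w s)) x y" for y
    by (rule solution_dirac_iff) (rule w)
  show ?thesis
    using traj_solution[OF dirac_kernel[OF assms], of x] traj_unique[OF dirac_kernel[OF assms], of x]
    unfolding iff by blast
qed

lemma kernels_nonempty: "kernels K \<noteq> {}"
proof -
  obtain a where "a \<in> K" using K(2) by blast
  then have "(\<lambda>s::real. a) \<in> restrict_space borel {0..} \<rightarrow>\<^sub>M restrict_space borel K"
    by (intro measurable_const) (simp add: space_restrict_space)
  from dirac_kernel[OF this] show ?thesis by blast
qed

definition "rcost x m = cost (relax F) (relax L) {0..} x m"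
definition "rvalue x = (INF m\<in>kernels K. rcost x m)"

lemma rvalue_le: "m \<in> kernels K \<Longrightarrow> rvalue x \<le> rcost x m"
  unfolding rvalue_def by (rule INF_lower)

text \<open>The interface to the ordinary problem: \<open>V_upper\<close> imitates ordinary controls
  by kernels on the same horizon, \<open>V_lower\<close> compares the value with kernels of finite
  cost. Both the bounded and the unbounded case reduce to these two properties.\<close>

context
  fixes V :: "real \<Rightarrow> 'b \<Rightarrow> ennreal"
  assumes V_upper: "\<And>t x c. 0 < t \<Longrightarrow> V t x < c \<Longrightarrow> \<exists>m\<in>kernels K. ennreal (J x m t) \<le> c"
    and V_lower: "\<And>t x m. 0 < t \<Longrightarrow> m \<in> kernels K \<Longrightarrow> rcost x m < \<top> \<Longrightarrow> V t x \<le> rcost x m"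
begin

lemma Sup_value_le: "(SUP t\<in>{0<..}. V t x) \<le> rvalue x"
  unfolding rvalue_def
proof (intro INF_greatest SUP_least)
  fix m and t :: real assume "m \<in> kernels K" "t \<in> {0<..}"
  then show "V t x \<le> rcost x m" using V_lower[of t m x] by (cases "rcost x m = \<top>") (auto simp: less_top)
qed

text \<open>The \<open>k\<close>-th kernel has cost at most the supremum plus \<open>1/(k+1)\<close>
  on the horizon \<open>k+1\<close>. As costs increase with the horizon, this bound holds on every
  fixed horizon \<open>n\<close> once \<open>k \<ge> n\<close>. If the supremum is infinite, any
  kernel will do.\<close>

lemma optimal_le_Sup: "\<exists>m\<in>kernels K. rcost x m \<le> (SUP t\<in>{0<..}. V t x)"
proof (cases "(SUP t\<in>{0<..}. V t x) = \<top>")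
  case True
  obtain m where "m \<in> kernels K" using kernels_nonempty by blast
  then show ?thesis unfolding True by (intro bexI[of _ m]) simp
next
  case False
  let ?c = "SUP t\<in>{0<..}. V t x"
  have "\<exists>m\<in>kernels K. ennreal (J x m (real (Suc k))) \<le> ?c + ennreal (1 / real (Suc k))" for k
  proof (rule V_upper)
    have "V (real (Suc k)) x \<le> ?c" by (intro SUP_upper) simp
    also have "\<dots> < ?c + ennreal (1 / real (Suc k))" using False by (simp add: less_top ennreal_less_zero_iff)
    finally show "V (real (Suc k)) x < ?c + ennreal (1 / real (Suc k))" .
  qed simp
  then obtain ms where ms: "\<And>k. ms k \<in> kernels K" and le: "\<And>k. ennreal (J x (ms k) (real (Suc k))) \<le> ?c + ennreal (1 / real (Suc k))"
    by metis
  have ev: "\<forall>\<^sub>F k in sequentially. ennreal (J x (ms k) (real n)) \<le> ?c + ennreal e" if e: "0 < e" for n e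
  proof -
    obtain k0 where k0: "1 / real (Suc k0) < e" using e nat_approx_posE by blast
    show ?thesis
    proof (rule eventually_sequentiallyI[of "max n k0"])
      fix k assume k: "max n k0 \<le> k"
      have "ennreal (J x (ms k) (real n)) \<le> ennreal (J x (ms k) (real (Suc k)))"
        using k by (intro ennreal_leI J_mono ms) auto
      also have "\<dots> \<le> ?c + ennreal (1 / real (Suc k))" by (rule le)
      also have "\<dots> \<le> ?c + ennreal e"
      proof (intro add_left_mono ennreal_leI)
        have "1 / real (Suc k) \<le> 1 / real (Suc k0)" using k by (intro divide_left_mono) auto
        then show "1 / real (Suc k) \<le> e" using k0 by linarith
      qed
      finally show "ennreal (J x (ms k) (real n)) \<le> ?c + ennreal e" .
    qed
  qed
  obtain m where "m \<in> kernels K" "cost (relax F) (relax L) {0..} x m \<le> ?c"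
    using relaxed_compactness[of ms "\<lambda>_. x" x ?c, OF ms tendsto_const ev] by blast
  then show ?thesis by (auto simp: rcost_def)
qed

lemma Sup_value_eq: "(SUP t\<in>{0<..}. V t x) = rvalue x"
proof (rule antisym[OF Sup_value_le])
  obtain m where "m \<in> kernels K" "rcost x m \<le> (SUP t\<in>{0<..}. V t x)" using optimal_le_Sup by blast
  then show "rvalue x \<le> (SUP t\<in>{0<..}. V t x)" using rvalue_le order_trans by blast
qed

lemma optimal_exists: "\<exists>m\<in>kernels K. rcost x m = rvalue x"
proof -
  obtain m where m: "m \<in> kernels K" "rcost x m \<le> rvalue x" using optimal_le_Sup[of x] unfolding Sup_value_eq by blast
  moreover have "rvalue x \<le> rcost x m" by (rule rvalue_le[OF m(1)])
  ultimately show ?thesis by (auto intro!: bexI[of _ m])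
qed

end

text \<open>If it failed at \<open>x\<close>, there would be \<open>c\<close> below the value at
  \<open>x\<close> and kernels of cost less than \<open>c\<close> for initial states converging to
  \<open>x\<close>; compactness would then give a kernel of cost at most \<open>c\<close> at
  \<open>x\<close>.\<close>

lemma rvalue_lsc: "lower_semicontinuous rvalue"
  unfolding lower_semicontinuous_def
proof (intro allI, rule ccontr)
  fix x assume "\<not> rvalue x \<le> Liminf (at x) rvalue"
  then obtain c where c: "Liminf (at x) rvalue < c" "c < rvalue x" using dense by (metis not_le)
  have "\<not> (\<forall>\<^sub>F y in at x. c \<le> rvalue y)" using Liminf_bounded[of c rvalue "at x"] c(1) by auto
  then have fr: "\<forall>d>0. \<exists>y. y \<noteq> x \<and> dist y x < d \<and> rvalue y < c"
    unfolding eventually_at by (auto simp: not_le)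
  have "\<exists>y m. dist y x < 1 / real (Suc k) \<and> m \<in> kernels K \<and> rcost y m < c" for k
  proof -
    obtain y where "dist y x < 1 / real (Suc k)" "rvalue y < c" using fr by (metis of_nat_0_less_iff zero_less_Suc zero_less_divide_1_iff)
    then show ?thesis unfolding rvalue_def INF_less_iff by blast
  qed
  then obtain xs ms where xs: "\<And>k. dist (xs k) x < 1 / real (Suc k)" and ms: "\<And>k. ms k \<in> kernels K" and less: "\<And>k. rcost (xs k) (ms k) < c"
    by metis
  have lim: "xs \<longlonglongrightarrow> x"
  proof (rule metric_LIMSEQ_I)
    fix e :: real assume "0 < e"
    then obtain k0 where k0: "1 / real (Suc k0) < e" using nat_approx_posE by blast
    have "dist (xs k) x < e" if "k \<ge> k0" for k
    proof -
      have "1 / real (Suc k) \<le> 1 / real (Suc k0)" using that by (intro divide_left_mono) auto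
      then show ?thesis using xs[of k] k0 by linarith
    qed
    then show "\<exists>no. \<forall>n\<ge>no. dist (xs n) x < e" by blast
  qed
  have ev: "\<forall>\<^sub>F k in sequentially. ennreal (J (xs k) (ms k) (real n)) \<le> c + ennreal e" if "0 < e" for n e
  proof (intro always_eventually allI)
    fix k
    have "ennreal (J (xs k) (ms k) (real n)) \<le> rcost (xs k) (ms k)" unfolding rcost_def by (rule J_le_cost[OF ms])
    also have "\<dots> \<le> c + ennreal e" using less[of k] by (simp add: add_increasing2 less_imp_le)
    finally show "ennreal (J (xs k) (ms k) (real n)) \<le> c + ennreal e" .
  qed
  obtain m where m: "m \<in> kernels K" "cost (relax F) (relax L) {0..} x m \<le> c"
    using relaxed_compactness[of ms xs x c, OF ms lim ev] by blast
  then have "rvalue x \<le> c" using rvalue_le[of m x] unfolding rcost_def by simp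
  with c(2) show False by simp
qed

end

section \<open>Costs under a change of time and under growing horizons\<close>

lemma (in time_change) nn_cost_transfer:
  fixes l' :: "real \<Rightarrow> 'b::euclidean_space \<Rightarrow> real"
  assumes meas: "(\<lambda>s. l' s (Y' s)) \<in> borel_measurable (restrict_space borel {0..})"
    and l: "\<And>u z. 0 \<le> u \<Longrightarrow> \<rho> u * l' (S u) z = l u z"
    and Y: "\<And>u. 0 \<le> u \<Longrightarrow> Y' (S u) = Y u" and t: "0 \<le> t"
  shows "(\<integral>\<^sup>+s\<in>{0..S t}. ennreal (l' s (Y' s)) \<partial>lebesgue) = (\<integral>\<^sup>+u\<in>{0..t}. ennreal (l u (Y u)) \<partial>lebesgue)"
  unfolding nn_change_of_variables[OF meas t]
  by (intro nn_integral_cong) (auto simp: indicator_def Y l)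

lemma borel_measurable_along:
  fixes \<Phi> :: "'b::euclidean_space \<Rightarrow> 'a::euclidean_space \<Rightarrow> 'c::euclidean_space"
  assumes \<Phi>: "continuous_on (UNIV \<times> A) (\<lambda>(x, a). \<Phi> x a)" and y: "continuous_on {0..} y"
    and w: "w \<in> restrict_space borel {0..} \<rightarrow>\<^sub>M restrict_space borel A"
  shows "(\<lambda>s. \<Phi> (y s) (w s)) \<in> borel_measurable (restrict_space borel {0..})"
proof -
  have [measurable]: "y \<in> borel_measurable (restrict_space borel {0..})"
    by (rule borel_measurable_continuous_on_restrict[OF y])
  have wb[measurable]: "w \<in> borel_measurable (restrict_space borel {0..})"
    using w by (rule measurable_restrict_space2_iff[THEN iffD1, THEN conjunct1])
  have "(\<lambda>s. (y s, w s)) \<in> restrict_space borel {0..} \<rightarrow>\<^sub>M restrict_space borel (UNIV \<times> A)"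
  proof (rule measurable_restrict_space2)
    show "(\<lambda>s. (y s, w s)) \<in> space (restrict_space borel {0..}) \<rightarrow> UNIV \<times> A"
      using measurable_space[OF w] by (auto simp: space_restrict_space)
    have "(\<lambda>s. (y s, w s)) \<in> restrict_space borel {0..} \<rightarrow>\<^sub>M borel \<Otimes>\<^sub>M borel" by measurable
    then show "(\<lambda>s. (y s, w s)) \<in> borel_measurable (restrict_space borel {0..})" by (simp add: borel_prod)
  qed
  from measurable_compose[OF this borel_measurable_continuous_on_restrict[OF \<Phi>]] show ?thesis by simp
qed

lemma cost_mono: "I \<subseteq> I' \<Longrightarrow> cost F L I x u \<le> cost F L I' x u"
  unfolding cost_def by (intro nn_integral_mono) (auto simp: indicator_def)

text \<open>Running costs enter as extended nonnegative numbers, so costs and their infima increase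
  with the horizon and the supremum is the limit.\<close>

lemma value_fun_tendsto:
  "((\<lambda>t. value_fun A q f l t x) \<longlongrightarrow> Sigma_fun A q f l x) at_top"
proof (rule order_tendstoI)
  have mono: "value_fun A q f l s x \<le> value_fun A q f l t x" if "s \<le> t" for s t
    unfolding value_fun_def
  proof (rule INF_mono)
    fix m assume "m \<in> controls A q"
    moreover have "cost f l {0..s} x m \<le> cost f l {0..t} x m" using that by (intro cost_mono) auto
    ultimately show "\<exists>n\<in>controls A q. cost f l {0..s} x n \<le> cost f l {0..t} x m" by blast
  qed
  fix a
  show "\<forall>\<^sub>F t in at_top. a < value_fun A q f l t x" if a: "a < Sigma_fun A q f l x"
  proof -
    obtain s where "a < value_fun A q f l s x" using a unfolding Sigma_fun_def less_SUP_iff by blast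
    then have "a < value_fun A q f l t x" if "s \<le> t" for t using mono[OF that] by (rule less_le_trans)
    then show ?thesis unfolding eventually_at_top_linorder by blast
  qed
  show "\<forall>\<^sub>F t in at_top. value_fun A q f l t x < a" if a: "Sigma_fun A q f l x < a"
  proof -
    have "value_fun A q f l t x < a" if "1 \<le> t" for t
    proof (rule le_less_trans[OF _ a])
      show "value_fun A q f l t x \<le> Sigma_fun A q f l x" unfolding Sigma_fun_def using that by (intro SUP_upper) auto
    qed
    then show ?thesis unfolding eventually_at_top_linorder by blast
  qed
qed

context compact_problem
begin

lemma J_dirac:
  assumes "w \<in> restrict_space borel {0..} \<rightarrow>\<^sub>M restrict_space borel K"
  shows "ennreal (J x (\<lambda>s. return (restrict_space borel K) (w s)) t) = cost F L {0..t} x w"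
proof -
  have w: "w s \<in> K" if "0 \<le> s" for s
    using measurable_space[OF assms, of s] that by (simp add: space_restrict_space)
  have "cost (relax F) (relax L) {0..t} x (\<lambda>s. return (restrict_space borel K) (w s)) = cost F L {0..t} x w"
    by (rule cost_dirac) (auto intro: w)
  then show ?thesis unfolding cost_eq_J[OF dirac_kernel[OF assms]] .
qed

lemma chattering_cost:
  assumes m: "m \<in> kernels K" and K0: "K0 \<subseteq> K" "K \<subseteq> closure K0" and t: "0 \<le> t"
  obtains w :: "nat \<Rightarrow> real \<Rightarrow> 'a" where "\<And>n. w n \<in> borel_measurable borel" "\<And>n. finite (range (w n))" "\<And>n. range (w n) \<subseteq> K0"
    "young_conv K (\<lambda>n s. return (restrict_space borel K) (w n s)) m"
    "(\<lambda>n. cost F L {0..t} x (w n)) \<longlonglongrightarrow> ennreal (J x m t)"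
proof -
  obtain w :: "nat \<Rightarrow> real \<Rightarrow> 'a" where w: "\<And>n. w n \<in> borel_measurable borel" "\<And>n. finite (range (w n))" "\<And>n. range (w n) \<subseteq> K0"
    and Y: "young_conv K (\<lambda>n s. return (restrict_space borel K) (w n s)) m"
    using chattering[OF K m K0] by blast
  have wK: "w n \<in> restrict_space borel {0..} \<rightarrow>\<^sub>M restrict_space borel K" for n
  proof (rule measurable_restrict_space2)
    show "w n \<in> borel_measurable (restrict_space borel {0..})" by (intro measurable_restrict_space1 w)
    show "w n \<in> space (restrict_space borel {0..}) \<rightarrow> K" using w(3)[of n] K0(1) by blast
  qed
  have "(\<lambda>n. J x (\<lambda>s. return (restrict_space borel K) (w n s)) t) \<longlonglongrightarrow> J x m t"
    by (rule cost_stability[OF dirac_kernel[OF wK] m Y tendsto_const t])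
  then have "(\<lambda>n. ennreal (J x (\<lambda>s. return (restrict_space borel K) (w n s)) t)) \<longlonglongrightarrow> ennreal (J x m t)"
    by (rule tendsto_ennrealI)
  then show ?thesis unfolding J_dirac[OF wK] using that[OF w Y] by blast
qed

end

text \<open>\<open>S\<close> maps the time of \<open>F\<close> to the time of \<open>F'\<close>.
  Unique solvability on either side gives it on both, so both trajectories are genuine solutions and
  correspond under \<open>S\<close>; the running costs then follow by substitution.\<close>

lemma (in time_change) cost_transfer:
  fixes F' :: "'b::euclidean_space \<Rightarrow> 'c \<Rightarrow> 'b" and F :: "'b \<Rightarrow> 'a \<Rightarrow> 'b"
  assumes F': "\<And>y. continuous_on {0..} y \<Longrightarrow> (\<lambda>s. F' (y s) (u' s)) \<in> borel_measurable (restrict_space borel {0..})"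
    and L': "\<And>y. continuous_on {0..} y \<Longrightarrow> (\<lambda>s. L' (y s) (u' s)) \<in> borel_measurable (restrict_space borel {0..})"
    and eqF: "\<And>r z. 0 \<le> r \<Longrightarrow> \<rho> r *\<^sub>R F' z (u' (S r)) = F z (u r)"
    and eqL: "\<And>r z. 0 \<le> r \<Longrightarrow> \<rho> r * L' z (u' (S r)) = L z (u r)"
    and ex: "(\<exists>!y. solution (\<lambda>s z. F' z (u' s)) x y) \<or> (\<exists>!y. solution (\<lambda>s z. F z (u s)) x y)"
    and t: "0 \<le> t"
  shows "cost F' L' {0..S t} x u' = cost F L {0..t} x u"
proof -
  have "(\<exists>!y. solution (\<lambda>s z. F' z (u' s)) x y) \<longleftrightarrow> (\<exists>!y. solution (\<lambda>s z. F z (u s)) x y)"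
    by (rule solution_unique_transfer(1)) (rule F', assumption, rule eqF, assumption)
  with ex have ex: "\<exists>!y. solution (\<lambda>s z. F' z (u' s)) x y" "\<exists>!y. solution (\<lambda>s z. F z (u s)) x y"
    by blast+
  have c: "continuous_on {0..} (trajectory F' x u')"
    unfolding trajectory_def by (rule solution_continuous[OF theI'[OF ex(1)]])
  have Y: "trajectory F' x u' (S r) = trajectory F x u r" if "0 \<le> r" for r
    unfolding trajectory_def
    by (rule solution_unique_transfer(2)) (rule F', assumption, rule eqF, assumption, rule ex(2), rule that)
  show ?thesis
    unfolding cost_def
    by (rule nn_cost_transfer[of "\<lambda>s z. L' z (u' s)" "trajectory F' x u'" "\<lambda>r z. L z (u r)" "trajectory F x u" t, OF L'[OF c] eqL Y t])
qed

section \<open>Compactification of an unbounded control cone\<close>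

locale conic_problem =
  fixes A :: "'a::euclidean_space set"
    and f finf :: "'b::euclidean_space \<Rightarrow> 'a \<Rightarrow> 'b" and l linf :: "'b \<Rightarrow> 'a \<Rightarrow> real"
    and p q :: nat and M C1 C2 :: real and LR MR :: "real \<Rightarrow> real"
  assumes A: "\<not> bounded A" "closed A" "cone A" "0 \<in> A"
    and f_cont: "continuous_on (UNIV \<times> A) (\<lambda>(x, a). f x a)"
    and l_cont: "continuous_on (UNIV \<times> A) (\<lambda>(x, a). l x a)"
    and pq: "1 \<le> p" "p \<le> q"
    and M: "0 < M"
    and LR: "\<And>R. 0 < R \<Longrightarrow> 0 < LR R"
    and f_lip: "\<And>R a x1 x2. \<lbrakk>0 < R; a \<in> A; norm x1 \<le> R; norm x2 \<le> R\<rbrakk> \<Longrightarrow>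
                  norm (f x1 a - f x2 a) \<le> LR R * (1 + norm a ^ p) * norm (x1 - x2)"
    and l_nonneg: "\<And>a x. a \<in> A \<Longrightarrow> 0 \<le> l x a"
    and f_growth: "\<And>x a. a \<in> A \<Longrightarrow> norm (f x a) \<le> M * (1 + norm a ^ p) * (1 + norm x)"
    and C: "0 \<le> C1" "0 < C2"
    and coercive: "\<And>x a. a \<in> A \<Longrightarrow> C2 * norm a ^ q - C1 \<le> l x a"
    and f_rec: "is_recession A q f finf"
    and l_rec: "is_recession A q l linf"
begin

definition "K = cball 0 1 \<inter> A"
text \<open>The values reached by ordinary controls; on the rest of \<open>K\<close>, where
  \<open>|w| = 1\<close>, original time stands still.\<close>

definition "K0 = {w \<in> K. norm w < 1}"
definition "w0 w = root q (1 - norm (w :: 'a) ^ q)"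
text \<open>On \<open>K0\<close> the inverse of the map that sends \<open>a\<close> to
  \<open>a / (1 + |a|^q)^(1/q)\<close>.\<close>

definition "slow w = inverse (w0 w) *\<^sub>R (w :: 'a)"
definition ext :: "('b \<Rightarrow> 'a \<Rightarrow> 'c) \<Rightarrow> ('b \<Rightarrow> 'a \<Rightarrow> 'c) \<Rightarrow> 'b \<Rightarrow> 'a \<Rightarrow> 'c::euclidean_space" where
  "ext \<Phi> \<Phi>inf x w = extended q \<Phi> \<Phi>inf x (w0 w) w"

lemma q0: "0 < q" using pq by simp

lemma K_compact: "compact K" unfolding K_def using A(2) by (intro compact_Int_closed) auto
lemma K_ne: "K \<noteq> {}"
proof -
  have "0 \<in> K" using A(4) by (simp add: K_def)
  then show ?thesis by blast
qed

lemma K_norm: "w \<in> K \<Longrightarrow> norm w ^ q \<le> 1" by (auto simp: K_def power_le_one)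

lemma w0: assumes "w \<in> K" shows "0 \<le> w0 w" "w0 w ^ q = 1 - norm w ^ q"
  using K_norm[OF assms] q0 by (auto simp: w0_def real_root_ge_zero)

lemma K0_less: "w \<in> K0 \<Longrightarrow> norm w ^ q < 1" using q0 by (auto simp: K0_def power_less_one_iff)

lemma w0_pos: "w \<in> K0 \<Longrightarrow> 0 < w0 w" using K0_less[of w] q0 by (auto simp: w0_def)

lemma slow_A: "w \<in> K0 \<Longrightarrow> slow w \<in> A"
  unfolding slow_def using A(3) w0_pos[of w] by (auto simp: cone_def K0_def K_def)

lemma ext_K0: "w \<in> K0 \<Longrightarrow> ext \<Phi> \<Phi>inf x w = (1 - norm w ^ q) *\<^sub>R \<Phi> x (slow w)"
  using w0_pos[of w] w0(2)[of w] by (auto simp: ext_def extended_def slow_def K0_def)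

text \<open>The rate \<open>1 - |w|^q\<close> of original time is the reciprocal of the speed
  \<open>1 + |a|^q\<close> at \<open>a = slow w\<close>.\<close>

lemma norm_slow: "w \<in> K0 \<Longrightarrow> (1 - norm w ^ q) * (1 + norm (slow w) ^ q) = 1"
proof -
  assume w: "w \<in> K0"
  have "norm (slow w) ^ q = norm w ^ q / w0 w ^ q"
    using w0_pos[OF w] by (simp add: slow_def power_mult_distrib power_inverse divide_inverse mult.commute)
  also have "w0 w ^ q = 1 - norm w ^ q" using w by (intro w0(2)) (simp add: K0_def)
  finally show ?thesis using K0_less[OF w] by (simp add: distrib_left)
qed

text \<open>From \<open>r^p \<le> 1 + r^q\<close> for \<open>p \<le> q\<close>: the weight of order
  \<open>q\<close> absorbs growth of order \<open>p\<close> uniformly up to \<open>|w| = 1\<close>.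
  This is the source of the factor 2 in the constants of the compactified problem.\<close>

lemma norm_slow_p: assumes w: "w \<in> K0" shows "(1 - norm w ^ q) * (1 + norm (slow w) ^ p) \<le> 2"
proof -
  have "norm (slow w) ^ p \<le> 1 + norm (slow w) ^ q"
  proof (cases "norm (slow w) \<le> 1")
    case True
    then have "norm (slow w) ^ p \<le> 1" by (simp add: power_le_one)
    moreover have "0 \<le> norm (slow w) ^ q" by simp
    ultimately show ?thesis by linarith
  next
    case False
    then have "norm (slow w) ^ p \<le> norm (slow w) ^ q" using pq by (intro power_increasing) auto
    then show ?thesis by linarith
  qed
  then have "(1 - norm w ^ q) * (1 + norm (slow w) ^ p) \<le> (1 - norm w ^ q) * (1 + (1 + norm (slow w) ^ q))"
    using K0_less[OF w] by (intro mult_left_mono) auto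
  also have "\<dots> = (1 - norm w ^ q) + 1" using norm_slow[OF w] by (simp add: algebra_simps)
  also have "\<dots> \<le> 2" by simp
  finally show ?thesis .
qed

lemma K0_sub: "K0 \<subseteq> K" by (auto simp: K0_def)

text \<open>Shrinking towards 0 stays in the cone and makes the norm smaller than 1.\<close>

lemma K0_dense: "K \<subseteq> closure K0"
proof
  fix w assume w: "w \<in> K"
  show "w \<in> closure K0"
    unfolding closure_approachable
  proof (intro allI impI)
    fix e :: real assume e: "0 < e"
    \<comment> \<open>The \<open>1/2\<close> keeps the factor nonnegative, the \<open>e/2\<close>
      keeps the displacement below \<open>e\<close>.\<close>
    define c where "c = 1 - min (1/2) (e/2)"
    have c: "0 \<le> c" "c < 1" "1 - c < e" using e by (auto simp: c_def min_def)
    have w1: "norm w \<le> 1" "w \<in> A" using w by (auto simp: K_def)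
    have "norm (c *\<^sub>R w) \<le> c * 1" using c w1 by (simp add: mult_left_le)
    then have "norm (c *\<^sub>R w) < 1" using c by linarith
    moreover have "c *\<^sub>R w \<in> A" using A(3) w1 c by (auto simp: cone_def)
    ultimately have "c *\<^sub>R w \<in> K0" by (auto simp: K0_def K_def)
    moreover have "dist (c *\<^sub>R w) w < e"
    proof -
      have "dist (c *\<^sub>R w) w = norm ((1 - c) *\<^sub>R w)" by (simp add: dist_norm norm_minus_commute scaleR_left_diff_distrib)
      also have "\<dots> \<le> (1 - c) * 1" using c w1 by (simp add: mult_left_le)
      also have "\<dots> < e" using c(3) by simp
      finally show ?thesis .
    qed
    ultimately show "\<exists>y\<in>K0. dist y w < e" by blast
  qed
qed

text \<open>Estimates are verified on \<open>K0\<close>, where the extended data are explicit, and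
  reach \<open>|w| = 1\<close> by density and continuity. So the recession functions are never
  estimated directly.\<close>

lemma le_on_K:
  fixes \<phi> \<psi> :: "'a \<Rightarrow> real"
  assumes "continuous_on K \<phi>" "continuous_on K \<psi>" "\<And>w. w \<in> K0 \<Longrightarrow> \<phi> w \<le> \<psi> w" "w \<in> K"
  shows "\<phi> w \<le> \<psi> w"
proof -
  have cl: "closure K0 = K"
    using K0_dense closure_minimal[OF K0_sub compact_imp_closed[OF K_compact]] by auto
  have "\<psi> w - \<phi> w \<ge> 0"
  proof (rule continuous_ge_on_closure[of K0 "\<lambda>w. \<psi> w - \<phi> w"])
    show "continuous_on (closure K0) (\<lambda>w. \<psi> w - \<phi> w)" unfolding cl using assms by (intro continuous_intros)
  qed (use assms cl in auto)
  then show ?thesis by simp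
qed

lemma w0_cont: "continuous_on S w0"
  unfolding w0_def[abs_def] by (intro continuous_intros)

text \<open>Near a point with \<open>|w| < 1\<close> this is a composition of continuous maps. At
  \<open>|w| = 1\<close> the value is that of the recession function. A nearby value with
  \<open>w0 > 0\<close> is close to the recession function at the same point, by the uniform limit
  taken at \<open>\<rho> = w0\<close>, and the recession function is continuous.\<close>

lemma ext_cont:
  fixes \<Phi> :: "'b \<Rightarrow> 'a \<Rightarrow> 'c::euclidean_space"
  assumes \<Phi>: "continuous_on (UNIV \<times> A) (\<lambda>(x, a). \<Phi> x a)" and rec: "is_recession A q \<Phi> \<Phi>inf"
  shows "continuous_on (UNIV \<times> K) (\<lambda>(x, w). ext \<Phi> \<Phi>inf x w)"
  unfolding continuous_on_eq_continuous_within
proof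
  let ?G = "\<lambda>(x, w). ext \<Phi> \<Phi>inf x w"
  have c0: "continuous_on (UNIV \<times> K0) ?G"
  proof -
    have s: "continuous_on (UNIV \<times> K0) (\<lambda>xw. slow (snd xw))"
      unfolding slow_def using w0_pos
      by (intro continuous_intros continuous_on_compose2[OF w0_cont[of UNIV]]) (auto simp: less_imp_neq[THEN not_sym])
    have "continuous_on (UNIV \<times> K0) (\<lambda>xw. (fst xw, slow (snd xw)))"
      by (intro continuous_intros s)
    moreover have "(\<lambda>xw. (fst xw, slow (snd xw))) ` (UNIV \<times> K0) \<subseteq> UNIV \<times> A"
      using slow_A by (intro image_subsetI) (auto simp: mem_Times_iff)
    ultimately have "continuous_on (UNIV \<times> K0) (\<lambda>xw. \<Phi> (fst xw) (slow (snd xw)))"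
      using continuous_on_compose2[OF \<Phi>] by fastforce
    then have "continuous_on (UNIV \<times> K0) (\<lambda>xw. (1 - norm (snd xw) ^ q) *\<^sub>R \<Phi> (fst xw) (slow (snd xw)))"
      by (intro continuous_intros)
    then show ?thesis by (rule continuous_on_eq) (auto simp: ext_K0)
  qed
  fix z :: "'b \<times> 'a" assume z: "z \<in> UNIV \<times> K"
  obtain x w where xw: "z = (x, w)" "w \<in> K" using z by auto
  show "continuous (at z within UNIV \<times> K) ?G"
  proof (cases "norm w < 1")
    case True
    have "at z within UNIV \<times> K = at z within UNIV \<times> K0"
    proof (rule at_within_nhd)
      show "open (UNIV \<times> ball (0::'a) 1 :: ('b \<times> 'a) set)" by (intro open_Times) auto
      show "z \<in> UNIV \<times> ball 0 1" using True xw by simp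
    qed (auto simp: K0_def)
    then show ?thesis using c0 True xw by (auto simp: continuous_on_eq_continuous_within K0_def)
  next
    case False
    then have w1: "norm w = 1" using xw by (auto simp: K_def)
    have w00: "w0 w = 0" by (simp add: w0_def w1)
    have Gz: "?G z = \<Phi>inf x w" by (simp add: xw ext_def extended_def w00)
    \<comment> \<open>A compact set containing all nearby points of the domain, on which the limit
      is uniform.\<close>
    define P where "P = cball x 1 \<times> K"
    have P: "compact P" "P \<subseteq> UNIV \<times> A" unfolding P_def using K_compact by (auto intro!: compact_Times simp: K_def)
    have unif: "uniform_limit P (\<lambda>\<rho> (x, a). \<rho> ^ q *\<^sub>R \<Phi> x (inverse \<rho> *\<^sub>R a)) (\<lambda>(x, a). \<Phi>inf x a) (at_right 0)"
      and \<Phi>inf: "continuous_on (UNIV \<times> A) (\<lambda>(x, a). \<Phi>inf x a)"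
      using rec P unfolding is_recession_def by auto
    have zA: "z \<in> UNIV \<times> A" using xw by (auto simp: K_def)
    show ?thesis
      unfolding continuous_within_eps_delta
    proof (intro allI impI)
      fix e :: real assume e: "0 < e"
      have "\<forall>\<^sub>F \<rho> in at_right 0. \<forall>z'\<in>P. dist (case z' of (x, a) \<Rightarrow> \<rho> ^ q *\<^sub>R \<Phi> x (inverse \<rho> *\<^sub>R a)) (case z' of (x, a) \<Rightarrow> \<Phi>inf x a) < e / 2"
        using uniform_limitD[OF unif, of "e/2"] e by (simp add: case_prod_unfold)
      then obtain d1 where d1: "0 < d1" "\<And>\<rho> z'. 0 < \<rho> \<Longrightarrow> \<rho> < d1 \<Longrightarrow> z' \<in> P \<Longrightarrow>
          dist (case z' of (x, a) \<Rightarrow> \<rho> ^ q *\<^sub>R \<Phi> x (inverse \<rho> *\<^sub>R a)) (case z' of (x, a) \<Rightarrow> \<Phi>inf x a) < e / 2"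
        unfolding eventually_at_right_field by blast
      obtain d2 where d2: "0 < d2" "\<And>z'. z' \<in> UNIV \<times> A \<Longrightarrow> dist z' z < d2 \<Longrightarrow> dist (case z' of (x, a) \<Rightarrow> \<Phi>inf x a) (case z of (x, a) \<Rightarrow> \<Phi>inf x a) < e / 2"
        using \<Phi>inf zA e unfolding continuous_on_iff by (metis half_gt_zero)
      obtain d3 where d3: "0 < d3" "\<And>w'. dist w' w < d3 \<Longrightarrow> dist (w0 w') (w0 w) < d1"
        using w0_cont[of UNIV] d1(1) unfolding continuous_on_iff by (metis UNIV_I)
      show "\<exists>d>0. \<forall>z'\<in>UNIV \<times> K. dist z' z < d \<longrightarrow> dist (?G z') (?G z) < e"
      proof (intro exI[of _ "min 1 (min d2 d3)"] conjI ballI impI)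
        fix z' assume z': "z' \<in> UNIV \<times> K" "dist z' z < min 1 (min d2 d3)"
        obtain x' w' where xw': "z' = (x', w')" "w' \<in> K" using z'(1) by auto
        have "dist x' x \<le> dist z' z" "dist w' w \<le> dist z' z"
          using dist_fst_le[of z' z] dist_snd_le[of z' z] by (simp_all add: xw xw')
        then have dd: "dist x' x < 1" "dist w' w < d3" using z'(2) by auto
        have P': "z' \<in> P" using dd xw' by (auto simp: P_def dist_commute)
        have "dist (\<Phi>inf x' w') (\<Phi>inf x w) < e / 2"
          using d2(2)[of z'] z'(2) xw xw' by (auto simp: K_def)
        moreover have "dist (?G z') (\<Phi>inf x' w') < e / 2"
        proof (cases "w0 w' = 0")
          case True then show ?thesis using e by (simp add: xw' ext_def extended_def)
        next
          case False
          then have "0 < w0 w'" using w0(1)[OF xw'(2)] by simp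
          moreover have "w0 w' < d1" using d3(2)[OF dd(2)] w00 by (simp add: dist_real_def)
          ultimately show ?thesis using d1(2)[OF _ _ P'] False by (simp add: xw' ext_def extended_def)
        qed
        ultimately show "dist (?G z') (?G z) < e"
          unfolding Gz using dist_triangle[of "?G z'" "\<Phi>inf x w" "\<Phi>inf x' w'"] by linarith
      qed (use d2 d3 in auto)
    qed
  qed
qed

lemma ext_sec:
  fixes \<Phi> :: "'b \<Rightarrow> 'a \<Rightarrow> 'c::euclidean_space"
  assumes "continuous_on (UNIV \<times> A) (\<lambda>(x, a). \<Phi> x a)" "is_recession A q \<Phi> \<Phi>inf"
  shows "continuous_on K (ext \<Phi> \<Phi>inf x)"
proof -
  have "continuous_on K (\<lambda>a. (x, a))" by (intro continuous_intros)
  from continuous_on_compose2[OF ext_cont[OF assms] this] show ?thesis by auto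
qed

text \<open>The coercivity bound multiplied by \<open>1 - |w|^q\<close> and rewritten with
  \<open>norm_slow\<close>: where original time runs slowly, the cost rate is at least nearly
  \<open>C2\<close>.\<close>

lemma ext_coercive:
  assumes "w \<in> K"
  shows "C2 - (C1 + C2) * (1 - norm w ^ q) \<le> ext l linf x w"
proof (rule le_on_K[OF _ ext_sec[OF l_cont l_rec] _ assms])
  show "continuous_on K (\<lambda>w. C2 - (C1 + C2) * (1 - norm w ^ q))" by (intro continuous_intros)
  fix w assume w: "w \<in> K0"
  have pos: "0 < 1 - norm w ^ q" using K0_less[OF w] by simp
  have "(1 - norm w ^ q) * (C2 * norm (slow w) ^ q - C1) \<le> (1 - norm w ^ q) * l x (slow w)"
    using pos coercive[OF slow_A[OF w]] by (intro mult_left_mono) auto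
  moreover have "(1 - norm w ^ q) * (C2 * norm (slow w) ^ q - C1) = C2 * ((1 - norm w ^ q) * (1 + norm (slow w) ^ q)) - (C1 + C2) * (1 - norm w ^ q)"
    by (simp add: algebra_simps)
  ultimately show "C2 - (C1 + C2) * (1 - norm w ^ q) \<le> ext l linf x w"
    unfolding norm_slow[OF w] by (simp add: ext_K0[OF w])
qed

text \<open>The bounds of order \<open>p\<close> on \<open>f\<close> become uniform in
  \<open>w\<close>, with the factor 2 from \<open>norm_slow_p\<close>.\<close>

sublocale compact_problem K "ext f finf" "ext l linf" "2 * M" "\<lambda>R. 2 * LR R"
proof
  show "compact K" "K \<noteq> {}" by (rule K_compact, rule K_ne)
  show "continuous_on (UNIV \<times> K) (\<lambda>(x, a). ext f finf x a)" by (rule ext_cont[OF f_cont f_rec])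
  show "continuous_on (UNIV \<times> K) (\<lambda>(x, a). ext l linf x a)" by (rule ext_cont[OF l_cont l_rec])
  show "0 < 2 * LR R" if "0 < R" for R using LR[OF that] by simp
  show "0 < 2 * M" using M by simp
  show "norm (ext f finf x1 a - ext f finf x2 a) \<le> 2 * LR R * norm (x1 - x2)"
    if R: "0 < R" and a: "a \<in> K" and x: "norm x1 \<le> R" "norm x2 \<le> R" for R a x1 x2
  proof (rule le_on_K[where w=a, OF _ _ _ a])
    show "continuous_on K (\<lambda>a. norm (ext f finf x1 a - ext f finf x2 a))"
      by (intro continuous_intros ext_sec[OF f_cont f_rec])
    fix w assume w: "w \<in> K0"
    have pos: "0 < 1 - norm w ^ q" using K0_less[OF w] by simp
    have "norm (ext f finf x1 w - ext f finf x2 w) = (1 - norm w ^ q) * norm (f x1 (slow w) - f x2 (slow w))"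
      using pos by (simp add: ext_K0[OF w] scaleR_diff_right[symmetric])
    also have "\<dots> \<le> (1 - norm w ^ q) * (LR R * (1 + norm (slow w) ^ p) * norm (x1 - x2))"
      using pos f_lip[OF R slow_A[OF w] x] by (intro mult_left_mono) auto
    also have "\<dots> = ((1 - norm w ^ q) * (1 + norm (slow w) ^ p)) * (LR R * norm (x1 - x2))" by (simp add: mult_ac)
    also have "\<dots> \<le> 2 * (LR R * norm (x1 - x2))"
      using norm_slow_p[OF w] LR[OF R] by (intro mult_right_mono) auto
    finally show "norm (ext f finf x1 w - ext f finf x2 w) \<le> 2 * LR R * norm (x1 - x2)" by simp
  qed (intro continuous_intros)
  show "norm (ext f finf x a) \<le> 2 * M * (1 + norm x)" if a: "a \<in> K" for x a
  proof (rule le_on_K[where w=a, OF _ _ _ a])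
    show "continuous_on K (\<lambda>a. norm (ext f finf x a))"
      by (intro continuous_intros ext_sec[OF f_cont f_rec])
    fix w assume w: "w \<in> K0"
    have pos: "0 < 1 - norm w ^ q" using K0_less[OF w] by simp
    have "norm (ext f finf x w) = (1 - norm w ^ q) * norm (f x (slow w))"
      using pos by (simp add: ext_K0[OF w])
    also have "\<dots> \<le> (1 - norm w ^ q) * (M * (1 + norm (slow w) ^ p) * (1 + norm x))"
      using pos f_growth[OF slow_A[OF w]] by (intro mult_left_mono) auto
    also have "\<dots> = ((1 - norm w ^ q) * (1 + norm (slow w) ^ p)) * (M * (1 + norm x))" by (simp add: mult_ac)
    also have "\<dots> \<le> 2 * (M * (1 + norm x))"
      using norm_slow_p[OF w] M by (intro mult_right_mono) auto
    finally show "norm (ext f finf x w) \<le> 2 * M * (1 + norm x)" by simp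
  qed (intro continuous_intros)
  show "0 \<le> ext l linf x a" if a: "a \<in> K" for x a
  proof (rule le_on_K[where w=a and \<phi>="\<lambda>_. 0", OF _ ext_sec[OF l_cont l_rec] _ a])
    fix w assume w: "w \<in> K0"
    show "0 \<le> ext l linf x w"
      using K0_less[OF w] l_nonneg[OF slow_A[OF w]] by (simp add: ext_K0[OF w])
  qed (intro continuous_intros)
qed

section \<open>Transfer of controls between original and compactified time\<close>

text \<open>The speed \<open>1 + |\<alpha>|^q\<close> is at least 1, so \<open>S t \<ge> t\<close>.
  The transformed control has the same cost on \<open>[0, S t]\<close> as \<open>\<alpha>\<close> on
  \<open>[0, t]\<close>, hence no larger cost on \<open>[0, t]\<close>.\<close>

lemma value_upper:
  assumes t: "0 < t" and less: "value_fun A q f l t x < c"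
  shows "\<exists>m\<in>kernels K. ennreal (J x m t) \<le> c"
proof -
  have "\<not> compact A" using A(1) compact_imp_bounded by blast
  moreover obtain \<alpha> where "\<alpha> \<in> controls A q" and cost: "cost f l {0..t} x \<alpha> < c"
    using less unfolding value_fun_def INF_less_iff by blast
  ultimately have \<alpha>: "\<alpha> \<in> restrict_space borel {0..} \<rightarrow>\<^sub>M restrict_space borel A"
    and \<alpha>i: "\<And>T. 0 < T \<Longrightarrow> set_integrable lebesgue {0..T} (\<lambda>\<tau>. norm (\<alpha> \<tau>) ^ q)"
    unfolding controls_def by blast+
  have \<alpha>A: "\<alpha> s \<in> A" if "0 \<le> s" for s using measurable_space[OF \<alpha>, of s] that by (simp add: space_restrict_space)
  have \<alpha>b[measurable]: "\<alpha> \<in> borel_measurable (restrict_space borel {0..})"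
    using \<alpha> by (rule measurable_restrict_space2_iff[THEN iffD1, THEN conjunct1])
  \<comment> \<open>The indicator gives the value 1 at negative times, where \<open>\<alpha>\<close>
    is arbitrary.\<close>
  define \<rho> where "\<rho> = (\<lambda>u. 1 + indicator {0..} u *\<^sub>R norm (\<alpha> u) ^ q)"
  have \<rho>1: "1 \<le> \<rho> u" for u by (auto simp: \<rho>_def indicator_def)
  have \<rho>m: "\<rho> \<in> borel_measurable borel"
  proof -
    have "(\<lambda>u. norm (\<alpha> u) ^ q) \<in> borel_measurable (restrict_space borel {0..})" by measurable
    then have "(\<lambda>u. indicator {0..} u *\<^sub>R norm (\<alpha> u) ^ q) \<in> borel_measurable borel"
      by (subst (asm) borel_measurable_restrict_space_iff) auto
    then show ?thesis unfolding \<rho>_def by measurable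
  qed
  interpret tc: time_change \<rho> 1
  proof
    show "set_integrable lebesgue {0..s} \<rho>" if "0 \<le> s" for s
    proof -
      have 1: "set_integrable lebesgue {0..s} (\<lambda>_. 1 :: real)"
        by (rule set_integrable_halfline_Icc[where C=1]) auto
      have 2: "set_integrable lebesgue {0..s} (\<lambda>\<tau>. norm (\<alpha> \<tau>) ^ q)"
        using that by (intro set_integrable_subset[OF \<alpha>i[of "s + 1"]]) auto
      have "indicator {0..s} u *\<^sub>R (1 + norm (\<alpha> u) ^ q) = indicator {0..s} u *\<^sub>R \<rho> u" for u
        by (auto simp: \<rho>_def indicator_def)
      then show ?thesis using set_integral_add(1)[OF 1 2] unfolding set_integrable_def by (simp only:)
    qed
  qed (use \<rho>1 \<rho>m in auto)
  have St: "t \<le> tc.S t" using tc.S_diff[of 0 t] t by simp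
  \<comment> \<open>The inverse of \<open>slow\<close>, applied to \<open>\<alpha>\<close> and read
    in the new time.\<close>
  define w where "w = (\<lambda>s. inverse (root q (\<rho> (tc.T s))) *\<^sub>R \<alpha> (tc.T s))"
  have r: "0 < root q (\<rho> u)" "root q (\<rho> u) ^ q = \<rho> u" for u using \<rho>1[of u] q0 by auto
  have nw: "norm (inverse (root q (\<rho> u)) *\<^sub>R \<alpha> u) ^ q = 1 - 1 / \<rho> u" if "0 \<le> u" for u
  proof -
    have "norm (inverse (root q (\<rho> u)) *\<^sub>R \<alpha> u) ^ q = norm (\<alpha> u) ^ q / root q (\<rho> u) ^ q"
      using r(1)[of u] by (simp add: power_mult_distrib power_inverse divide_inverse mult.commute)
    also have "\<dots> = (\<rho> u - 1) / \<rho> u" unfolding r(2) using that by (simp add: \<rho>_def)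
    finally show ?thesis using \<rho>1[of u] by (simp add: field_simps)
  qed
  have wK0: "inverse (root q (\<rho> u)) *\<^sub>R \<alpha> u \<in> K0" if "0 \<le> u" for u
  proof -
    have "norm (inverse (root q (\<rho> u)) *\<^sub>R \<alpha> u) ^ q < 1" unfolding nw[OF that] using \<rho>1[of u] by simp
    then have "norm (inverse (root q (\<rho> u)) *\<^sub>R \<alpha> u) < 1" using power_less_one_iff[OF norm_ge_zero] q0 by blast
    moreover have "inverse (root q (\<rho> u)) *\<^sub>R \<alpha> u \<in> A"
      using A(3) \<alpha>A[OF that] r(1)[of u] by (auto simp: cone_def)
    ultimately show ?thesis by (auto simp: K0_def K_def)
  qed
  have Tm: "tc.T \<in> restrict_space borel {0..} \<rightarrow>\<^sub>M restrict_space borel {0..}"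
    using borel_measurable_continuous_on_restrict[OF tc.T_cont] tc.T_props(1)
    by (intro measurable_restrict_space2) (auto simp: space_restrict_space)
  have wm: "w \<in> restrict_space borel {0..} \<rightarrow>\<^sub>M restrict_space borel K"
  proof (rule measurable_restrict_space2)
    show "w \<in> space (restrict_space borel {0..}) \<rightarrow> K"
      using wK0 tc.T_props(1) K0_sub by (auto simp: w_def space_restrict_space)
    have [measurable]: "(\<lambda>s. \<alpha> (tc.T s)) \<in> borel_measurable (restrict_space borel {0..})"
      by (rule measurable_compose[OF Tm \<alpha>b])
    have [measurable]: "tc.T \<in> borel_measurable (restrict_space borel {0..})"
      by (rule borel_measurable_continuous_on_restrict[OF tc.T_cont])
    have [measurable]: "(\<lambda>s. \<rho> (tc.T s)) \<in> borel_measurable (restrict_space borel {0..})"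
      by (rule measurable_compose[OF _ \<rho>m]) measurable
    show "w \<in> borel_measurable (restrict_space borel {0..})" unfolding w_def by measurable
  qed
  have key: "\<rho> u *\<^sub>R ext \<Phi> \<Phi>inf z (w (tc.S u)) = \<Phi> z (\<alpha> u)" if u: "0 \<le> u" for \<Phi> \<Phi>inf :: "'b \<Rightarrow> 'a \<Rightarrow> 'd::euclidean_space" and z u
  proof -
    let ?w = "inverse (root q (\<rho> u)) *\<^sub>R \<alpha> u"
    have ws: "w (tc.S u) = ?w" by (simp add: w_def tc.T_S[OF u])
    \<comment> \<open>So \<open>slow\<close> gives back \<open>\<alpha> u\<close>, and the weight
      \<open>1 - |w|^q = 1/\<rho>\<close> cancels the speed.\<close>
    have "w0 ?w = inverse (root q (\<rho> u))"
      unfolding w0_def nw[OF u] by (simp add: real_root_inverse inverse_eq_divide[symmetric])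
    then have "slow ?w = \<alpha> u" using r(1)[of u] by (simp add: slow_def)
    then show ?thesis unfolding ws ext_K0[OF wK0[OF u]] nw[OF u] using \<rho>1[of u] by simp
  qed
  have "cost (ext f finf) (ext l linf) {0..tc.S t} x w = cost f l {0..t} x \<alpha>"
  proof (rule tc.cost_transfer)
    show "(\<lambda>s. ext f finf (y s) (w s)) \<in> borel_measurable (restrict_space borel {0..})" if "continuous_on {0..} y" for y
      by (rule borel_measurable_along[OF F_cont that wm])
    show "(\<lambda>s. ext l linf (y s) (w s)) \<in> borel_measurable (restrict_space borel {0..})" if "continuous_on {0..} y" for y
      by (rule borel_measurable_along[OF L_cont that wm])
    show "\<rho> r *\<^sub>R ext f finf z (w (tc.S r)) = f z (\<alpha> r)" if "0 \<le> r" for r z by (rule key[OF that])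
    show "\<rho> r * ext l linf z (w (tc.S r)) = l z (\<alpha> r)" if "0 \<le> r" for r z
      using key[OF that, of l linf z] by simp
    show "(\<exists>!y. solution (\<lambda>s z. ext f finf z (w s)) x y) \<or> (\<exists>!y. solution (\<lambda>s z. f z (\<alpha> s)) x y)"
      using solution_dirac_ex1[OF wm] by blast
  qed (use t in simp)
  moreover have "cost (ext f finf) (ext l linf) {0..t} x w \<le> cost (ext f finf) (ext l linf) {0..tc.S t} x w"
    using St by (intro cost_mono) auto
  ultimately have "ennreal (J x (\<lambda>s. return (restrict_space borel K) (w s)) t) \<le> c"
    unfolding J_dirac[OF wm] using cost by simp
  then show ?thesis using dirac_kernel[OF wm] by blast
qed

text \<open>The original time that has elapsed at compactified time \<open>s\<close> along the
  relaxed control.\<close>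

definition "clock m s = (LINT r:{0..s}|lebesgue. LINT w|m r. 1 - norm (w :: 'a) ^ q)"

text \<open>Finitely many values in \<open>K0\<close> keep the rate \<open>1 - |w|^q\<close> bounded
  below, so the change back to original time is available, and the control obtained by
  \<open>slow\<close> is bounded, hence admissible. The assumption on the clock says that at
  compactified time \<open>s\<close> original time has reached \<open>t\<close>.\<close>

lemma value_le_simple:
  assumes t: "0 < t" and s: "0 \<le> s" and wm: "w \<in> borel_measurable borel" and fin: "finite (range w)" and wK0: "range w \<subseteq> K0"
    and clock: "t \<le> (LINT r:{0..s}|lebesgue. 1 - norm (w r) ^ q)"
  shows "value_fun A q f l t x \<le> cost (ext f finf) (ext l linf) {0..s} x w"
proof -
  note wm[measurable]
  define \<rho> where "\<rho> = (\<lambda>u. 1 - norm (w u) ^ q)"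
  define \<delta> where "\<delta> = Min (range \<rho>)"
  have fr: "finite (range \<rho>)"
    using finite_imageI[OF fin, of "\<lambda>a. 1 - norm a ^ q"] by (simp add: \<rho>_def image_image)
  have "\<delta> \<in> range \<rho>" unfolding \<delta>_def by (rule Min_in[OF fr]) auto
  then obtain u0 where "\<delta> = \<rho> u0" by blast
  moreover have \<rho>0: "0 < \<rho> u" for u using K0_less[of "w u"] wK0 by (auto simp: \<rho>_def)
  ultimately have \<delta>: "0 < \<delta>" by simp
  have \<delta>le: "\<delta> \<le> \<rho> u" for u unfolding \<delta>_def by (rule Min_le[OF fr]) auto
  have \<rho>m: "\<rho> \<in> borel_measurable borel" unfolding \<rho>_def by measurable
  have \<rho>1: "\<rho> u \<le> 1" for u by (simp add: \<rho>_def)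
  interpret tc: time_change \<rho> \<delta>
  proof
    have "\<rho> \<in> borel_measurable halfline" using \<rho>m by (intro measurable_restrict_space1 measurable_completion) simp
    then show "set_integrable lebesgue {0..r} \<rho>" for r
      by (rule set_integrable_halfline_Icc[where C=1]) (use \<rho>0 \<rho>1 in \<open>auto simp: less_imp_le abs_of_pos\<close>)
  qed (use \<delta> \<delta>le \<rho>m in auto)
  \<comment> \<open>In this direction \<open>S\<close> is original time as a function of
    compactified time.\<close>
  have tS: "t \<le> tc.S s" unfolding tc.S_def unfolding \<rho>_def by (rule clock)
  define \<alpha> where "\<alpha> = (\<lambda>r. slow (w (tc.T r)))"
  have w0m: "w0 \<in> borel_measurable borel" by (rule borel_measurable_continuous_onI[OF w0_cont])
  have slowm: "slow \<in> borel_measurable borel" unfolding slow_def[abs_def] using w0m by measurable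
  have \<alpha>b: "\<alpha> \<in> borel_measurable (restrict_space borel {0..})"
    unfolding \<alpha>_def
    by (rule measurable_compose[OF measurable_compose[OF borel_measurable_continuous_on_restrict[OF tc.T_cont] wm] slowm])
  have \<alpha>m: "\<alpha> \<in> restrict_space borel {0..} \<rightarrow>\<^sub>M restrict_space borel A"
    using \<alpha>b slow_A wK0 by (intro measurable_restrict_space2) (auto simp: \<alpha>_def)
  have "finite (range \<alpha>)"
    by (rule finite_subset[OF _ finite_imageI[OF fin, of slow]]) (auto simp: \<alpha>_def)
  then have "bounded (range \<alpha>)" by (rule finite_imp_bounded)
  then obtain C where C: "\<And>r. norm (\<alpha> r) \<le> C" unfolding bounded_iff by blast
  have "set_integrable lebesgue {0..T} (\<lambda>\<tau>. norm (\<alpha> \<tau>) ^ q)" for T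
  proof (rule set_integrable_halfline_Icc[where C="C ^ q"])
    have "(\<lambda>\<tau>. norm (\<alpha> \<tau>) ^ q) \<in> borel_measurable (restrict_space borel {0..})" using \<alpha>b by measurable
    then have "(\<lambda>\<tau>. indicator {0..} \<tau> *\<^sub>R norm (\<alpha> \<tau>) ^ q) \<in> borel_measurable borel"
      by (subst (asm) borel_measurable_restrict_space_iff) auto
    then have "(\<lambda>\<tau>. indicator {0..} \<tau> *\<^sub>R norm (\<alpha> \<tau>) ^ q) \<in> borel_measurable lebesgue"
      by (intro measurable_completion) simp
    then show "(\<lambda>\<tau>. norm (\<alpha> \<tau>) ^ q) \<in> borel_measurable halfline"
      by (subst borel_measurable_restrict_space_iff) auto
    show "norm (norm (\<alpha> s) ^ q) \<le> C ^ q" for s using C[of s] by (simp add: power_mono)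
  qed simp
  then have "\<alpha> \<in> controls A q" using \<alpha>m by (auto simp: controls_def)
  then have "value_fun A q f l t x \<le> cost f l {0..t} x \<alpha>" unfolding value_fun_def by (rule INF_lower)
  also have "\<dots> \<le> cost f l {0..tc.S s} x \<alpha>" using tS by (intro cost_mono) auto
  also have "\<dots> = cost (ext f finf) (ext l linf) {0..s} x w"
  proof (rule tc.cost_transfer)
    show "(\<lambda>s. f (y s) (\<alpha> s)) \<in> borel_measurable (restrict_space borel {0..})" if "continuous_on {0..} y" for y
      by (rule borel_measurable_along[OF f_cont that \<alpha>m])
    show "(\<lambda>s. l (y s) (\<alpha> s)) \<in> borel_measurable (restrict_space borel {0..})" if "continuous_on {0..} y" for y
      by (rule borel_measurable_along[OF l_cont that \<alpha>m])
    have key: "\<rho> r *\<^sub>R \<Phi> z (\<alpha> (tc.S r)) = ext \<Phi> \<Phi>inf z (w r)" if r: "0 \<le> r" for \<Phi> \<Phi>inf :: "'b \<Rightarrow> 'a \<Rightarrow> 'd::euclidean_space" and z r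
    proof -
      have "w r \<in> K0" using wK0 by blast
      moreover have "\<alpha> (tc.S r) = slow (w r)" by (simp only: \<alpha>_def tc.T_S[OF r])
      ultimately show ?thesis by (simp only: ext_K0 \<rho>_def)
    qed
    show "\<rho> r *\<^sub>R f z (\<alpha> (tc.S r)) = ext f finf z (w r)" if "0 \<le> r" for r z by (rule key[OF that])
    show "\<rho> r * l z (\<alpha> (tc.S r)) = ext l linf z (w r)" if "0 \<le> r" for r z
      using key[OF that, of l z linf] by simp
    have "w \<in> restrict_space borel {0..} \<rightarrow>\<^sub>M restrict_space borel K"
      using wK0 K0_sub by (intro measurable_restrict_space2 measurable_restrict_space1 wm) auto
    then show "(\<exists>!y. solution (\<lambda>s z. f z (\<alpha> s)) x y) \<or> (\<exists>!y. solution (\<lambda>s z. ext f finf z (w s)) x y)"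
      using solution_dirac_ex1 by blast
  qed (rule s)
  finally show ?thesis .
qed

text \<open>Coercivity integrated along the control: while the clock stays bounded, the cost grows
  at least linearly in \<open>s\<close>.\<close>

lemma clock_bound:
  assumes m: "m \<in> kernels K" and s: "0 \<le> s"
  shows "C2 * s - (C1 + C2) * clock m s \<le> J x m s"
proof -
  have c: "continuous_on K (\<lambda>w. 1 - norm w ^ q)" by (intro continuous_intros)
  have cm: "(\<lambda>r. LINT w|m r. 1 - norm w ^ q) \<in> borel_measurable halfline"
    using m unfolding kernels_def by (rule measurable_kernel_integral) (rule borel_measurable_continuous_on_restrict[OF c])
  have le: "C2 - (C1 + C2) * (LINT w|m r. 1 - norm w ^ q) \<le> relax (ext l linf) z (m r)" if r: "0 \<le> r" for r z
  proof -
    interpret prob_space "m r" by (rule kernelsD(1)[OF m r])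
    have i: "integrable (m r) (\<lambda>w. 1 - norm w ^ q)" by (rule integrable_kernel[OF K_compact m r c])
    have "C2 - (C1 + C2) * (LINT w|m r. 1 - norm w ^ q) = (LINT w|m r. C2 - (C1 + C2) * (1 - norm w ^ q))"
      using i by (subst Bochner_Integration.integral_diff) (auto simp: prob_space)
    also have "\<dots> \<le> (LINT w|m r. ext l linf z w)"
    proof (rule integral_mono)
      show "integrable (m r) (\<lambda>w. C2 - (C1 + C2) * (1 - norm w ^ q))" using i by simp
      show "integrable (m r) (ext l linf z)" by (rule integrable_kernel[OF K_compact m r L_sec])
      show "C2 - (C1 + C2) * (1 - norm w ^ q) \<le> ext l linf z w" if "w \<in> space (m r)" for w
        using that kernelsD(3)[OF m r] by (intro ext_coercive) simp
    qed
    finally show ?thesis by (simp add: relax_def)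
  qed
  have ic: "set_integrable lebesgue {0..s} (\<lambda>r. LINT w|m r. 1 - norm w ^ q)"
  proof (rule set_integrable_halfline_Icc[OF cm, where C=1])
    fix r assume "r \<in> {0..s}"
    then show "norm (LINT w|m r. 1 - norm w ^ q) \<le> 1"
      using K_norm kernel_integral_bound(2)[OF m[unfolded kernels_def] borel_measurable_continuous_on_restrict[OF c], of 1 r]
      by (auto simp: space_restrict_space)
  qed simp
  have iC: "set_integrable lebesgue {0..s} (\<lambda>r. C2)" by (rule set_integrable_halfline_Icc[where C="\<bar>C2\<bar>"]) auto
  have im: "set_integrable lebesgue {0..s} (\<lambda>r. (C1 + C2) * (LINT w|m r. 1 - norm w ^ q))" using ic by simp
  have "C2 * s - (C1 + C2) * clock m s = (LINT r:{0..s}|lebesgue. C2 - (C1 + C2) * (LINT w|m r. 1 - norm w ^ q))"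
    unfolding set_integral_diff(2)[OF iC im] clock_def using s by (simp add: set_lebesgue_integral_def)
  also have "\<dots> \<le> J x m s"
    unfolding J_def
    by (rule set_integral_mono[OF set_integral_diff(1)[OF iC im] running_cost_bound[OF m traj_cont[OF m]]]) (use le in auto)
  finally show ?thesis .
qed

text \<open>A bounded clock would make the cost infinite, so the clock exceeds \<open>t\<close> at
  some \<open>s\<close>. The strict inequality survives for the oscillating controls close to
  \<open>m\<close>, to which \<open>value_le_simple\<close> applies.\<close>

lemma value_lower:
  assumes t: "0 < t" and m: "m \<in> kernels K" and fin: "rcost x m < \<top>"
  shows "value_fun A q f l t x \<le> rcost x m"
proof -
  obtain s where s: "0 \<le> s" "t < clock m s"
  proof (rule ccontr)
    assume "\<not> thesis"
    then have le: "clock m s \<le> t" if "0 \<le> s" for s using that \<open>\<not> thesis\<close> \<open>\<And>s. 0 \<le> s \<Longrightarrow> t < clock m s \<Longrightarrow> thesis\<close> by (meson not_le)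
    define r where "r = enn2real (rcost x m)"
    have r: "0 \<le> r" "rcost x m = ennreal r" using fin by (auto simp: r_def less_top)
    have Jr: "J x m s \<le> r" if "0 \<le> s" for s
      using J_le_cost[OF m, of x s] r J_nonneg[OF m that] by (simp add: rcost_def)
    \<comment> \<open>Chosen so that \<open>C2 s - (C1 + C2) t = r + 1\<close>, one more than the
      cost allows.\<close>
    define s where "s = (r + 1 + (C1 + C2) * t) / C2"
    have s: "0 \<le> s" using r C t by (simp add: s_def)
    have "C2 * s - (C1 + C2) * clock m s \<le> r" using clock_bound[OF m s, of x] Jr[OF s] by linarith
    moreover have "(C1 + C2) * clock m s \<le> (C1 + C2) * t" using le[OF s] C by (intro mult_left_mono) auto
    moreover have "C2 * s = r + 1 + (C1 + C2) * t" using C by (simp add: s_def)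
    ultimately show False by linarith
  qed
  obtain w :: "nat \<Rightarrow> real \<Rightarrow> 'a" where w: "\<And>n. w n \<in> borel_measurable borel" "\<And>n. finite (range (w n))" "\<And>n. range (w n) \<subseteq> K0"
    and Y: "young_conv K (\<lambda>n s. return (restrict_space borel K) (w n s)) m"
    and lim: "(\<lambda>n. cost (ext f finf) (ext l linf) {0..s} x (w n)) \<longlonglongrightarrow> ennreal (J x m s)"
    by (rule chattering_cost[OF m K0_sub K0_dense s(1), of x]) blast
  have c: "continuous_on K (\<lambda>w. 1 - norm w ^ q)" by (intro continuous_intros)
  have ret: "(LINT a|return (restrict_space borel K) (w n r). 1 - norm a ^ q) = 1 - norm (w n r) ^ q" for n r
    using w(3)[of n] K0_sub borel_measurable_continuous_on_restrict[OF c]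
    by (intro integral_return) (auto simp: space_restrict_space)
  have "(\<lambda>n. LINT r:{0..s}|lebesgue. 1 - norm (w n r) ^ q) \<longlonglongrightarrow> clock m s"
    using Y c s(1) unfolding young_conv_def clock_def ret[symmetric] by blast
  then have "\<forall>\<^sub>F n in sequentially. t < (LINT r:{0..s}|lebesgue. 1 - norm (w n r) ^ q)"
    using s(2) by (rule order_tendstoD)
  then have "\<forall>\<^sub>F n in sequentially. value_fun A q f l t x \<le> cost (ext f finf) (ext l linf) {0..s} x (w n)"
    by (rule eventually_mono) (rule value_le_simple[OF t s(1) w], simp)
  with lim have "value_fun A q f l t x \<le> ennreal (J x m s)"
    by (rule tendsto_lowerbound) simp
  also have "\<dots> \<le> rcost x m" unfolding rcost_def by (rule J_le_cost[OF m])
  finally show ?thesis .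
qed

lemma relaxed_base_eq: "relaxed_base A = K"
  using A(1) by (simp add: relaxed_base_def K_def)

lemma relaxed_data_eq: "relaxed_data A q \<Phi> \<Phi>inf = relax (ext \<Phi> \<Phi>inf)"
  using A(1) by (simp add: relaxed_data_def ext_def[abs_def] w0_def)

lemma relaxed_cost_eq: "relaxed_cost A q f finf l linf x m = rcost x m"
  by (simp add: relaxed_cost_def rcost_def relaxed_data_eq)

lemma relaxed_value_eq: "relaxed_value A q f finf l linf = rvalue"
  by (simp add: relaxed_value_def rvalue_def fun_eq_iff relaxed_base_eq relaxed_cost_eq relaxed_controls_eq_kernels[OF K_compact])

lemma relaxation:
  "(\<forall>x. ((\<lambda>t. value_fun A q f l t x) \<longlongrightarrow> Sigma_fun A q f l x) at_top \<and>
              Sigma_fun A q f l x = relaxed_value A q f finf l linf x) \<and>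
         lower_semicontinuous (relaxed_value A q f finf l linf) \<and>
         (\<forall>x. \<exists>\<mu>\<in>relaxed_controls (relaxed_base A).
              relaxed_cost A q f finf l linf x \<mu> = relaxed_value A q f finf l linf x)"
proof -
  have \<Sigma>: "Sigma_fun A q f l x = rvalue x" for x
    unfolding Sigma_fun_def by (rule Sup_value_eq) (rule value_upper value_lower; assumption)+
  have "\<exists>m\<in>kernels K. rcost x m = rvalue x" for x
    by (rule optimal_exists[where V="value_fun A q f l"]) (rule value_upper value_lower; assumption)+
  then show ?thesis
    using value_fun_tendsto[of A q f l, unfolded \<Sigma>] rvalue_lsc
    by (simp add: \<Sigma> relaxed_value_eq relaxed_cost_eq relaxed_base_eq relaxed_controls_eq_kernels[OF K_compact])
qed

end

section \<open>The case of a compact control set\<close>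

locale bounded_problem = compact_problem K f l B Lip
  for K :: "'a::euclidean_space set" and f :: "'b::euclidean_space \<Rightarrow> 'a \<Rightarrow> 'b" and l B Lip
begin

text \<open>An ordinary control is a Dirac kernel with the same cost on the same horizon.\<close>

lemma value_upper:
  assumes less: "value_fun K q f l t x < c"
  shows "\<exists>m\<in>kernels K. ennreal (J x m t) \<le> c"
proof -
  obtain \<alpha> where "\<alpha> \<in> controls K q" and cost: "cost f l {0..t} x \<alpha> < c"
    using less unfolding value_fun_def INF_less_iff by blast
  then have \<alpha>: "\<alpha> \<in> restrict_space borel {0..} \<rightarrow>\<^sub>M restrict_space borel K"
    unfolding controls_def by blast
  have "ennreal (J x (\<lambda>s. return (restrict_space borel K) (\<alpha> s)) t) \<le> c"
    unfolding J_dirac[OF \<alpha>] using cost by (rule less_imp_le)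
  then show ?thesis using dirac_kernel[OF \<alpha>] by blast
qed

text \<open>With \<open>K0 = K\<close> every oscillating control is admissible, and the
  approximation takes place on the horizon \<open>t\<close> itself.\<close>

lemma value_lower:
  assumes t: "0 < t" and m: "m \<in> kernels K"
  shows "value_fun K q f l t x \<le> rcost x m"
proof -
  obtain w :: "nat \<Rightarrow> real \<Rightarrow> 'a" where w: "\<And>n. w n \<in> borel_measurable borel" "\<And>n. range (w n) \<subseteq> K"
    and lim: "(\<lambda>n. cost f l {0..t} x (w n)) \<longlonglongrightarrow> ennreal (J x m t)"
    by (rule chattering_cost[OF m order_refl closure_subset less_imp_le[OF t], of x]) blast
  have "w n \<in> controls K q" for n
    using w(2)[of n] K(1) unfolding controls_def
    by (auto intro!: measurable_restrict_space2 measurable_restrict_space1 w(1))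
  then have "value_fun K q f l t x \<le> cost f l {0..t} x (w n)" for n unfolding value_fun_def by (intro INF_lower)
  then have "value_fun K q f l t x \<le> ennreal (J x m t)"
    using lim by (intro tendsto_lowerbound[OF lim]) auto
  also have "\<dots> \<le> rcost x m" unfolding rcost_def by (rule J_le_cost[OF m])
  finally show ?thesis .
qed

lemma relaxation:
  "(\<forall>x. ((\<lambda>t. value_fun K q f l t x) \<longlongrightarrow> Sigma_fun K q f l x) at_top \<and>
              Sigma_fun K q f l x = relaxed_value K q f finf l linf x) \<and>
         lower_semicontinuous (relaxed_value K q f finf l linf) \<and>
         (\<forall>x. \<exists>\<mu>\<in>relaxed_controls (relaxed_base K).
              relaxed_cost K q f finf l linf x \<mu> = relaxed_value K q f finf l linf x)"
proof -
  have b: "bounded K" using K(1) by (rule compact_imp_bounded)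
  have base: "relaxed_base K = K" using b by (simp add: relaxed_base_def)
  have cost: "relaxed_cost K q f finf l linf x m = rcost x m" for x m
    using b by (simp add: relaxed_cost_def rcost_def relaxed_data_def)
  have val: "relaxed_value K q f finf l linf = rvalue"
    by (simp add: relaxed_value_def rvalue_def fun_eq_iff base cost relaxed_controls_eq_kernels[OF K(1)])
  have \<Sigma>: "Sigma_fun K q f l x = rvalue x" for x
    unfolding Sigma_fun_def by (rule Sup_value_eq) (rule value_upper value_lower; assumption)+
  have "\<exists>m\<in>kernels K. rcost x m = rvalue x" for x
    by (rule optimal_exists[where V="value_fun K q f l"]) (rule value_upper value_lower; assumption)+
  then show ?thesis
    using value_fun_tendsto[of K q f l, unfolded \<Sigma>] rvalue_lsc
    by (simp add: \<Sigma> val cost base relaxed_controls_eq_kernels[OF K(1)])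
qed

end

section \<open>Reduction of the theorem to the two cases\<close>

theorem theorem4p1:
  fixes A :: "(real ^ 'm) set"
    and f finf :: "real ^ 'n \<Rightarrow> real ^ 'm \<Rightarrow> real ^ 'n"
    and l linf :: "real ^ 'n \<Rightarrow> real ^ 'm \<Rightarrow> real"
    and p q :: nat
    and M C1 C2 :: real
    and LR MR :: "real \<Rightarrow> real"
    and \<omega> :: "real \<Rightarrow> real \<Rightarrow> real"
  assumes A: "compact A \<and> A \<noteq> {} \<or>
              \<not> bounded A \<and> convex A \<and> closed A \<and> cone A \<and> A \<noteq> {0} \<and> 0 \<in> A"
    and f_cont: "continuous_on (UNIV \<times> A) (\<lambda>(x, a). f x a)"
    and l_cont: "continuous_on (UNIV \<times> A) (\<lambda>(x, a). l x a)"
    and pq: "1 \<le> p" "p \<le> q"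
    and M: "0 < M"
    and LR: "\<And>R. 0 < R \<Longrightarrow> 0 < LR R"
    and MR: "\<And>R. 0 < R \<Longrightarrow> 0 < MR R"
    and \<omega>: "modulus \<omega>"
    and f_lip: "\<And>R a x1 x2. \<lbrakk>0 < R; a \<in> A; norm x1 \<le> R; norm x2 \<le> R\<rbrakk> \<Longrightarrow>
                  norm (f x1 a - f x2 a) \<le> LR R * (1 + norm a ^ p) * norm (x1 - x2)"
    and l_mod: "\<And>R a x1 x2. \<lbrakk>0 < R; a \<in> A; norm x1 \<le> R; norm x2 \<le> R\<rbrakk> \<Longrightarrow>
                  \<bar>l x1 a - l x2 a\<bar> \<le> (1 + norm a ^ q) * \<omega> (norm (x1 - x2)) R"
    and l_bound: "\<And>R a x. \<lbrakk>0 < R; a \<in> A; norm x \<le> R\<rbrakk> \<Longrightarrow>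
                  0 \<le> l x a \<and> l x a \<le> MR R * (1 + norm a ^ q)"
    and f_growth: "\<And>x a. a \<in> A \<Longrightarrow> norm (f x a) \<le> M * (1 + norm a ^ p) * (1 + norm x)"
    and coercive: "\<not> bounded A \<Longrightarrow>
                  0 \<le> C1 \<and> 0 < C2 \<and> (\<forall>x. \<forall>a\<in>A. C2 * norm a ^ q - C1 \<le> l x a)"
    and f_rec: "\<not> bounded A \<Longrightarrow> is_recession A q f finf"
    and l_rec: "\<not> bounded A \<Longrightarrow> is_recession A q l linf"
  shows "(\<forall>x. ((\<lambda>t. value_fun A q f l t x) \<longlongrightarrow> Sigma_fun A q f l x) at_top \<and>
              Sigma_fun A q f l x = relaxed_value A q f finf l linf x) \<and>
         lower_semicontinuous (relaxed_value A q f finf l linf) \<and>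
         (\<forall>x. \<exists>\<mu>\<in>relaxed_controls (relaxed_base A).
              relaxed_cost A q f finf l linf x \<mu> = relaxed_value A q f finf l linf x)"
proof -
  \<comment> \<open>Any positive radius that is at least \<open>|x|\<close> serves; adding 1 makes
    it positive.\<close>
  have l_nonneg: "0 \<le> l x a" if "a \<in> A" for x a
    using l_bound[of "norm x + 1" a x] that norm_ge_zero[of x] by linarith
  show ?thesis
  proof (cases "bounded A")
    case True
    then have K: "compact A" "A \<noteq> {}" using A by auto
    \<comment> \<open>On a bounded control set the factor \<open>1 + |a|^p\<close> is absorbed into
      the constants.\<close>
    obtain N where N: "\<And>a. a \<in> A \<Longrightarrow> norm a \<le> N" using True unfolding bounded_iff by blast
    have N0: "0 \<le> N" using N K(2) norm_ge_zero order_trans by blast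
    have Np: "1 + norm a ^ p \<le> 1 + N ^ p" if "a \<in> A" for a using N[OF that] by (simp add: power_mono)
    interpret bounded_problem A f l "M * (1 + N ^ p)" "\<lambda>R. LR R * (1 + N ^ p)"
    proof unfold_locales
      show "0 < LR R * (1 + N ^ p)" if "0 < R" for R using LR[OF that] N0 by (simp add: add_pos_nonneg)
      show "0 < M * (1 + N ^ p)" using M N0 by (simp add: add_pos_nonneg)
      show "norm (f x1 a - f x2 a) \<le> LR R * (1 + N ^ p) * norm (x1 - x2)"
        if "0 < R" "a \<in> A" "norm x1 \<le> R" "norm x2 \<le> R" for R a x1 x2
        using f_lip[OF that] mult_right_mono[OF mult_left_mono[OF Np[OF that(2)] less_imp_le[OF LR[OF that(1)]]], of "norm (x1 - x2)"]
        by simp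
      show "norm (f x a) \<le> M * (1 + N ^ p) * (1 + norm x)" if "a \<in> A" for x a
        using f_growth[OF that, of x] mult_right_mono[OF mult_left_mono[OF Np[OF that] less_imp_le[OF M]], of "1 + norm x"]
        by (simp add: add_nonneg_nonneg)
    qed (use K f_cont l_cont l_nonneg in auto)
    show ?thesis by (rule relaxation)
  next
    case False
    then have A': "closed A" "cone A" "0 \<in> A" using A compact_imp_bounded by auto
    interpret conic_problem A f finf l linf p q M C1 C2 LR MR
      using False A' f_cont l_cont pq M LR f_lip l_nonneg f_growth coercive f_rec l_rec
      by unfold_locales auto
    show ?thesis by (rule relaxation)
  qed
qed

end
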